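(* Let $\{ G_n \}_{n=1}^{\infty}$ be a sequence of finite graphs, each with a non-empty edge set, and let $\mu$ be an s-graphon. Then the following conditions are equivalent: (1) $\{ G_n \}_{n=1}^{\infty}$ is s-convergent to $\mu$; (2) $\lim_{n\rightarrow\infty} C(G_n) = C(\mu)$ in the Vietoris topology on the hyperspace of compact subsets of $\mathfrak{sG}$.
   Context: $\mathbb{N}=\{1,2,\ldots\}$. $\lambda$ is Lebesgue measure on $[0,1]$ and $\lambda^2$ is Lebesgue measure on $[0,1]^2$. $\mathbb{M}_k$ is the space of real $k\times k$ matrices with the topology of $\mathbb{R}^{k\times k}$. An s-graphon is a symmetric Borel probability measure on $[0,1]^2$ (invariant under $(x,y)\mapsto(y,x)$). $\mathfrak{sG}$ is the space of all s-graphons with the weak topology inherited from the space of Borel probability measures on $[0,1]^2$ (convergence of integrals of continuous functions); it is compact and metrizable. $\mathcal{FDC}$ is the set of continuous functions $f\colon[0,1]^2\to[0,\infty)$ such that for all $x,y\in[0,1]$, $\int_{[0,1]} f(x,v)\,d\lambda(v)=\int_{[0,1]} f(u,y)\,d\lambda(u)=1$. For $f\in\mathcal{FDC}$ and $\mu\in\mathfrak{sG}$ put $\varphi(f,\mu)(u,v)=\int_{[0,1]^2} f(x,u)f(y,v)\,d\mu(x,y)$ for $u,v\in[0,1]$, and let $\Phi(f,\mu)$ be the measure on $[0,1]^2$ with density $\varphi(f,\mu)$ with respect to $\lambda^2$; it is an s-graphon. Shape of an s-graphon: $C(\mu)=\overline{\{\Phi(f,\mu)\colon f\in\mathcal{FDC}\}}\subseteq\mathfrak{sG}$,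 closure in the weak topology; it is compact. $k$-shape of an s-graphon: for $k\in\mathbb{N}$, $C(\mu,k)\subseteq\mathbb{M}_k$ is the closure in $\mathbb{M}_k$ of the set of all matrices $\left(\int_{[0,1]^2} f_i(x)f_j(y)\,d\mu(x,y)\right)_{i,j=1}^k$, where $f_1,\ldots,f_k$ are non-negative Borel functions on $[0,1]$ with $f_1+\cdots+f_k\equiv 1$ and $\int_{[0,1]} f_i\,d\lambda=1/k$ for each $i$; it is compact. For $M\in\mathbb{M}_k$ with non-negative entries, $\mu_M$ is the measure on $[0,1]^2$ absolutely continuous with respect to $\lambda^2$ whose density equals $k^2M(i,j)$ on $\left(\frac{i-1}{k},\frac{i}{k}\right)\times\left(\frac{j-1}{k},\frac{j}{k}\right)$, $i,j=1,\ldots,k$. For a finite graph $G$ with non-empty edge set and $k$ vertices, let $A_G$ be its adjacency matrix and $\widetilde{A}_G=\frac{1}{\|A_G\|_{l^1}}A_G$, where $\|A_G\|_{l^1}$ is the sum of the absolute values of the entries; then $\mu_{\widetilde{A}_G}$ is an s-graphon. The shape of $G$ is $C(G)=C(\mu_{\widetilde{A}_G})$. A sequence $\{G_n\}_{n=1}^\infty$ is s-convergent to an s-graphon $\mu$ if for every $k\in\mathbb{N}$ the $k$-shapes $C(\mu_{\widetilde{A}_{G_n}},k)$ converge to $C(\mu,k)$ as $n\to\infty$ in the Hausdorff distance on compact subsets of $\mathbb{M}_k$. The Vietoris topology on the hyperspace of compact subsets of a metrizable space is the one induced (on nonempty compact sets) by the Hausdorff distance of any compatible metric. *)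

theory Defs
  imports "HOL-Probability.Probability" "Graph_Theory.Digraph"
begin

section \<open>S-graphons and the weak topology\<close>

abbreviation unit_square :: "(real \<times> real) set" where
  "unit_square \<equiv> {0..1} \<times> {0..1}"

definition lambda1 :: "real measure" where
  "lambda1 = restrict_space lborel {0..1}"

definition lambda2 :: "(real \<times> real) measure" where
  "lambda2 = restrict_space lborel unit_square"

definition square_prob_measures :: "(real \<times> real) measure set" where
  "square_prob_measures =
     {\<mu>. prob_space \<mu> \<and> sets \<mu> = sets (restrict_space borel unit_square)}"

definition weak_topology :: "(real \<times> real) measure topology" where
  "weak_topology = topology_generated_by
     {{\<mu> \<in> square_prob_measures. (\<integral>z. f z \<partial>\<mu>) \<in> U} | (f :: real \<times> real \<Rightarrow> real) U.
        continuous_on unit_square f \<and> open U}"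

definition sgraphons :: "(real \<times> real) measure set" where
  "sgraphons = {\<mu> \<in> square_prob_measures. distr \<mu> \<mu> prod.swap = \<mu>}"

definition sgraphon_topology :: "(real \<times> real) measure topology" where
  "sgraphon_topology = subtopology weak_topology sgraphons"

section \<open>Shapes\<close>

text \<open>Functions on the unit square are total functions on the plane; their values outside
  the unit square are irrelevant.\<close>

definition FDC :: "(real \<times> real \<Rightarrow> real) set" where
  "FDC = {f. continuous_on unit_square f \<and> (\<forall>z\<in>unit_square. 0 \<le> f z) \<and>
     (\<forall>x\<in>{0..1}. (\<integral>v. f (x, v) \<partial>lambda1) = 1) \<and>
     (\<forall>y\<in>{0..1}. (\<integral>u. f (u, y) \<partial>lambda1) = 1)}"

definition phi :: "(real \<times> real \<Rightarrow> real) \<Rightarrow> (real \<times> real) measure \<Rightarrow> real \<times> real \<Rightarrow> real" where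
  "phi f \<mu> = (\<lambda>(u, v). \<integral>(x, y). f (x, u) * f (y, v) \<partial>\<mu>)"

definition Phi :: "(real \<times> real \<Rightarrow> real) \<Rightarrow> (real \<times> real) measure \<Rightarrow> (real \<times> real) measure" where
  "Phi f \<mu> = density lambda2 (\<lambda>z. ennreal (phi f \<mu> z))"

definition shape :: "(real \<times> real) measure \<Rightarrow> (real \<times> real) measure set" where
  "shape \<mu> = sgraphon_topology closure_of {Phi f \<mu> | f. f \<in> FDC}"

section \<open>Matrices and k-shapes\<close>

text \<open>A real \<open>k \<times> k\<close> matrix is an extensional function on \<open>{1..k} \<times> {1..k}\<close>.\<close>

definition matrix_topology :: "nat \<Rightarrow> (nat \<times> nat \<Rightarrow> real) topology" where
  "matrix_topology k = product_topology (\<lambda>_. euclideanreal) ({1..k} \<times> {1..k})"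

definition matrix_dist :: "nat \<Rightarrow> (nat \<times> nat \<Rightarrow> real) \<Rightarrow> (nat \<times> nat \<Rightarrow> real) \<Rightarrow> real" where
  "matrix_dist k A B = sqrt (\<Sum>p\<in>{1..k} \<times> {1..k}. (A p - B p)\<^sup>2)"

definition fractional_partitions :: "nat \<Rightarrow> (nat \<Rightarrow> real \<Rightarrow> real) set" where
  "fractional_partitions k = {f.
     (\<forall>i\<in>{1..k}. f i \<in> borel_measurable (restrict_space borel {0..1}) \<and>
        (\<forall>x\<in>{0..1}. 0 \<le> f i x) \<and> (\<integral>x. f i x \<partial>lambda1) = 1 / real k) \<and>
     (\<forall>x\<in>{0..1}. (\<Sum>i=1..k. f i x) = 1)}"

definition k_shape :: "nat \<Rightarrow> (real \<times> real) measure \<Rightarrow> (nat \<times> nat \<Rightarrow> real) set" where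
  "k_shape k \<mu> = matrix_topology k closure_of
     {\<lambda>(i, j)\<in>{1..k} \<times> {1..k}. \<integral>(x, y). f i x * f j y \<partial>\<mu> | f. f \<in> fractional_partitions k}"

section \<open>Hausdorff distance and Vietoris topology\<close>

definition hausdorff_distance :: "('a \<Rightarrow> 'a \<Rightarrow> real) \<Rightarrow> 'a set \<Rightarrow> 'a set \<Rightarrow> real" where
  "hausdorff_distance d A B =
     max (SUP x\<in>A. INF y\<in>B. d x y) (SUP y\<in>B. INF x\<in>A. d x y)"

definition vietoris_topology :: "'a topology \<Rightarrow> 'a set topology" where
  "vietoris_topology X = topology_generated_by
     ({{K. compactin X K \<and> K \<subseteq> U} | U. openin X U} \<union>
      {{K. compactin X K \<and> K \<inter> U \<noteq> {}} | U. openin X U})"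

section \<open>Graphs\<close>

text \<open>The locale \<^locale>\<open>graph\<close> describes finite simple graphs as symmetric digraphs. An adjacency
  matrix depends on an enumeration \<open>e\<close> of the vertices by \<open>{1..k}\<close>, where \<open>k\<close> is their number.\<close>

definition adjacency_matrix :: "('a, 'b) pre_digraph \<Rightarrow> (nat \<Rightarrow> 'a) \<Rightarrow> nat \<times> nat \<Rightarrow> real" where
  "adjacency_matrix G e = (\<lambda>(i, j)\<in>{1..card (verts G)} \<times> {1..card (verts G)}.
     of_bool (e i \<rightarrow>\<^bsub>G\<^esub> e j))"

definition l1_norm :: "nat \<Rightarrow> (nat \<times> nat \<Rightarrow> real) \<Rightarrow> real" where
  "l1_norm k A = (\<Sum>p\<in>{1..k} \<times> {1..k}. \<bar>A p\<bar>)"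

definition normalized_adjacency :: "('a, 'b) pre_digraph \<Rightarrow> (nat \<Rightarrow> 'a) \<Rightarrow> nat \<times> nat \<Rightarrow> real" where
  "normalized_adjacency G e = (\<lambda>p\<in>{1..card (verts G)} \<times> {1..card (verts G)}.
     adjacency_matrix G e p / l1_norm (card (verts G)) (adjacency_matrix G e))"

text \<open>The open cells are disjoint, so at most one summand is nonzero; the grid lines, where the
  density below is 0, form a null set.\<close>

definition matrix_measure :: "nat \<Rightarrow> (nat \<times> nat \<Rightarrow> real) \<Rightarrow> (real \<times> real) measure" where
  "matrix_measure k A = density lambda2 (\<lambda>z. ennreal (\<Sum>i=1..k. \<Sum>j=1..k.
     (real k)\<^sup>2 * A (i, j) *
     indicator ({(real i - 1) / k <..< real i / k} \<times> {(real j - 1) / k <..< real j / k}) z))"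

definition graph_sgraphon :: "('a, 'b) pre_digraph \<Rightarrow> (nat \<Rightarrow> 'a) \<Rightarrow> (real \<times> real) measure" where
  "graph_sgraphon G e = matrix_measure (card (verts G)) (normalized_adjacency G e)"

definition graph_shape :: "('a, 'b) pre_digraph \<Rightarrow> (nat \<Rightarrow> 'a) \<Rightarrow> (real \<times> real) measure set" where
  "graph_shape G e = shape (graph_sgraphon G e)"

definition s_convergent ::
    "(nat \<Rightarrow> ('a, 'b) pre_digraph) \<Rightarrow> (nat \<Rightarrow> nat \<Rightarrow> 'a) \<Rightarrow> (real \<times> real) measure \<Rightarrow> bool" where
  "s_convergent G e \<mu> \<longleftrightarrow> (\<forall>k\<ge>1.
     (\<lambda>n. hausdorff_distance (matrix_dist k) (k_shape k (graph_sgraphon (G n) (e n))) (k_shape k \<mu>))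
       \<longlonglongrightarrow> 0)"

section \<open>Consistency of the topological notions\<close>

lemma limitin_topology_generated_by:
  "limitin (topology_generated_by S) f l F \<longleftrightarrow>
     l \<in> \<Union>S \<and> (\<forall>U\<in>S. l \<in> U \<longrightarrow> (\<forall>\<^sub>F n in F. f n \<in> U))"
proof (intro iffI)
  assume "limitin (topology_generated_by S) f l F"
  then show "l \<in> \<Union>S \<and> (\<forall>U\<in>S. l \<in> U \<longrightarrow> (\<forall>\<^sub>F n in F. f n \<in> U))"
    by (auto simp: limitin_def topology_generated_by_Basis)
next
  assume R: "l \<in> \<Union>S \<and> (\<forall>U\<in>S. l \<in> U \<longrightarrow> (\<forall>\<^sub>F n in F. f n \<in> U))"
  have "l \<in> U \<longrightarrow> (\<forall>\<^sub>F n in F. f n \<in> U)" if "generate_topology_on S U" for U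
    using that
  proof induction
    case (UN K)
    show ?case
    proof
      assume "l \<in> \<Union>K"
      then obtain k where "k \<in> K" "l \<in> k" by auto
      with UN have "\<forall>\<^sub>F n in F. f n \<in> k" by auto
      then show "\<forall>\<^sub>F n in F. f n \<in> \<Union>K"
        by eventually_elim (use \<open>k \<in> K\<close> in auto)
    qed
  qed (use R in \<open>auto simp: eventually_conj_iff\<close>)
  with R show "limitin (topology_generated_by S) f l F"
    by (auto simp: limitin_def openin_topology_generated_by_iff)
qed

lemma limitin_sgraphon_topology:
  assumes "\<mu> \<in> sgraphons" "\<And>n. \<nu> n \<in> sgraphons"
  shows "limitin sgraphon_topology \<nu> \<mu> sequentially \<longleftrightarrow>
    (\<forall>f :: real \<times> real \<Rightarrow> real. continuous_on unit_square f \<longrightarrow>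
       (\<lambda>n. \<integral>z. f z \<partial>\<nu> n) \<longlonglongrightarrow> (\<integral>z. f z \<partial>\<mu>))"
proof -
  have P: "\<mu> \<in> square_prob_measures" "\<And>n. \<nu> n \<in> square_prob_measures"
    using assms by (auto simp: sgraphons_def)
  have "square_prob_measures \<in>
      {{\<mu> \<in> square_prob_measures. (\<integral>z. f z \<partial>\<mu>) \<in> U} | (f :: real \<times> real \<Rightarrow> real) U.
        continuous_on unit_square f \<and> open U}"
    by (rule CollectI, rule exI[of _ "\<lambda>_. 0"], rule exI[of _ UNIV]) simp
  with P(1) have mem: "\<mu> \<in> \<Union>{{\<mu> \<in> square_prob_measures. (\<integral>z. f z \<partial>\<mu>) \<in> U} |
      (f :: real \<times> real \<Rightarrow> real) U. continuous_on unit_square f \<and> open U}"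
    by (rule UnionI[rotated])
  have "limitin sgraphon_topology \<nu> \<mu> sequentially \<longleftrightarrow>
      (\<forall>V\<in>{{\<mu> \<in> square_prob_measures. (\<integral>z. f z \<partial>\<mu>) \<in> U} | (f :: real \<times> real \<Rightarrow> real) U.
        continuous_on unit_square f \<and> open U}.
        \<mu> \<in> V \<longrightarrow> (\<forall>\<^sub>F n in sequentially. \<nu> n \<in> V))"
    unfolding sgraphon_topology_def limitin_subtopology weak_topology_def
      limitin_topology_generated_by
    using assms mem by simp
  also have "\<dots> \<longleftrightarrow> (\<forall>f :: real \<times> real \<Rightarrow> real. \<forall>U. continuous_on unit_square f \<and> open U \<longrightarrow>
      \<mu> \<in> {\<mu> \<in> square_prob_measures. (\<integral>z. f z \<partial>\<mu>) \<in> U} \<longrightarrow>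
      (\<forall>\<^sub>F n in sequentially. \<nu> n \<in> {\<mu> \<in> square_prob_measures. (\<integral>z. f z \<partial>\<mu>) \<in> U}))"
    unfolding Ball_def mem_Collect_eq[of _ "\<lambda>V. \<exists>f U. V = _ f U \<and> _ f U"]
    by blast
  also have "\<dots> \<longleftrightarrow> (\<forall>f :: real \<times> real \<Rightarrow> real. \<forall>U. continuous_on unit_square f \<and> open U \<longrightarrow>
      (\<integral>z. f z \<partial>\<mu>) \<in> U \<longrightarrow> (\<forall>\<^sub>F n in sequentially. (\<integral>z. f z \<partial>\<nu> n) \<in> U))"
    using P by simp
  finally show ?thesis unfolding tendsto_def by blast
qed

lemma Metric_space_matrix_dist:
  "Metric_space (topspace (matrix_topology k)) (matrix_dist k)"
proof
  let ?I = "{1..k} \<times> {1..k}"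
  fix A B C :: "nat \<times> nat \<Rightarrow> real"
  have L2: "matrix_dist k A B = L2_set (\<lambda>p. A p - B p) ?I" for A B
    by (simp add: matrix_dist_def L2_set_def)
  show "0 \<le> matrix_dist k A B" by (simp add: matrix_dist_def sum_nonneg)
  show "matrix_dist k A B = matrix_dist k B A"
    by (simp add: matrix_dist_def power2_commute)
  show "matrix_dist k A C \<le> matrix_dist k A B + matrix_dist k B C"
    using L2_set_triangle_ineq[of "\<lambda>p. A p - B p" "\<lambda>p. B p - C p" ?I] by (simp add: L2)
  assume A: "A \<in> topspace (matrix_topology k)" "B \<in> topspace (matrix_topology k)"
  have "matrix_dist k A B = 0 \<longleftrightarrow> (\<forall>p\<in>?I. A p - B p = 0)"
    unfolding L2 by (rule L2_set_eq_0_iff) simp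
  also have "\<dots> \<longleftrightarrow> A = B"
  proof
    assume eq: "\<forall>p\<in>?I. A p - B p = 0"
    show "A = B"
    proof (rule PiE_ext)
      show "A \<in> PiE ?I (\<lambda>_. UNIV)" "B \<in> PiE ?I (\<lambda>_. UNIV)"
        using A by (simp_all add: matrix_topology_def)
    qed (use eq in force)
  qed simp
  finally show "matrix_dist k A B = 0 \<longleftrightarrow> A = B" .
qed

lemma mtopology_matrix_dist:
  "Metric_space.mtopology (topspace (matrix_topology k)) (matrix_dist k) = matrix_topology k"
proof -
  let ?I = "{1..k} \<times> {1..k}" and ?M = "topspace (matrix_topology k)"
  interpret Metric_space ?M "matrix_dist k" by (rule Metric_space_matrix_dist)
  have M: "?M = PiE ?I (\<lambda>_. UNIV)" by (simp add: matrix_topology_def)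
  have comp: "\<bar>A p - B p\<bar> \<le> matrix_dist k A B" if "p \<in> ?I" for A B p
  proof -
    have "(A p - B p)\<^sup>2 \<le> (\<Sum>p\<in>?I. (A p - B p)\<^sup>2)"
      using that by (intro member_le_sum) auto
    then have "sqrt ((A p - B p)\<^sup>2) \<le> matrix_dist k A B"
      unfolding matrix_dist_def by (rule real_sqrt_le_mono)
    then show ?thesis by simp
  qed
  have up: "matrix_dist k A B \<le> (\<Sum>p\<in>?I. \<bar>A p - B p\<bar>)" for A B
    using L2_set_le_sum_abs[of "\<lambda>p. A p - B p" ?I] by (simp add: matrix_dist_def L2_set_def)
  show ?thesis
  proof (rule topology_eq[THEN iffD2], intro allI iffI)
    fix U assume U: "openin mtopology U"
    show "openin (matrix_topology k) U"
      unfolding matrix_topology_def openin_product_topology_alt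
    proof
      fix A assume "A \<in> U"
      with U obtain r where r: "r > 0" "mball A r \<subseteq> U" and AM: "A \<in> ?M"
        unfolding openin_mtopology by blast
      define s where "s = r / (real (card ?I) + 1)"
      have s: "s > 0" "real (card ?I) * s < r"
        using r by (simp_all add: s_def field_simps add_pos_nonneg)
      define W where "W p = (if p \<in> ?I then ball (A p) s else UNIV)" for p
      have "PiE ?I W \<subseteq> U"
      proof
        fix B assume B: "B \<in> PiE ?I W"
        have BM: "B \<in> ?M" using B by (auto simp: M)
        have "\<bar>A p - B p\<bar> \<le> s" if "p \<in> ?I" for p
          using PiE_mem[OF B that] that by (auto simp: W_def dist_real_def)
        then have "(\<Sum>p\<in>?I. \<bar>A p - B p\<bar>) \<le> real (card ?I) * s"
          by (rule sum_bounded_above)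
        with up[of A B] s have "matrix_dist k A B < r" by linarith
        with AM BM r show "B \<in> U" by auto
      qed
      moreover have "A \<in> PiE ?I W"
        using AM s by (auto simp: M W_def PiE_iff)
      moreover have "finite {i \<in> ?I. W i \<noteq> topspace euclideanreal}"
        by simp
      moreover have "\<forall>i\<in>?I. openin euclideanreal (W i)" by (auto simp: W_def)
      ultimately show "\<exists>W. finite {i \<in> ?I. W i \<noteq> topspace euclideanreal} \<and>
         (\<forall>i\<in>?I. openin euclideanreal (W i)) \<and> A \<in> PiE ?I W \<and> PiE ?I W \<subseteq> U"
        by blast
    qed
  next
    fix U assume U: "openin (matrix_topology k) U"
    show "openin mtopology U"
      unfolding openin_mtopology
    proof (intro conjI allI impI)
      show "U \<subseteq> ?M" using U by (rule openin_subset)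
      fix A assume "A \<in> U"
      with U obtain W where W: "\<forall>i\<in>?I. open (W i)" "A \<in> PiE ?I W" "PiE ?I W \<subseteq> U"
        unfolding matrix_topology_def openin_product_topology_alt by force
      have "\<exists>e>0. ball (A p) e \<subseteq> W p" if "p \<in> ?I" for p
        using W(1) PiE_mem[OF W(2) that] that by (meson open_contains_ball)
      then obtain e where e: "\<And>p. p \<in> ?I \<Longrightarrow> e p > 0 \<and> ball (A p) (e p) \<subseteq> W p"
        by metis
      define r where "r = Min (insert 1 (e ` ?I))"
      have fin: "finite (insert 1 (e ` ?I))" by simp
      have "0 < x" if "x \<in> insert 1 (e ` ?I)" for x
        using that
      proof
        assume "x \<in> e ` ?I"
        then obtain p where "p \<in> ?I" "x = e p" by (rule imageE)
        then show ?thesis using e[of p] by simp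
      qed simp
      from this[OF Min_in[OF fin insert_not_empty]] have "r > 0" unfolding r_def .
      moreover have "r \<le> e p" if "p \<in> ?I" for p
        unfolding r_def by (intro Min_le insertI2 imageI that) simp
      ultimately have r: "r > 0" "\<And>p. p \<in> ?I \<Longrightarrow> r \<le> e p" by blast+
      have "mball A r \<subseteq> U"
      proof
        fix B assume "B \<in> mball A r"
        then have B: "B \<in> ?M" "matrix_dist k A B < r" by auto
        have "B p \<in> W p" if "p \<in> ?I" for p
        proof -
          have "dist (A p) (B p) < e p"
            using comp[OF that, of A B] B r(2)[OF that] by (simp add: dist_real_def)
          then show ?thesis using e[OF that] by auto
        qed
        then have "B \<in> PiE ?I W" using B by (auto simp: M)
        with W show "B \<in> U" by auto
      qed
      with r show "\<exists>r>0. mball A r \<subseteq> U" by blast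
    qed
  qed
qed

context Metric_space
begin

lemma hausdorff_distance_commute: "hausdorff_distance d A B = hausdorff_distance d B A"
  by (simp add: hausdorff_distance_def max.commute commute)

lemma hausdorff_distance_le:
  assumes "A \<noteq> {}" "B \<noteq> {}"
    and "\<And>x. x \<in> A \<Longrightarrow> \<exists>y\<in>B. d x y \<le> r" "\<And>y. y \<in> B \<Longrightarrow> \<exists>x\<in>A. d x y \<le> r"
  shows "hausdorff_distance d A B \<le> r"
proof -
  have bdd: "bdd_below (d x ` S)" "bdd_below ((\<lambda>x. d x y) ` S)" for x y S
    by (auto intro!: bdd_belowI[of _ 0])
  have "(INF y\<in>B. d x y) \<le> r" if "x \<in> A" for x
    using assms(3)[OF that] bdd by (meson cINF_lower order_trans)
  moreover have "(INF x\<in>A. d x y) \<le> r" if "y \<in> B" for y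
    using assms(4)[OF that] bdd by (meson cINF_lower order_trans)
  ultimately show ?thesis
    unfolding hausdorff_distance_def using assms(1,2) by (auto intro!: cSUP_least)
qed

lemma hausdorff_distance_nonneg:
  assumes "compactin mtopology A" "compactin mtopology B" "A \<noteq> {}" "B \<noteq> {}"
  shows "bdd_above ((\<lambda>x. INF y\<in>B. d x y) ` A)" "0 \<le> hausdorff_distance d A B"
proof -
  have bdd: "bdd_below (d x ` S)" for x S
    by (auto intro!: bdd_belowI[of _ 0])
  have "mbounded (A \<union> B)"
    using assms by (simp add: compactin_imp_mbounded mbounded_Un)
  then obtain D where D: "\<And>x y. x \<in> A \<Longrightarrow> y \<in> B \<Longrightarrow> d x y \<le> D"
    unfolding mbounded_alt by blast
  have le: "(INF y\<in>B. d x y) \<le> D" if "x \<in> A" for x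
    using assms(4) D[OF that] bdd by (meson cINF_lower order_trans all_not_in_conv)
  show b: "bdd_above ((\<lambda>x. INF y\<in>B. d x y) ` A)"
    using le by (auto intro!: bdd_aboveI[of _ D])
  obtain x where x: "x \<in> A" using assms by auto
  have "0 \<le> (INF y\<in>B. d x y)" using assms by (auto intro!: cINF_greatest)
  also have "\<dots> \<le> (SUP x\<in>A. INF y\<in>B. d x y)" by (rule cSUP_upper[OF x b])
  finally show "0 \<le> hausdorff_distance d A B" by (simp add: hausdorff_distance_def)
qed

lemma hausdorff_distance_less:
  assumes "compactin mtopology A" "compactin mtopology B" "A \<noteq> {}" "B \<noteq> {}"
    and "hausdorff_distance d A B < r" "x \<in> A"
  shows "\<exists>y\<in>B. d x y < r"
proof -
  have "(INF y\<in>B. d x y) \<le> (SUP x\<in>A. INF y\<in>B. d x y)"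
    using assms hausdorff_distance_nonneg(1) by (intro cSUP_upper) auto
  also have "\<dots> < r" using assms(5) by (simp add: hausdorff_distance_def)
  finally show ?thesis
    using assms(4) by (subst (asm) cINF_less_iff) (auto intro!: bdd_belowI[of _ 0])
qed

lemma limitin_vietoris_iff_hausdorff:
  assumes K: "\<And>n :: nat. compactin mtopology (K n)" "\<And>n. K n \<noteq> {}"
    and L: "compactin mtopology L" "L \<noteq> {}"
  shows "limitin (vietoris_topology mtopology) K L sequentially \<longleftrightarrow>
    (\<lambda>n. hausdorff_distance d (K n) L) \<longlonglongrightarrow> 0"
proof
  assume lim: "limitin (vietoris_topology mtopology) K L sequentially"
  have nbhd: "\<forall>\<^sub>F n in sequentially. K n \<in> V"
    if "openin (vietoris_topology mtopology) V" "L \<in> V" for V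
    using lim that by (simp add: limitin_def)
  have up: "\<forall>\<^sub>F n in sequentially. K n \<subseteq> U" if U: "openin mtopology U" "L \<subseteq> U" for U
  proof -
    have "openin (vietoris_topology mtopology) {K. compactin mtopology K \<and> K \<subseteq> U}"
      unfolding vietoris_topology_def
      by (rule topology_generated_by_Basis, rule UnI1, rule CollectI, rule exI, rule conjI[OF refl U(1)])
    from nbhd[OF this] U L show ?thesis by (simp add: eventually_conj_iff)
  qed
  have hit: "\<forall>\<^sub>F n in sequentially. K n \<inter> U \<noteq> {}"
    if U: "openin mtopology U" "L \<inter> U \<noteq> {}" for U
  proof -
    have "openin (vietoris_topology mtopology) {K. compactin mtopology K \<and> K \<inter> U \<noteq> {}}"
      unfolding vietoris_topology_def
      by (rule topology_generated_by_Basis, rule UnI2, rule CollectI, rule exI, rule conjI[OF refl U(1)])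
    from nbhd[OF this] U L show ?thesis by (simp add: eventually_conj_iff)
  qed
  have LM: "L \<subseteq> M" using L compactin_subset_topspace by fastforce
  show "(\<lambda>n. hausdorff_distance d (K n) L) \<longlonglongrightarrow> 0"
  proof (rule tendstoI)
    fix r :: real assume r: "r > 0"
    define e where "e = r / 3"
    have e: "e > 0" "2 * e < r" using r by (auto simp: e_def)
    let ?B = "(\<lambda>x. mball x e) ` L"
    have "L \<subseteq> \<Union>?B" using e LM by auto
    have "\<exists>F. finite F \<and> F \<subseteq> ?B \<and> L \<subseteq> \<Union>F"
      by (rule compactinD[OF L(1) _ \<open>L \<subseteq> \<Union>?B\<close>]) auto
    then obtain F where F: "finite F" "F \<subseteq> ?B" "L \<subseteq> \<Union>F" by blast
    have 1: "\<forall>\<^sub>F n in sequentially. K n \<subseteq> \<Union>?B"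
      using \<open>L \<subseteq> \<Union>?B\<close> by (intro up openin_Union) auto
    have "\<forall>\<^sub>F n in sequentially. \<forall>V\<in>F. K n \<inter> V \<noteq> {}"
    proof (intro eventually_ball_finite F(1) ballI)
      fix V assume "V \<in> F"
      then obtain x where "x \<in> L" "V = mball x e" using F by auto
      then show "\<forall>\<^sub>F n in sequentially. K n \<inter> V \<noteq> {}"
        using e LM by (intro hit) auto
    qed
    with 1 show "\<forall>\<^sub>F n in sequentially. dist (hausdorff_distance d (K n) L) 0 < r"
    proof eventually_elim
      case (elim n)
      have "hausdorff_distance d (K n) L \<le> 2 * e"
      proof (rule hausdorff_distance_le)
        fix x assume "x \<in> K n"
        then obtain y where "y \<in> L" "d y x < e" using elim(1) by auto
        then show "\<exists>y\<in>L. d x y \<le> 2 * e" using e by (auto simp: commute intro!: bexI[of _ y])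
      next
        fix y assume "y \<in> L"
        with F(3) obtain V where V: "V \<in> F" "y \<in> V" by (meson UnionE subsetD)
        from V(1) F(2) obtain z where z: "V = mball z e" by (meson imageE subsetD)
        from V(1) elim(2) obtain x where x: "x \<in> K n" "x \<in> V" by (meson disjoint_iff)
        have M: "x \<in> M" "y \<in> M" "z \<in> M" and lt: "d z x < e" "d z y < e"
          using x(2) V(2) by (simp_all add: z)
        have "d x y \<le> d x z + d z y" using M by (intro triangle)
        also have "\<dots> \<le> 2 * e" using lt commute[of x z] by linarith
        finally show "\<exists>x\<in>K n. d x y \<le> 2 * e" using x(1) by blast
      qed (use K L in auto)
      then show ?case using hausdorff_distance_nonneg(2)[OF K(1) L(1) K(2) L(2)] e by simp
    qed
  qed
next
  assume lim: "(\<lambda>n. hausdorff_distance d (K n) L) \<longlonglongrightarrow> 0"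
  have ev: "\<forall>\<^sub>F n in sequentially. hausdorff_distance d (K n) L < r" if "r > 0" for r
    using order_tendstoD(2)[OF lim that] .
  have LM: "L \<subseteq> M" using L compactin_subset_topspace by fastforce
  have KM: "K n \<subseteq> M" for n using K compactin_subset_topspace by fastforce
  have up: "\<forall>\<^sub>F n in sequentially. K n \<subseteq> U" if U: "openin mtopology U" "L \<subseteq> U" for U
  proof -
    have "\<forall>x\<in>L. \<exists>r>0. mball x r \<subseteq> U" using U by (auto simp: openin_mtopology)
    then obtain r where r: "\<And>x. x \<in> L \<Longrightarrow> r x > 0 \<and> mball x (r x) \<subseteq> U" by metis
    let ?B = "(\<lambda>x. mball x (r x / 2)) ` L"
    have "L \<subseteq> \<Union>?B" using r LM by force
    have "\<exists>F. finite F \<and> F \<subseteq> ?B \<and> L \<subseteq> \<Union>F"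
      by (rule compactinD[OF L(1) _ \<open>L \<subseteq> \<Union>?B\<close>]) auto
    then obtain F' where F': "finite F'" "F' \<subseteq> ?B" "L \<subseteq> \<Union>F'" by blast
    obtain F where F: "finite F" "F \<subseteq> L" "L \<subseteq> (\<Union>x\<in>F. mball x (r x / 2))"
      using finite_subset_image[OF F'(1,2)] F'(3) by blast
    define s where "s = Min (insert 1 ((\<lambda>x. r x / 2) ` F))"
    have "s > 0" unfolding s_def using F r by (subst Min_gr_iff) auto
    moreover have "s \<le> r x / 2" if "x \<in> F" for x
      unfolding s_def using F(1) that by (intro Min_le) auto
    ultimately have s: "s > 0" "\<And>x. x \<in> F \<Longrightarrow> s \<le> r x / 2" by blast+
    show ?thesis using ev[OF s(1)]
    proof eventually_elim
      case (elim n)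
      show ?case
      proof
        fix x assume x: "x \<in> K n"
        obtain y where y: "y \<in> L" "d x y < s"
          using hausdorff_distance_less[OF K(1) L(1) K(2) L(2) elim x] by auto
        with F(3) obtain z where z: "z \<in> F" "y \<in> mball z (r z / 2)" by (meson UN_E subsetD)
        have M: "x \<in> M" "y \<in> M" "z \<in> M" and lt: "d z y < r z / 2"
          using x KM[of n] z(2) by auto
        have "d z x \<le> d z y + d y x" using M by (intro triangle)
        also have "\<dots> < r z" using lt y(2) s(2)[OF z(1)] commute[of x y] by linarith
        finally have "x \<in> mball z (r z)" using M by simp
        then show "x \<in> U" using r[of z] z(1) F(2) by (meson subsetD)
      qed
    qed
  qed
  have hit: "\<forall>\<^sub>F n in sequentially. K n \<inter> U \<noteq> {}" if U: "openin mtopology U" "L \<inter> U \<noteq> {}" for U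
  proof -
    obtain x r where x: "x \<in> L" "r > 0" "mball x r \<subseteq> U"
      using U unfolding openin_mtopology by blast
    show ?thesis using ev[OF x(2)]
    proof eventually_elim
      case (elim n)
      then have "hausdorff_distance d L (K n) < r"
        by (simp add: hausdorff_distance_commute[of L])
      from hausdorff_distance_less[OF L(1) K(1) L(2) K(2) this x(1)]
      obtain y where y: "y \<in> K n" "d x y < r" by blast
      then have "y \<in> mball x r" using x(1) LM KM[of n] by auto
      then show ?case using x(3) y(1) by blast
    qed
  qed
  let ?S = "{{K. compactin mtopology K \<and> K \<subseteq> U} | U. openin mtopology U} \<union>
      {{K. compactin mtopology K \<and> K \<inter> U \<noteq> {}} | U. openin mtopology U}"
  have "L \<in> {K. compactin mtopology K \<and> K \<subseteq> M}" using L LM by simp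
  moreover have "{K. compactin mtopology K \<and> K \<subseteq> M} \<in> ?S"
    by (rule UnI1, rule CollectI, rule exI[of _ M]) simp
  ultimately have mem: "L \<in> \<Union>?S" by (rule UnionI[rotated])
  have "\<forall>\<^sub>F n in sequentially. K n \<in> V" if V: "V \<in> ?S" "L \<in> V" for V
    using V(1)
  proof
    assume "V \<in> {{K. compactin mtopology K \<and> K \<subseteq> U} | U. openin mtopology U}"
    then obtain U where U: "V = {K. compactin mtopology K \<and> K \<subseteq> U}" "openin mtopology U"
      by (elim CollectE exE conjE)
    with V(2) have "\<forall>\<^sub>F n in sequentially. K n \<subseteq> U" by (intro up) simp_all
    with U K(1) show ?thesis by simp
  next
    assume "V \<in> {{K. compactin mtopology K \<and> K \<inter> U \<noteq> {}} | U. openin mtopology U}"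
    then obtain U where U: "V = {K. compactin mtopology K \<and> K \<inter> U \<noteq> {}}" "openin mtopology U"
      by (elim CollectE exE conjE)
    with V(2) have "\<forall>\<^sub>F n in sequentially. K n \<inter> U \<noteq> {}" by (intro hit) simp_all
    with U K(1) show ?thesis by simp
  qed
  with mem show "limitin (vietoris_topology mtopology) K L sequentially"
    unfolding vietoris_topology_def limitin_topology_generated_by
    by (intro conjI ballI impI)
qed

end

end

theory Submission
  imports Defs
begin

text \<open>
  For a continuous partition of unity \<open>g\<close> with all integrals \<open>1 / k\<close> and smoothed indicator
  functions \<open>h\<close> of the \<open>k\<close> cells of \<open>[0,1]\<close>, the kernel \<open>\<Sum>i. k * g i x * h i u\<close> lies in \<open>FDC\<close>,
  and its action on \<open>\<mu>\<close> has density \<open>\<Sum>i j. k\<^sup>2 * M (i, j) * h i u * h j v\<close>, where \<open>M\<close> is the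
  matrix of \<open>g\<close> and \<open>\<mu>\<close>. Testing this measure against \<open>h\<close> returns \<open>M\<close> up to an error independent
  of \<open>\<mu>\<close> and \<open>g\<close>; conversely, averaging \<open>f \<in> FDC\<close> over the cells gives a fractional partition
  whose matrix determines \<open>Phi f \<mu>\<close> up to the oscillation of the test functions over cells. Hence
  shape and \<open>k\<close>-shapes determine each other approximately, uniformly in \<open>\<mu>\<close>, and convergence passes
  between them. Borel partitions may be replaced by continuous ones because continuous functions are
  dense in \<open>L\<^sup>1\<close> of Lebesgue measure and of the marginal of \<open>\<mu>\<close> simultaneously. The Vietoris
  statement needs the space of s-graphons to be compact; limits are found by pulling the measures
  back to the real line along a measurable section of Schoenberg's space-filling curve and applying
  Helly's selection theorem there.
\<close>

section \<open>Lebesgue measure on the unit square\<close>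

text \<open>Sharp cell indicators would give exact identities, but they are excluded twice: kernels
  in \<open>FDC\<close> must be continuous, and testing against indicators is not weakly continuous.
  Hence the smoothed \<open>h\<close>, fixed once for given \<open>k\<close> and error. As the
  measures of the sequence vary, estimates must be uniform over \<open>sgraphons\<close>. They are:
  apart from the distance of matrices, the errors see only the Lebesgue distance of \<open>h\<close>
  from the cells and the size and oscillation of the test functions. From \<open>k\<close>-shapes to
  shapes, \<open>k\<close> is dictated by the oscillation of finitely many test functions; in the
  other direction \<open>k\<close> is prescribed and only \<open>h\<close> is refined. Closeness of
  s-graphons is measured by finite families of test functions instead of a metric, and compactness
  lets one family serve a whole shape. The curve enters because Helly's theorem concerns
  distribution functions on the line: measures travel to the line by the section and return by the
  curve.\<close>

lemma space_lambda1 [simp]: "space lambda1 = {0..1}"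
  by (simp add: lambda1_def space_restrict_space)

lemma space_lambda2 [simp]: "space lambda2 = unit_square"
  by (simp add: lambda2_def space_restrict_space)

lemma sets_lambda1: "sets lambda1 = sets (restrict_space borel {0..1})"
  by (simp add: lambda1_def sets_restrict_space)

lemma borel_unit_square: "unit_square \<in> sets borel"
  by (intro borel_closed closed_Times) auto

lemma sets_lambda2: "sets lambda2 = sets (restrict_space borel unit_square)"
  by (simp add: lambda2_def sets_restrict_space)

lemma emeasure_lambda1:
  "A \<in> sets borel \<Longrightarrow> A \<subseteq> {0..1} \<Longrightarrow> emeasure lambda1 A = emeasure lborel A"
  unfolding lambda1_def by (subst emeasure_restrict_space) auto

interpretation lambda1: prob_space lambda1
  by standard (simp add: emeasure_lambda1)

lemma sets_lambda1_borel: "A \<in> sets lambda1 \<longleftrightarrow> A \<in> sets borel \<and> A \<subseteq> {0..1}"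
  by (auto simp: lambda1_def sets_restrict_space_iff)

text \<open>Identifies the restricted plane measure with a product of probability measures, so that
  Fubini applies; only the sigma-algebras and the rectangles have to be compared.\<close>

lemma lambda2_eq: "lambda2 = lambda1 \<Otimes>\<^sub>M lambda1"
proof (rule sym, rule pair_measure_eqI)
  show "sigma_finite_measure lambda1" "sigma_finite_measure lambda1" by unfold_locales
  show "sets (lambda1 \<Otimes>\<^sub>M lambda1) = sets lambda2"
  proof
    have "(\<lambda>z. z) \<in> lambda1 \<Otimes>\<^sub>M lambda1 \<rightarrow>\<^sub>M restrict_space (borel \<Otimes>\<^sub>M borel) unit_square"
    proof (rule measurable_restrict_space2)
      have "(\<lambda>x. x) \<in> lambda1 \<rightarrow>\<^sub>M borel"
        unfolding lambda1_def by (rule measurable_restrict_space1) simp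
      then show "(\<lambda>z. z) \<in> lambda1 \<Otimes>\<^sub>M lambda1 \<rightarrow>\<^sub>M borel \<Otimes>\<^sub>M borel"
        by (intro measurable_pair) (auto simp: comp_def intro: measurable_compose[OF measurable_fst] measurable_compose[OF measurable_snd])
    qed (simp add: space_pair_measure)
    note M = measurable_sets[OF this]
    have "A \<in> sets (lambda1 \<Otimes>\<^sub>M lambda1)" if "A \<in> sets lambda2" for A
      using M[of A] that sets.sets_into_space[OF that]
      by (simp add: sets_lambda2 borel_prod space_pair_measure Int_absorb2)
    then show "sets lambda2 \<subseteq> sets (lambda1 \<Otimes>\<^sub>M lambda1)" by blast
    have "(\<lambda>z. z) \<in> restrict_space (borel \<Otimes>\<^sub>M borel) unit_square \<rightarrow>\<^sub>M lambda1 \<Otimes>\<^sub>M lambda1"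
      by (rule measurable_pair)
         (auto simp: comp_def measurable_cong_sets[OF refl sets_lambda1] space_restrict_space
            intro!: measurable_restrict_space2 intro: measurable_restrict_space1)
    note M = measurable_sets[OF this]
    have "A \<in> sets lambda2" if "A \<in> sets (lambda1 \<Otimes>\<^sub>M lambda1)" for A
      using M[of A] that sets.sets_into_space[OF that]
      by (simp add: sets_lambda2 borel_prod space_pair_measure space_restrict_space Int_absorb2)
    then show "sets (lambda1 \<Otimes>\<^sub>M lambda1) \<subseteq> sets lambda2" by blast
  qed
next
  fix A B assume "A \<in> sets lambda1" "B \<in> sets lambda1"
  then have AB: "A \<in> sets borel" "B \<in> sets borel" "A \<subseteq> {0..1}" "B \<subseteq> {0..1}"
    by (auto simp: sets_lambda1_borel)
  then have "emeasure lambda2 (A \<times> B) = emeasure lborel (A \<times> B)"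
    unfolding lambda2_def using borel_unit_square by (intro emeasure_restrict_space) auto
  also have "\<dots> = emeasure lborel A * emeasure lborel B"
    using AB by (subst lborel_prod[symmetric], subst lborel.emeasure_pair_measure_Times) auto
  finally show "emeasure lambda1 A * emeasure lambda1 B = emeasure lambda2 (A \<times> B)"
    using AB by (simp add: emeasure_lambda1)
qed

interpretation lambda1_pair: pair_prob_space lambda1 lambda1
  by unfold_locales

interpretation lambda2: prob_space lambda2
  unfolding lambda2_eq by unfold_locales

lemma sgraphonsD:
  assumes "\<mu> \<in> sgraphons"
  shows "prob_space \<mu>" "sets \<mu> = sets lambda2" "space \<mu> = unit_square" "distr \<mu> \<mu> prod.swap = \<mu>"
proof -
  show "prob_space \<mu>" and s: "sets \<mu> = sets lambda2" and "distr \<mu> \<mu> prod.swap = \<mu>"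
    using assms by (auto simp: sgraphons_def square_prob_measures_def sets_lambda2)
  show "space \<mu> = unit_square" using sets_eq_imp_space_eq[OF s] by simp
qed

lemma measurable_swap_lambda2: "prod.swap \<in> lambda2 \<rightarrow>\<^sub>M lambda2"
proof -
  have "prod.swap = (\<lambda>(x :: real, y :: real). (y, x))" by auto
  then show ?thesis using measurable_pair_swap'[of lambda1 lambda1] by (simp only: lambda2_eq)
qed

lemma integral_sgraphon_swap:
  assumes "\<mu> \<in> sgraphons" and f: "f \<in> borel_measurable lambda2"
  shows "(\<integral>z. f (prod.swap z) \<partial>\<mu>) = (\<integral>z. (f z :: real) \<partial>\<mu>)"
proof -
  note D = sgraphonsD[OF assms(1)]
  have "prod.swap \<in> \<mu> \<rightarrow>\<^sub>M \<mu>"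
    using measurable_swap_lambda2 by (simp only: measurable_cong_sets[OF D(2) D(2)])
  moreover have "f \<in> borel_measurable \<mu>" using f measurable_cong_sets[OF D(2) refl] by blast
  ultimately have "(\<integral>z. f z \<partial>distr \<mu> \<mu> prod.swap) = (\<integral>z. f (prod.swap z) \<partial>\<mu>)"
    by (rule integral_distr)
  then show ?thesis using D by simp
qed

lemma distr_swap_lambda2: "distr lambda2 lambda2 prod.swap = lambda2"
proof -
  have "prod.swap = (\<lambda>(x :: real, y :: real). (y, x))" by auto
  then show ?thesis unfolding lambda2_eq using lambda1_pair.distr_pair_swap by simp
qed

text \<open>Common criterion for \<open>Phi f \<mu>\<close>, for matrix measures and for Lebesgue
  measure itself: symmetry of the density suffices because \<open>lambda2\<close> is invariant under
  the swap.\<close>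

lemma density_in_sgraphons:
  fixes g :: "real \<times> real \<Rightarrow> real"
  assumes g: "g \<in> borel_measurable lambda2"
    and nn: "\<And>z. z \<in> unit_square \<Longrightarrow> 0 \<le> g z"
    and sym: "\<And>x y. x \<in> {0..1} \<Longrightarrow> y \<in> {0..1} \<Longrightarrow> g (y, x) = g (x, y)"
    and int: "integrable lambda2 g" "(\<integral>z. g z \<partial>lambda2) = 1"
  shows "density lambda2 (\<lambda>z. ennreal (g z)) \<in> sgraphons"
proof -
  let ?D = "density lambda2 (\<lambda>z. ennreal (g z))"
  note [measurable] = g measurable_swap_lambda2
  have "emeasure ?D (space ?D) = (\<integral>\<^sup>+z. ennreal (g z) \<partial>lambda2)"
    using sets.top[of lambda2] by (subst emeasure_density) (auto intro!: nn_integral_cong simp: indicator_def)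
  also have "\<dots> = 1"
    using int nn by (subst nn_integral_eq_integral) auto
  finally have p: "prob_space ?D" by (rule prob_spaceI)
  have "distr ?D ?D prod.swap = ?D"
  proof (rule measure_eqI)
    fix A assume "A \<in> sets (distr ?D ?D prod.swap)"
    then have A [measurable]: "A \<in> sets lambda2" by simp
    have "emeasure (distr ?D ?D prod.swap) A = emeasure ?D (prod.swap -` A \<inter> space lambda2)"
      by (subst emeasure_distr) (auto simp: measurable_cong_sets[OF sets_density sets_density] measurable_swap_lambda2)
    also have "\<dots> = (\<integral>\<^sup>+z. ennreal (g z) * indicator (prod.swap -` A \<inter> space lambda2) z \<partial>lambda2)"
      by (rule emeasure_density) measurable
    also have "\<dots> = (\<integral>\<^sup>+z. ennreal (g (prod.swap z)) * indicator A (prod.swap z) \<partial>lambda2)"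
      by (intro nn_integral_cong) (auto simp: indicator_def sym)
    also have "\<dots> = (\<integral>\<^sup>+z. ennreal (g z) * indicator A z \<partial>distr lambda2 lambda2 prod.swap)"
      by (rule nn_integral_distr[symmetric]) measurable
    also have "\<dots> = emeasure ?D A"
      by (simp add: distr_swap_lambda2 emeasure_density)
    finally show "emeasure (distr ?D ?D prod.swap) A = emeasure ?D A" .
  qed simp
  with p show ?thesis by (auto simp: sgraphons_def square_prob_measures_def sets_lambda2)
qed

section \<open>Density of continuous functions in \<open>L\<^sup>1\<close>\<close>

lemma abs_diff_le: "\<bar>a - b\<bar> \<le> A + B" if "\<bar>a\<bar> \<le> A" "\<bar>b\<bar> \<le> B" for a b A B :: real
  using that by linarith

text \<open>The distance to a closed set vanishes only on the set, so elsewhere the slope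
  \<open>n\<close> eventually pushes the function down to 0. Serves both the approximation of
  indicators and the uniqueness of measures.\<close>

lemma indicator_closed_limit:
  fixes A :: "'a::metric_space set"
  assumes "closed A" "A \<noteq> {}"
  shows "(\<lambda>n. max 0 (1 - real n * infdist x A)) \<longlonglongrightarrow> indicator A x"
proof (cases "x \<in> A")
  case False
  then have "infdist x A > 0" using assms by (simp add: infdist_pos_not_in_closed)
  then obtain m :: nat where m: "1 < real m * infdist x A" using reals_Archimedean3 by blast
  have "max 0 (1 - real n * infdist x A) = 0" if "n \<ge> m" for n
  proof -
    have "real m * infdist x A \<le> real n * infdist x A"
      using that by (intro mult_right_mono) (auto simp: infdist_nonneg)
    with m show ?thesis by simp
  qed
  then show ?thesis using False by (intro tendsto_eventually eventually_sequentiallyI[of m]) auto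
qed (simp add: infdist_zero)

text \<open>A single \<open>g\<close> must be good for all measures of the family at once. The later
  use has two of them: Lebesgue measure, which governs the integrals of a partition, and a marginal
  of \<mu>, which governs its matrix. Boundedness of \<open>g\<close> keeps everything
  integrable.\<close>

definition continuous_L1_approximable :: "'i set \<Rightarrow> ('i \<Rightarrow> 'a::metric_space measure) \<Rightarrow> ('a \<Rightarrow> real) \<Rightarrow> bool" where
  "continuous_L1_approximable I N f \<longleftrightarrow> (\<forall>\<epsilon>>0. \<exists>g. continuous_on UNIV g \<and> (\<exists>B. \<forall>x. \<bar>g x\<bar> \<le> B) \<and>
     (\<forall>i\<in>I. (\<integral>x. \<bar>f x - g x\<bar> \<partial>N i) < \<epsilon>))"

context
  fixes I :: "'i set" and N :: "'i \<Rightarrow> 'a::metric_space measure"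
  assumes fin: "finite I"
    and N: "\<And>i. i \<in> I \<Longrightarrow> finite_measure (N i)" "\<And>i. i \<in> I \<Longrightarrow> sets (N i) = sets borel"
begin

abbreviation approximable where
  "approximable \<equiv> continuous_L1_approximable I N"

lemma borel_measurable_N:
  "i \<in> I \<Longrightarrow> (f :: 'a \<Rightarrow> real) \<in> borel_measurable borel \<Longrightarrow> f \<in> borel_measurable (N i)"
  using measurable_cong_sets[OF N(2) refl] by blast

lemma integrable_N:
  "i \<in> I \<Longrightarrow> (f :: 'a \<Rightarrow> real) \<in> borel_measurable borel \<Longrightarrow> (\<And>x. \<bar>f x\<bar> \<le> B) \<Longrightarrow> integrable (N i) f"
  by (rule finite_measure.integrable_const_bound[OF N(1), where B=B])
     (auto intro: borel_measurable_N)

lemma approximable_continuous: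
  assumes "continuous_on UNIV f" "\<And>x. \<bar>f x\<bar> \<le> B"
  shows "approximable f"
  unfolding continuous_L1_approximable_def using assms by (auto intro!: exI[of _ f])

text \<open>The Lipschitz constant turns the errors of the two arguments into an error of the value,
  so each argument is granted \<open>\<epsilon> / (2 * C)\<close>. Complements, finite unions,
  multiples and sums are the instances used.\<close>

lemma approximable_compose2:
  fixes h :: "real \<Rightarrow> real \<Rightarrow> real"
  assumes f: "approximable f" "f \<in> borel_measurable borel" "\<And>x. \<bar>f x\<bar> \<le> Bf"
    and g: "approximable g" "g \<in> borel_measurable borel" "\<And>x. \<bar>g x\<bar> \<le> Bg"
    and h: "continuous_on UNIV (\<lambda>(a, b). h a b)"
      "\<And>a b c d. \<bar>h a b - h c d\<bar> \<le> C * (\<bar>a - c\<bar> + \<bar>b - d\<bar>)"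
    and C: "C > 0"
  shows "approximable (\<lambda>x. h (f x) (g x))"
  unfolding continuous_L1_approximable_def
proof (intro allI impI)
  fix \<epsilon> :: real assume "\<epsilon> > 0"
  then have e: "\<epsilon> / (2 * C) > 0" using C by simp
  obtain f' Bf' where f': "continuous_on UNIV f'" "\<And>x. \<bar>f' x\<bar> \<le> Bf'"
      "\<And>i. i \<in> I \<Longrightarrow> (\<integral>x. \<bar>f x - f' x\<bar> \<partial>N i) < \<epsilon> / (2 * C)"
    using f(1) e unfolding continuous_L1_approximable_def by blast
  obtain g' Bg' where g': "continuous_on UNIV g'" "\<And>x. \<bar>g' x\<bar> \<le> Bg'"
      "\<And>i. i \<in> I \<Longrightarrow> (\<integral>x. \<bar>g x - g' x\<bar> \<partial>N i) < \<epsilon> / (2 * C)"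
    using g(1) e unfolding continuous_L1_approximable_def by blast
  have [measurable]: "f' \<in> borel_measurable borel" "g' \<in> borel_measurable borel"
    "f \<in> borel_measurable borel" "g \<in> borel_measurable borel"
    using f' g' f g by (auto intro: borel_measurable_continuous_onI)
  have [measurable]: "(\<lambda>(a, b). h a b) \<in> borel_measurable borel"
    using h(1) by (rule borel_measurable_continuous_onI)
  have m [measurable]: "(\<lambda>x. h (u x) (v x)) \<in> borel_measurable borel"
    if [measurable]: "u \<in> borel_measurable borel" "v \<in> borel_measurable borel" for u v :: "'a \<Rightarrow> real"
    using measurable_compose[of "\<lambda>x. (u x, v x)" borel "borel \<Otimes>\<^sub>M borel" "\<lambda>(a, b). h a b" borel]
    by (simp add: borel_prod)
  show "\<exists>g'. continuous_on UNIV g' \<and> (\<exists>B. \<forall>x. \<bar>g' x\<bar> \<le> B) \<and>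
     (\<forall>i\<in>I. (\<integral>x. \<bar>h (f x) (g x) - g' x\<bar> \<partial>N i) < \<epsilon>)"
  proof (intro exI[of _ "\<lambda>x. h (f' x) (g' x)"] conjI exI allI ballI)
    show "continuous_on UNIV (\<lambda>x. h (f' x) (g' x))"
      using continuous_on_compose2[OF h(1), of UNIV "\<lambda>x. (f' x, g' x)"] f' g'
      by (simp add: continuous_on_Pair)
    fix x
    have "\<bar>h (f' x) (g' x)\<bar> \<le> \<bar>h 0 0\<bar> + C * (\<bar>f' x\<bar> + \<bar>g' x\<bar>)"
      using h(2)[of "f' x" "g' x" 0 0] by simp
    also have "\<dots> \<le> \<bar>h 0 0\<bar> + C * (Bf' + Bg')"
      using C f'(2)[of x] g'(2)[of x] by (intro add_left_mono mult_left_mono add_mono) auto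
    finally show "\<bar>h (f' x) (g' x)\<bar> \<le> \<bar>h 0 0\<bar> + C * (Bf' + Bg')" .
  next
    fix i assume i: "i \<in> I"
    have if': "integrable (N i) (\<lambda>x. \<bar>f x - f' x\<bar>)"
      using i abs_diff_le[OF f(3) f'(2)] by (intro integrable_N[of i _ "Bf + Bf'"]) auto
    have ig': "integrable (N i) (\<lambda>x. \<bar>g x - g' x\<bar>)"
      using i abs_diff_le[OF g(3) g'(2)] by (intro integrable_N[of i _ "Bg + Bg'"]) auto
    have "(\<integral>x. \<bar>h (f x) (g x) - h (f' x) (g' x)\<bar> \<partial>N i) \<le> (\<integral>x. C * (\<bar>f x - f' x\<bar> + \<bar>g x - g' x\<bar>) \<partial>N i)"
    proof (rule integral_mono')
      show "integrable (N i) (\<lambda>x. C * (\<bar>f x - f' x\<bar> + \<bar>g x - g' x\<bar>))"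
        using if' ig' by simp
    qed (use h(2) C in auto)
    also have "\<dots> = C * ((\<integral>x. \<bar>f x - f' x\<bar> \<partial>N i) + (\<integral>x. \<bar>g x - g' x\<bar> \<partial>N i))"
      using if' ig' by simp
    also have "\<dots> < C * (\<epsilon> / (2 * C) + \<epsilon> / (2 * C))"
      using f'(3)[OF i] g'(3)[OF i] C by (intro mult_strict_left_mono add_strict_mono) auto
    also have "\<dots> = \<epsilon>" using C by (simp add: field_simps)
    finally show "(\<integral>x. \<bar>h (f x) (g x) - h (f' x) (g' x)\<bar> \<partial>N i) < \<epsilon>" .
  qed
qed

text \<open>Dominated convergence gives each measure its own threshold; finiteness of
  \<open>I\<close> yields one \<open>n\<close> for all.\<close>

lemma approximable_limit:
  assumes f: "\<And>n :: nat. approximable (f n)" "\<And>n. f n \<in> borel_measurable borel" "\<And>n x. \<bar>f n x\<bar> \<le> B"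
    and lim: "\<And>x. (\<lambda>n. f n x) \<longlonglongrightarrow> u x"
  shows "approximable u"
  unfolding continuous_L1_approximable_def
proof (intro allI impI)
  fix \<epsilon> :: real assume e: "\<epsilon> > 0"
  have [measurable]: "f n \<in> borel_measurable borel" for n using f by auto
  have u [measurable]: "u \<in> borel_measurable borel"
    using lim by (rule borel_measurable_LIMSEQ_real) measurable
  have uB: "\<bar>u x\<bar> \<le> B" for x
    using lim[of x] f(3) by (intro LIMSEQ_le_const2[OF tendsto_rabs[OF lim]]) auto
  have bd: "\<bar>\<bar>u x - f n x\<bar>\<bar> \<le> 2 * B" for x n
    using uB[of x] f(3)[of n x] by linarith
  have "(\<lambda>n. \<integral>x. \<bar>u x - f n x\<bar> \<partial>N i) \<longlonglongrightarrow> (\<integral>x. 0 \<partial>N i)" if i: "i \<in> I" for i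
  proof (rule integral_dominated_convergence[where w="\<lambda>_. 2 * B"])
    show "integrable (N i) (\<lambda>_. 2 * B)" using i by (intro integrable_N[of i _ "\<bar>2 * B\<bar>"]) auto
    show "AE x in N i. (\<lambda>n. \<bar>u x - f n x\<bar>) \<longlonglongrightarrow> 0"
    proof (rule AE_I2)
      fix x show "(\<lambda>n. \<bar>u x - f n x\<bar>) \<longlonglongrightarrow> 0"
        using tendsto_rabs[OF tendsto_diff[OF tendsto_const lim[of x]], of "u x"] by simp
    qed
    show "AE x in N i. norm \<bar>u x - f n x\<bar> \<le> 2 * B" for n using bd by auto
  qed (use i in \<open>auto intro: borel_measurable_N\<close>)
  then have "\<forall>\<^sub>F n in sequentially. (\<integral>x. \<bar>u x - f n x\<bar> \<partial>N i) < \<epsilon> / 2" if "i \<in> I" for i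
    using e that by (intro order_tendstoD(2)) auto
  then have "\<forall>\<^sub>F n in sequentially. \<forall>i\<in>I. (\<integral>x. \<bar>u x - f n x\<bar> \<partial>N i) < \<epsilon> / 2"
    using fin by (intro eventually_ball_finite ballI) auto
  then obtain n where n: "\<And>i. i \<in> I \<Longrightarrow> (\<integral>x. \<bar>u x - f n x\<bar> \<partial>N i) < \<epsilon> / 2"
    unfolding eventually_sequentially by blast
  obtain g Bg where g: "continuous_on UNIV g" "\<And>x. \<bar>g x\<bar> \<le> Bg"
      "\<And>i. i \<in> I \<Longrightarrow> (\<integral>x. \<bar>f n x - g x\<bar> \<partial>N i) < \<epsilon> / 2"
    using f(1)[of n] e unfolding continuous_L1_approximable_def by (meson half_gt_zero)
  have [measurable]: "g \<in> borel_measurable borel" using g(1) by (rule borel_measurable_continuous_onI)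
  have "(\<integral>x. \<bar>u x - g x\<bar> \<partial>N i) < \<epsilon>" if i: "i \<in> I" for i
  proof -
    have 1: "integrable (N i) (\<lambda>x. \<bar>u x - f n x\<bar>)"
      using i bd by (intro integrable_N[of i _ "2 * B"]) auto
    have 2: "integrable (N i) (\<lambda>x. \<bar>f n x - g x\<bar>)"
      using i abs_diff_le[OF f(3) g(2)] by (intro integrable_N[of i _ "B + Bg"]) auto
    have "(\<integral>x. \<bar>u x - g x\<bar> \<partial>N i) \<le> (\<integral>x. \<bar>u x - f n x\<bar> + \<bar>f n x - g x\<bar> \<partial>N i)"
      using 1 2 by (intro integral_mono') auto
    also have "\<dots> = (\<integral>x. \<bar>u x - f n x\<bar> \<partial>N i) + (\<integral>x. \<bar>f n x - g x\<bar> \<partial>N i)"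
      using 1 2 by simp
    also have "\<dots> < \<epsilon>" using n[OF i] g(3)[OF i] by simp
    finally show ?thesis .
  qed
  with g show "\<exists>g. continuous_on UNIV g \<and> (\<exists>B. \<forall>x. \<bar>g x\<bar> \<le> B) \<and>
     (\<forall>i\<in>I. (\<integral>x. \<bar>u x - g x\<bar> \<partial>N i) < \<epsilon>)" by blast
qed

text \<open>Induction over the sigma-algebra generated by the closed sets; a countable union is
  reached through finite unions and a pointwise limit.\<close>

lemma approximable_indicator:
  assumes "A \<in> sets borel"
  shows "approximable (indicator A)"
proof -
  have "A \<in> sigma_sets UNIV (Collect closed)"
    using assms unfolding borel_eq_closed by simp
  then show ?thesis
  proof (induction rule: sigma_sets.induct)
    case (Basic A)
    show ?case
    \<comment> \<open>\<open>infdist\<close> to the empty set is 0, so the approximating functions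
      would be constantly 1 there.\<close>
    proof (cases "A = {}")
      case False
      let ?f = "\<lambda>n x. max 0 (1 - real n * infdist x A)"
      show ?thesis
      proof (rule approximable_limit[of ?f 1])
        have c: "continuous_on UNIV (?f n)" for n by (intro continuous_intros)
        then show "approximable (?f n)" "?f n \<in> borel_measurable borel" for n
          by (auto intro!: approximable_continuous[of _ 1] borel_measurable_continuous_onI simp: infdist_nonneg)
        show "(\<lambda>n. ?f n x) \<longlonglongrightarrow> indicator A x" for x
          using Basic \<open>A \<noteq> {}\<close> by (intro indicator_closed_limit) auto
      qed (auto simp: infdist_nonneg)
    qed (auto intro!: approximable_continuous[of _ 1])
  next
    case Empty
    show ?case by (auto intro!: approximable_continuous[of _ 1])
  next
    case (Compl A)
    have "A \<in> sets borel" using Compl.hyps unfolding borel_eq_closed by simp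
    \<comment> \<open>An instance of the two-argument lemma with a function that ignores its second
      argument.\<close>
    have "approximable (\<lambda>x. 1 - indicator A x)"
    proof (rule approximable_compose2[OF Compl.IH _ _ Compl.IH, where h = "\<lambda>a b. 1 - a" and C = 1 and Bf = 1 and Bg = 1])
      show "continuous_on UNIV (\<lambda>(a :: real, b :: real). 1 - a)"
        unfolding case_prod_beta' by (intro continuous_intros)
    qed (use \<open>A \<in> sets borel\<close> in simp_all)
    moreover have "(\<lambda>x. 1 - indicator A x) = (indicator (UNIV - A) :: 'a \<Rightarrow> real)"
      by (auto simp: indicator_def)
    ultimately show ?case by simp
  next
    case (Union A)
    have A: "A n \<in> sets borel" for n using Union.hyps unfolding borel_eq_closed by simp
    have "approximable (indicator (\<Union>i<n. A i))" for n
    proof (induction n)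
      case 0
      show ?case by (auto intro!: approximable_continuous[of _ 1])
    next
      case (Suc n)
      have "approximable (\<lambda>x. max (indicator (\<Union>i<n. A i) x) (indicator (A n) x))"
      proof (rule approximable_compose2[OF Suc _ _ Union.IH[of n], where h = max and C = 1 and Bf = 1 and Bg = 1])
        show "continuous_on UNIV (\<lambda>(a :: real, b :: real). max a b)"
          unfolding case_prod_beta' by (intro continuous_intros)
      qed (use A in auto)
      moreover have "(\<lambda>x. max (indicator (\<Union>i<n. A i) x) (indicator (A n) x)) =
          (indicator (\<Union>i<Suc n. A i) :: 'a \<Rightarrow> real)"
        by (auto simp: fun_eq_iff indicator_def less_Suc_eq)
      ultimately show ?case by simp
    qed
    then show ?case
      using A by (intro approximable_limit[where B=1, OF _ _ _ LIMSEQ_indicator_UN]) auto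
  qed
qed

lemma approximable_cmult:
  assumes "approximable u" "u \<in> borel_measurable borel" "\<And>x. \<bar>u x\<bar> \<le> B" "c > 0"
  shows "approximable (\<lambda>x. c * u x)"
proof -
  have "continuous_on UNIV (\<lambda>(a, b :: real). c * a)"
    unfolding case_prod_beta' by (intro continuous_intros)
  moreover have "\<bar>c * a - c * a'\<bar> \<le> c * (\<bar>a - a'\<bar> + \<bar>b - b'\<bar>)" for a a' b b'
    using assms(4) by (simp add: abs_mult flip: right_diff_distrib)
  ultimately show ?thesis
    by (rule approximable_compose2[OF assms(1-3) assms(1-3), where h = "\<lambda>a b. c * a", OF _ _ assms(4)])
qed

lemma approximable_add:
  assumes "approximable u" "u \<in> borel_measurable borel" "\<And>x. \<bar>u x\<bar> \<le> B"
    and "approximable v" "v \<in> borel_measurable borel" "\<And>x. \<bar>v x\<bar> \<le> B'"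
  shows "approximable (\<lambda>x. u x + v x)"
proof -
  have "continuous_on UNIV (\<lambda>(a, b). a + b :: real)"
    unfolding case_prod_beta' by (intro continuous_intros)
  moreover have "\<bar>(a + b) - (c + d)\<bar> \<le> 1 * (\<bar>a - c\<bar> + \<bar>b - d\<bar>)" for a b c d :: real
    using abs_triangle_ineq[of "a - c" "b - d"] by (simp add: algebra_simps)
  ultimately show ?thesis
    by (rule approximable_compose2[OF assms, where h = "\<lambda>a b. a + b"]) simp
qed

text \<open>Induction along the construction of nonnegative Borel functions. The bound is
  generalised because the factor of a multiple obeys a rescaled one.\<close>

lemma approximable_borel:
  assumes f: "f \<in> borel_measurable borel" "\<And>x. 0 \<le> f x" and B: "\<And>x. f x \<le> B"
  shows "approximable f"
  using assms
proof (induction arbitrary: B rule: borel_measurable_induct_real)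
  case (set A)
  then show ?case by (simp add: approximable_indicator)
next
  case (mult u c)
  show ?case
  proof (cases "c = 0")
    case True
    then show ?thesis by (auto intro!: approximable_continuous[of _ 1])
  next
    case False
    with mult.hyps(1) have c: "c > 0" by simp
    have B: "u x \<le> B / c" for x
      using mult.prems[of x] c by (simp add: pos_le_divide_eq mult.commute)
    then have "approximable u" by (rule mult.IH)
    moreover have "\<bar>u x\<bar> \<le> B / c" for x using B mult.hyps(3) by simp
    ultimately show ?thesis
      using mult.hyps(2) c by (intro approximable_cmult[of u "B / c"])
  qed
next
  case (add u v)
  have B: "\<bar>u x\<bar> \<le> B" and B': "\<bar>v x\<bar> \<le> B" for x
    using add.hyps(2)[of x] add.hyps(4)[of x] add.prems[of x] by linarith+
  have "approximable u" by (rule add.IH(1)[OF abs_le_D1[OF B]])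
  moreover have "approximable v" by (rule add.IH(2)[OF abs_le_D1[OF B']])
  ultimately show ?case
    by (intro approximable_add[where u = v and v = u and B = B and B' = B, OF _ add.hyps(3) B' _ add.hyps(1) B])
next
  case (seq U)
  have lim: "(\<lambda>i. U i x) \<longlonglongrightarrow> f x" for x using seq.hyps(4) by simp
  have "U n x \<le> f x" for n x
  proof (rule incseq_le[OF _ lim])
    show "incseq (\<lambda>i. U i x)" using seq.hyps(3) by (simp add: incseq_def le_fun_def)
  qed
  from order_trans[OF this seq.prems] have UB: "U n x \<le> B" for n x .
  then have "approximable (U n)" for n by (rule seq.IH)
  moreover have "\<bar>U n x\<bar> \<le> B" for n x using seq.hyps(2) UB by simp
  ultimately show ?case
    using seq.hyps(1) lim by (intro approximable_limit[of U B f])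
qed

end

section \<open>Continuous partitions\<close>

text \<open>The conditions are imposed on the whole line, although only \<open>{0..1}\<close>
  carries mass: continuity, positivity and measurability are then available without side conditions
  on the argument.\<close>

definition continuous_partitions :: "nat \<Rightarrow> (nat \<Rightarrow> real \<Rightarrow> real) set" where
  "continuous_partitions k = {g.
     (\<forall>i\<in>{1..k}. continuous_on UNIV (g i) \<and> (\<forall>x. 0 \<le> g i x) \<and> (\<integral>x. g i x \<partial>lambda1) = 1 / real k) \<and>
     (\<forall>x. (\<Sum>i=1..k. g i x) = 1)}"

lemma le_1_of_sum_eq_1:
  fixes g :: "'i \<Rightarrow> real"
  assumes "(\<Sum>i\<in>I. g i) = 1" "finite I" "\<And>i. i \<in> I \<Longrightarrow> 0 \<le> g i" "i \<in> I"
  shows "g i \<le> 1"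
  using member_le_sum[of i I g] assms by simp

lemma continuous_partitionsD:
  assumes "g \<in> continuous_partitions k" "i \<in> {1..k}"
  shows "continuous_on UNIV (g i)" "0 \<le> g i x" "g i x \<le> 1" "(\<integral>x. g i x \<partial>lambda1) = 1 / real k"
    "g i \<in> borel_measurable borel"
proof -
  show "continuous_on UNIV (g i)" "0 \<le> g i x" "(\<integral>x. g i x \<partial>lambda1) = 1 / real k"
    using assms by (auto simp: continuous_partitions_def)
  then show "g i \<in> borel_measurable borel" by (intro borel_measurable_continuous_onI)
  show "g i x \<le> 1"
    using assms by (intro le_1_of_sum_eq_1[of "\<lambda>i. g i x" "{1..k}"]) (auto simp: continuous_partitions_def)
qed

lemma continuous_partitions_sum: "g \<in> continuous_partitions k \<Longrightarrow> (\<Sum>i=1..k. g i x) = 1"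
  by (auto simp: continuous_partitions_def)

lemma fractional_partitionsD:
  assumes "f \<in> fractional_partitions k" "i \<in> {1..k}"
  shows "f i \<in> borel_measurable lambda1" "x \<in> {0..1} \<Longrightarrow> 0 \<le> f i x" "x \<in> {0..1} \<Longrightarrow> f i x \<le> 1"
    "(\<integral>x. f i x \<partial>lambda1) = 1 / real k"
proof -
  have "f i \<in> borel_measurable (restrict_space borel {0..1})"
    using assms by (auto simp: fractional_partitions_def)
  then show "f i \<in> borel_measurable lambda1"
    using measurable_cong_sets[OF sets_lambda1 refl] by blast
  show "x \<in> {0..1} \<Longrightarrow> 0 \<le> f i x" "(\<integral>x. f i x \<partial>lambda1) = 1 / real k"
    using assms by (auto simp: fractional_partitions_def)
  show "x \<in> {0..1} \<Longrightarrow> f i x \<le> 1"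
    using assms by (intro le_1_of_sum_eq_1[of "\<lambda>i. f i x" "{1..k}"]) (auto simp: fractional_partitions_def)
qed

lemma fractional_partitions_sum:
  "f \<in> fractional_partitions k \<Longrightarrow> x \<in> {0..1} \<Longrightarrow> (\<Sum>i=1..k. f i x) = 1"
  by (auto simp: fractional_partitions_def)

lemma continuous_partitions_subset: "continuous_partitions k \<subseteq> fractional_partitions k"
proof
  fix g assume g: "g \<in> continuous_partitions k"
  have "g i \<in> borel_measurable (restrict_space borel {0..1})" if "i \<in> {1..k}" for i
    using continuous_partitionsD(5)[OF g that] by (rule measurable_restrict_space1)
  then show "g \<in> fractional_partitions k"
    using continuous_partitionsD[OF g] continuous_partitions_sum[OF g]
    by (auto simp: fractional_partitions_def)
qed

lemma measurable_lambda1I: "f \<in> borel_measurable borel \<Longrightarrow> f \<in> borel_measurable lambda1"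
  unfolding lambda1_def by (rule measurable_restrict_space1) simp

lemma measurable_lambda2I: "f \<in> borel_measurable borel \<Longrightarrow> f \<in> borel_measurable lambda2"
  unfolding lambda2_def by (rule measurable_restrict_space1) simp

lemma measurable_sgraphonI:
  assumes "\<mu> \<in> sgraphons" "f \<in> borel_measurable lambda2"
  shows "f \<in> borel_measurable \<mu>"
  using assms measurable_cong_sets[OF sgraphonsD(2) refl] by blast

text \<open>A family of nonnegative functions is turned into a partition of unity by scaling it down
  where its sum exceeds 1 and distributing the defect evenly elsewhere.\<close>

lemma normalize_partition:
  fixes f g :: "nat \<Rightarrow> real"
  assumes k: "k \<ge> 1" and g: "\<And>i. i \<in> {1..k} \<Longrightarrow> 0 \<le> g i" and f: "(\<Sum>i=1..k. f i) = 1"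
  defines "S \<equiv> \<Sum>i=1..k. g i"
  defines "g' \<equiv> \<lambda>i. g i / max 1 S + (1 - S / max 1 S) / k"
  shows "i \<in> {1..k} \<Longrightarrow> 0 \<le> g' i" "(\<Sum>i=1..k. g' i) = 1"
    "i \<in> {1..k} \<Longrightarrow> \<bar>f i - g' i\<bar> \<le> \<bar>f i - g i\<bar> + (\<Sum>j=1..k. \<bar>f j - g j\<bar>)"
proof -
  let ?m = "max 1 S"
  have m: "?m > 0" "S \<le> ?m" "1 \<le> ?m" by auto
  have S0: "0 \<le> S" unfolding S_def using g by (intro sum_nonneg) auto
  have d: "0 \<le> 1 - S / ?m" using m by (simp add: field_simps)
  show "i \<in> {1..k} \<Longrightarrow> 0 \<le> g' i" using g d m unfolding g'_def by (intro add_nonneg_nonneg divide_nonneg_nonneg) auto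
  have "(\<Sum>i=1..k. g' i) = S / ?m + (1 - S / ?m)"
    unfolding g'_def S_def using k by (simp add: sum.distrib sum_divide_distrib[symmetric])
  then show "(\<Sum>i=1..k. g' i) = 1" by simp
  assume i: "i \<in> {1..k}"
  have gS: "g i \<le> S" unfolding S_def using g i by (intro member_le_sum) auto
  \<comment> \<open>If \<open>S \<ge> 1\<close>, entry \<open>i\<close> loses its share
    \<open>g i / S\<close> of the excess; otherwise it gains the share \<open>1 / k\<close> of the
    defect. Either share is at most 1.\<close>
  have "\<bar>g i - g' i\<bar> \<le> \<bar>S - 1\<bar>"
  proof (cases "S \<ge> 1")
    case True
    then have "?m = S" by simp
    then have eq: "g i - g' i = g i / S * (S - 1)" using True by (simp add: g'_def field_simps)
    have q: "g i / S \<le> 1" "0 \<le> g i / S" using gS True g[OF i] by auto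
    have "\<bar>g i / S * (S - 1)\<bar> = \<bar>g i / S\<bar> * \<bar>S - 1\<bar>" by (rule abs_mult)
    also have "\<dots> \<le> 1 * \<bar>S - 1\<bar>" using q by (intro mult_right_mono) auto
    finally show ?thesis by (simp only: eq mult_1)
  next
    case False
    then have "?m = 1" by simp
    then have "g i - g' i = - ((1 - S) / k)" by (simp add: g'_def)
    also have "\<bar>\<dots>\<bar> = (1 - S) / k" using False by simp
    also have "(1 - S) / k \<le> (1 - S) / 1"
      using False k by (intro divide_left_mono) auto
    finally show ?thesis using False by simp
  qed
  also have "\<bar>S - 1\<bar> = \<bar>\<Sum>j=1..k. g j - f j\<bar>" using f by (simp add: S_def sum_subtractf)
  also have "\<dots> \<le> (\<Sum>j=1..k. \<bar>f j - g j\<bar>)"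
    by (rule order_trans[OF sum_abs]) (simp add: abs_minus_commute)
  finally show "\<bar>f i - g' i\<bar> \<le> \<bar>f i - g i\<bar> + (\<Sum>j=1..k. \<bar>f j - g j\<bar>)"
    by linarith
qed

text \<open>Averaging with constants \<open>c i\<close> restores the prescribed integrals \<open>1 / k\<close>; since the integrals
  \<open>a i\<close> are almost right, a small weight \<open>t\<close> of the constants suffices.\<close>

lemma correct_integrals:
  fixes a :: "nat \<Rightarrow> real"
  assumes k: "k \<ge> 1" and \<delta>: "0 < \<delta>" "real k * \<delta> \<le> 1"
    and a: "\<And>i. i \<in> {1..k} \<Longrightarrow> \<bar>a i - 1 / k\<bar> \<le> \<delta>" and sum: "(\<Sum>i=1..k. a i) = 1"
  shows "\<exists>c. (\<Sum>i=1..k. c i) = 1 \<and>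
    (\<forall>i\<in>{1..k}. 0 \<le> c i \<and> (1 - k * \<delta>) * a i + k * \<delta> * c i = 1 / k)"
proof (intro exI conjI ballI)
  \<comment> \<open>\<open>c i\<close> is solved from the required equation. This weight makes it
    nonnegative, because \<open>(1 - t) * (1 / k + \<delta>) = 1 / k - t * \<delta>\<close>.\<close>
  define t where "t = real k * \<delta>"
  define c where "c i = (1 / k - (1 - t) * a i) / t" for i
  have t: "0 < t" "t \<le> 1" using k \<delta> by (auto simp: t_def)
  show "(1 - k * \<delta>) * a i + k * \<delta> * c i = 1 / k" for i
    using t unfolding t_def[symmetric] by (simp add: c_def)
  have "(\<Sum>i=1..k. c i) = ((\<Sum>i=1..k. 1 / k) - (1 - t) * (\<Sum>i=1..k. a i)) / t"
    unfolding c_def by (simp add: sum_divide_distrib sum_subtractf sum_distrib_left diff_divide_distrib)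
  then show "(\<Sum>i=1..k. c i) = 1" using t k sum by simp
  fix i assume "i \<in> {1..k}"
  then have "(1 - t) * a i \<le> (1 - t) * (1 / k + \<delta>)"
    using a[of i] t by (intro mult_left_mono) auto
  also have "\<dots> = 1 / k - t * \<delta>" using k by (simp add: t_def field_simps)
  also have "\<dots> \<le> 1 / k" using t \<delta> by simp
  finally show "0 \<le> c i" using t by (simp add: c_def)
qed

text \<open>Approximate each component in both measures, cut off negative values, normalise the sum,
  then mix with constants to restore the integrals exactly.\<close>

lemma fractional_partition_approx:
  assumes \<mu>: "\<mu> \<in> sgraphons" and f: "f \<in> fractional_partitions k" and k: "k \<ge> 1" and \<epsilon>: "\<epsilon> > 0"
  obtains g where "g \<in> continuous_partitions k"
    "\<And>i. i \<in> {1..k} \<Longrightarrow> (\<integral>x. \<bar>f i x - g i x\<bar> \<partial>lambda1) \<le> \<epsilon>"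
    "\<And>i. i \<in> {1..k} \<Longrightarrow> (\<integral>z. \<bar>f i (fst z) - g i (fst z)\<bar> \<partial>\<mu>) \<le> \<epsilon>"
proof -
  interpret \<mu>: prob_space \<mu> using sgraphonsD[OF \<mu>] by simp
  \<comment> \<open>Both measures become Borel measures on the line concentrated on
    \<open>{0..1}\<close>; the index type \<open>bool\<close> makes them a finite family.\<close>
  define N where "N b = (if b then distr lambda1 borel (\<lambda>x. x) else distr \<mu> borel fst)" for b
  define F where "F i x = indicator {0..1} x * f i x" for i x
  have id_meas [measurable]: "(\<lambda>x. x) \<in> borel_measurable lambda1" by (rule measurable_lambda1I) simp
  have fst_meas [measurable]: "fst \<in> borel_measurable \<mu>"
    by (intro measurable_sgraphonI[OF \<mu>] measurable_lambda2I) (simp add: borel_measurable_continuous_onI continuous_on_fst)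
  have N: "prob_space (N b)" "sets (N b) = sets borel" for b
    by (auto simp: N_def intro: lambda1.prob_space_distr \<mu>.prob_space_distr)
  have conc: "AE x in N b. x \<in> {0..1}" for b
  proof (cases b)
    case True
    show ?thesis unfolding N_def if_P[OF True] by (subst AE_distr_iff) auto
  next
    case False
    show ?thesis unfolding N_def if_not_P[OF False]
      by (subst AE_distr_iff) (auto simp: sgraphonsD[OF \<mu>])
  qed
  have Fm: "F i \<in> borel_measurable borel" if "i \<in> {1..k}" for i
    using that f unfolding F_def fractional_partitions_def
    by (auto simp: borel_measurable_restrict_space_iff)
  have F01: "0 \<le> F i x" "F i x \<le> 1" if "i \<in> {1..k}" for i x
    using fractional_partitionsD(2,3)[OF f that] by (auto simp: F_def indicator_def)
  have Fsum: "(\<Sum>i=1..k. F i x) = 1" if "x \<in> {0..1}" for x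
    using fractional_partitions_sum[OF f that] that by (simp add: F_def)
  have FN: "(\<integral>x. \<bar>f i x - g x\<bar> \<partial>lambda1) = (\<integral>x. \<bar>F i x - g x\<bar> \<partial>N True)"
    "(\<integral>z. \<bar>f i (fst z) - g (fst z)\<bar> \<partial>\<mu>) = (\<integral>x. \<bar>F i x - g x\<bar> \<partial>N False)"
    if "i \<in> {1..k}" and [measurable]: "g \<in> borel_measurable borel" for i g
  proof -
    note [measurable] = Fm[OF that(1)]
    have "(\<integral>x. \<bar>F i x - g x\<bar> \<partial>N True) = (\<integral>x. \<bar>F i x - g x\<bar> \<partial>lambda1)"
      unfolding N_def by (simp add: integral_distr)
    also have "\<dots> = (\<integral>x. \<bar>f i x - g x\<bar> \<partial>lambda1)"
      by (intro Bochner_Integration.integral_cong) (auto simp: F_def)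
    finally show "(\<integral>x. \<bar>f i x - g x\<bar> \<partial>lambda1) = (\<integral>x. \<bar>F i x - g x\<bar> \<partial>N True)" ..
    have "(\<integral>x. \<bar>F i x - g x\<bar> \<partial>N False) = (\<integral>z. \<bar>F i (fst z) - g (fst z)\<bar> \<partial>\<mu>)"
      unfolding N_def by (simp add: integral_distr)
    also have "\<dots> = (\<integral>z. \<bar>f i (fst z) - g (fst z)\<bar> \<partial>\<mu>)"
      by (intro Bochner_Integration.integral_cong) (auto simp: F_def sgraphonsD[OF \<mu>])
    finally show "(\<integral>z. \<bar>f i (fst z) - g (fst z)\<bar> \<partial>\<mu>) = (\<integral>x. \<bar>F i x - g x\<bar> \<partial>N False)" ..
  qed
  have int: "integrable (N b) h" if "h \<in> borel_measurable borel" "\<And>x. x \<in> {0..1} \<Longrightarrow> \<bar>h x\<bar> \<le> B" for h :: "real \<Rightarrow> real" and B b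
  proof -
    interpret Nb: prob_space "N b" by (rule N)
    have "AE x in N b. norm (h x) \<le> B" using conc[of b] by eventually_elim (use that in auto)
    then show ?thesis
      using that(1) measurable_cong_sets[OF N(2)[of b] refl] by (intro Nb.integrable_const_bound) auto
  qed
  \<comment> \<open>Normalising costs a factor \<open>k + 1\<close>, since the errors of all
    components are added to that of one, and mixing with constants costs the same factor again;
    hence \<open>m\<^sup>2\<close>. The minimum with 1 keeps the mixing weight
    \<open>k * \<delta>\<close> at most 1.\<close>
  define m where "m = real k + 1"
  define \<epsilon>0 where "\<epsilon>0 = min \<epsilon> 1 / m\<^sup>2"
  have e0: "\<epsilon>0 > 0" using \<epsilon> by (simp add: \<epsilon>0_def m_def add_nonneg_pos)
  have "continuous_L1_approximable UNIV N (F i)" if "i \<in> {1..k}" for i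
    using N that Fm F01 by (intro approximable_borel[of UNIV N "F i" 1]) (auto simp: prob_space_def)
  then have "\<exists>g. \<forall>i\<in>{1..k}. continuous_on UNIV (g i) \<and> (\<exists>B. \<forall>x. \<bar>g i x\<bar> \<le> B) \<and>
      (\<forall>b. (\<integral>x. \<bar>F i x - g i x\<bar> \<partial>N b) < \<epsilon>0)"
    using e0 unfolding continuous_L1_approximable_def by (intro bchoice) simp
  then obtain g0 where *: "\<forall>i\<in>{1..k}. continuous_on UNIV (g0 i) \<and> (\<exists>B. \<forall>x. \<bar>g0 i x\<bar> \<le> B) \<and>
      (\<forall>b. (\<integral>x. \<bar>F i x - g0 i x\<bar> \<partial>N b) < \<epsilon>0)" ..
  have g0: "\<And>i. i \<in> {1..k} \<Longrightarrow> continuous_on UNIV (g0 i)"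
      "\<And>i. i \<in> {1..k} \<Longrightarrow> \<exists>B. \<forall>x. \<bar>g0 i x\<bar> \<le> B"
      "\<And>i b. i \<in> {1..k} \<Longrightarrow> (\<integral>x. \<bar>F i x - g0 i x\<bar> \<partial>N b) < \<epsilon>0"
    using * by simp_all
  define g1 where "g1 i x = max 0 (g0 i x)" for i x
  have g1c: "continuous_on UNIV (g1 i)" if "i \<in> {1..k}" for i
    using g0(1)[OF that] unfolding g1_def by (intro continuous_intros)
  define S where "S x = (\<Sum>i=1..k. g1 i x)" for x
  have Sc: "continuous_on UNIV S" unfolding S_def using g1c by (intro continuous_intros)
  define g2 where "g2 i x = g1 i x / max 1 (S x) + (1 - S x / max 1 (S x)) / k" for i x
  have g2c: "continuous_on UNIV (g2 i)" if "i \<in> {1..k}" for i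
    unfolding g2_def using g1c[OF that] Sc k by (intro continuous_intros) auto
  have g2m: "g2 i \<in> borel_measurable borel" if "i \<in> {1..k}" for i
    using g2c[OF that] by (rule borel_measurable_continuous_onI)
  have g2_0: "0 \<le> g2 i x" if "i \<in> {1..k}" for i x
    unfolding g2_def S_def using k that
    by (intro normalize_partition(1)[of k "\<lambda>i. g1 i x" "\<lambda>_. 1 / k"]) (simp_all add: g1_def)
  have g2_sum: "(\<Sum>i=1..k. g2 i x) = 1" for x
    unfolding g2_def S_def using k
    by (intro normalize_partition(2)[of k "\<lambda>i. g1 i x" "\<lambda>_. 1 / k"]) (simp_all add: g1_def)
  have g2_F: "\<bar>F i x - g2 i x\<bar> \<le> \<bar>F i x - g1 i x\<bar> + (\<Sum>j=1..k. \<bar>F j x - g1 j x\<bar>)"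
    if "i \<in> {1..k}" "x \<in> {0..1}" for i x
    unfolding g2_def S_def using k that Fsum
    by (intro normalize_partition(3)[of k "\<lambda>i. g1 i x" "\<lambda>i. F i x"]) (simp_all add: g1_def)
  have g2_1: "g2 i x \<le> 1" if "i \<in> {1..k}" for i x
    using that g2_0 g2_sum by (intro le_1_of_sum_eq_1[of "\<lambda>i. g2 i x" "{1..k}"]) auto
  define \<delta> where "\<delta> = m * \<epsilon>0"
  have g1_err: "(\<integral>x. \<bar>F i x - g1 i x\<bar> \<partial>N b) \<le> \<epsilon>0"
    and g1_int: "integrable (N b) (\<lambda>x. \<bar>F i x - g1 i x\<bar>)" if i: "i \<in> {1..k}" for i b
  proof -
    obtain B where B: "\<And>x. \<bar>g0 i x\<bar> \<le> B" using g0(2)[OF i] by blast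
    \<comment> \<open>Cutting off at 0 can only move \<open>g0\<close> towards the nonnegative
      \<open>F\<close>.\<close>
    have le: "\<bar>F i x - g1 i x\<bar> \<le> \<bar>F i x - g0 i x\<bar>" for x using F01[OF i, of x] by (auto simp: g1_def)
    have [measurable]: "g0 i \<in> borel_measurable borel" "g1 i \<in> borel_measurable borel" "F i \<in> borel_measurable borel"
      using g0(1)[OF i] g1c[OF i] Fm[OF i] by (auto intro: borel_measurable_continuous_onI)
    have B': "\<bar>F i x - g0 i x\<bar> \<le> 1 + B" for x
      using B[of x] F01[OF i, of x] by linarith
    then have int0: "integrable (N b) (\<lambda>x. \<bar>F i x - g0 i x\<bar>)"
      by (intro int[of _ "1 + B"]) auto
    show "integrable (N b) (\<lambda>x. \<bar>F i x - g1 i x\<bar>)"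
      using order_trans[OF le B'] by (intro int[of _ "1 + B"]) auto
    have "(\<integral>x. \<bar>F i x - g1 i x\<bar> \<partial>N b) \<le> (\<integral>x. \<bar>F i x - g0 i x\<bar> \<partial>N b)"
      by (rule integral_mono'[OF int0 le]) simp
    with g0(3)[OF i, of b] show "(\<integral>x. \<bar>F i x - g1 i x\<bar> \<partial>N b) \<le> \<epsilon>0" by simp
  qed
  have g2_int: "integrable (N b) (\<lambda>x. \<bar>F i x - g2 i x\<bar>)" if i: "i \<in> {1..k}" for i b
  proof (rule int[of _ 1])
    show "\<bar>\<bar>F i x - g2 i x\<bar>\<bar> \<le> 1" for x
      using F01[OF i, of x] g2_0[OF i, of x] g2_1[OF i, of x] by linarith
    show "(\<lambda>x. \<bar>F i x - g2 i x\<bar>) \<in> borel_measurable borel"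
      using Fm[OF i] g2m[OF i] by measurable
  qed
  have g2_err: "(\<integral>x. \<bar>F i x - g2 i x\<bar> \<partial>N b) \<le> \<delta>" if i: "i \<in> {1..k}" for i b
  proof -
    have "AE x in N b. \<bar>F i x - g2 i x\<bar> \<le> \<bar>F i x - g1 i x\<bar> + (\<Sum>j=1..k. \<bar>F j x - g1 j x\<bar>)"
      using conc[of b] by eventually_elim (rule g2_F[OF i])
    then have "(\<integral>x. \<bar>F i x - g2 i x\<bar> \<partial>N b) \<le> (\<integral>x. \<bar>F i x - g1 i x\<bar> + (\<Sum>j=1..k. \<bar>F j x - g1 j x\<bar>) \<partial>N b)"
      using g2_int[OF i] g1_int i
      by (intro integral_mono_AE Bochner_Integration.integrable_add Bochner_Integration.integrable_sum) auto
    also have "\<dots> = (\<integral>x. \<bar>F i x - g1 i x\<bar> \<partial>N b) + (\<Sum>j=1..k. \<integral>x. \<bar>F j x - g1 j x\<bar> \<partial>N b)"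
      using g1_int i by (subst Bochner_Integration.integral_add) (auto simp: Bochner_Integration.integral_sum)
    also have "\<dots> \<le> \<epsilon>0 + (\<Sum>j=1..k. \<epsilon>0)"
      using g1_err i by (intro add_mono sum_mono) auto
    finally show ?thesis by (simp add: \<delta>_def m_def algebra_simps)
  qed
  define a where "a i = (\<integral>x. g2 i x \<partial>lambda1)" for i
  have i1: "integrable lambda1 (g2 i)" if "i \<in> {1..k}" for i
    using g2_0[OF that] g2_1[OF that] g2m[OF that]
    by (intro lambda1.integrable_const_bound[where B=1]) (auto intro: measurable_lambda1I)
  have \<delta>: "0 < \<delta>" "k * \<delta> \<le> 1" "m * \<delta> \<le> \<epsilon>"
  proof -
    have "m > 0" by (simp add: m_def)
    have md: "m * \<delta> = min \<epsilon> 1" using \<open>m > 0\<close> by (simp add: \<delta>_def \<epsilon>0_def power2_eq_square)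
    show d0: "0 < \<delta>" using \<open>m > 0\<close> e0 by (simp add: \<delta>_def)
    have "k * \<delta> \<le> m * \<delta>" using d0 by (simp add: m_def)
    with md show "k * \<delta> \<le> 1" "m * \<delta> \<le> \<epsilon>" by auto
  qed
  have a: "\<bar>a i - 1 / k\<bar> \<le> \<delta>" if i: "i \<in> {1..k}" for i
  proof -
    have fi: "integrable lambda1 (f i)"
      using fractional_partitionsD[OF f i] by (intro lambda1.integrable_const_bound[where B=1]) auto
    have "\<bar>a i - 1 / k\<bar> = \<bar>\<integral>x. f i x - g2 i x \<partial>lambda1\<bar>"
      using i1[OF i] fi fractional_partitionsD(4)[OF f i] by (simp add: a_def)
    also have "\<dots> \<le> (\<integral>x. \<bar>f i x - g2 i x\<bar> \<partial>lambda1)" by (rule integral_abs_bound)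
    also have "\<dots> \<le> \<delta>" using g2_err[OF i, of True] FN(1)[OF i g2m[OF i]] by simp
    finally show ?thesis .
  qed
  have "(\<Sum>i=1..k. a i) = (\<integral>x. (\<Sum>i=1..k. g2 i x) \<partial>lambda1)"
    unfolding a_def using i1 by (simp add: Bochner_Integration.integral_sum)
  also have "\<dots> = 1" unfolding g2_sum using lambda1.prob_space by simp
  finally have a_sum: "(\<Sum>i=1..k. a i) = 1" .
  from correct_integrals[OF k \<delta>(1,2) a a_sum]
  obtain c where *: "(\<Sum>i=1..k. c i) = 1 \<and>
    (\<forall>i\<in>{1..k}. 0 \<le> c i \<and> (1 - k * \<delta>) * a i + k * \<delta> * c i = 1 / k)" ..
  have c: "\<And>i. i \<in> {1..k} \<Longrightarrow> 0 \<le> c i" "(\<Sum>i=1..k. c i) = 1"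
    "\<And>i. i \<in> {1..k} \<Longrightarrow> (1 - k * \<delta>) * a i + k * \<delta> * c i = 1 / k"
    using * by blast+
  define g where "g i x = (1 - k * \<delta>) * g2 i x + k * \<delta> * c i" for i x
  have gc: "continuous_on UNIV (g i)" if "i \<in> {1..k}" for i
    unfolding g_def using g2c[OF that] by (intro continuous_intros)
  have gm: "g i \<in> borel_measurable borel" if "i \<in> {1..k}" for i
    using gc[OF that] by (rule borel_measurable_continuous_onI)
  have gk: "g \<in> continuous_partitions k"
    unfolding continuous_partitions_def
  proof (intro CollectI conjI ballI allI)
    fix i x assume i: "i \<in> {1..k}"
    show "continuous_on UNIV (g i)" by (rule gc[OF i])
    show "0 \<le> g i x" unfolding g_def
      using g2_0[OF i] c(1)[OF i] \<delta> by (intro add_nonneg_nonneg mult_nonneg_nonneg) auto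
    have "(\<integral>x. g i x \<partial>lambda1) = (1 - k * \<delta>) * a i + k * \<delta> * c i"
      unfolding g_def a_def using i1[OF i] lambda1.prob_space by simp
    then show "(\<integral>x. g i x \<partial>lambda1) = 1 / k" using c(3)[OF i] by simp
  next
    fix x
    have "(\<Sum>i=1..k. g i x) = (1 - k * \<delta>) * (\<Sum>i=1..k. g2 i x) + k * \<delta> * (\<Sum>i=1..k. c i)"
      unfolding g_def by (simp add: sum.distrib sum_distrib_left)
    then show "(\<Sum>i=1..k. g i x) = 1" unfolding g2_sum c(2) by simp
  qed
  have err: "(\<integral>x. \<bar>F i x - g i x\<bar> \<partial>N b) \<le> \<epsilon>" if i: "i \<in> {1..k}" for i b
  proof -
    interpret Nb: prob_space "N b" by (rule N)
    have ci: "c i \<le> 1" using c i by (intro le_1_of_sum_eq_1[of c "{1..k}"]) auto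
    have "\<bar>F i x - g i x\<bar> \<le> \<bar>F i x - g2 i x\<bar> + k * \<delta>" for x
    proof -
      have "g2 i x - g i x = k * \<delta> * (g2 i x - c i)" by (simp add: g_def algebra_simps)
      also have "\<bar>\<dots>\<bar> = k * \<delta> * \<bar>g2 i x - c i\<bar>" using \<delta> by (simp add: abs_mult)
      also have "\<dots> \<le> k * \<delta> * 1"
        using \<delta> ci c(1)[OF i] g2_0[OF i, of x] g2_1[OF i, of x] by (intro mult_left_mono) auto
      finally show ?thesis by linarith
    qed
    then have "(\<integral>x. \<bar>F i x - g i x\<bar> \<partial>N b) \<le> (\<integral>x. \<bar>F i x - g2 i x\<bar> + k * \<delta> \<partial>N b)"
      using g2_int[OF i] \<delta>(1) by (intro integral_mono') auto
    also have "\<dots> = (\<integral>x. \<bar>F i x - g2 i x\<bar> \<partial>N b) + k * \<delta>"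
      using g2_int[OF i] Nb.prob_space by simp
    also have "\<dots> \<le> m * \<delta>" using g2_err[OF i, of b] by (simp add: m_def algebra_simps)
    finally show ?thesis using \<delta>(3) by simp
  qed
  show thesis
  proof (rule that[OF gk])
    fix i assume i: "i \<in> {1..k}"
    show "(\<integral>x. \<bar>f i x - g i x\<bar> \<partial>lambda1) \<le> \<epsilon>" "(\<integral>z. \<bar>f i (fst z) - g i (fst z)\<bar> \<partial>\<mu>) \<le> \<epsilon>"
      unfolding FN(1)[OF i gm[OF i]] FN(2)[OF i gm[OF i]] by (rule err[OF i])+
  qed
qed

section \<open>Smoothing by kernels in \<open>FDC\<close>\<close>

lemma integral_double_sum:
  fixes f :: "'i \<Rightarrow> 'j \<Rightarrow> 'a \<Rightarrow> real"
  assumes "\<And>i j. i \<in> I \<Longrightarrow> j \<in> J \<Longrightarrow> integrable M (f i j)"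
  shows "(\<integral>x. (\<Sum>i\<in>I. \<Sum>j\<in>J. f i j x) \<partial>M) = (\<Sum>i\<in>I. \<Sum>j\<in>J. \<integral>x. f i j x \<partial>M)"
    "integrable M (\<lambda>x. \<Sum>i\<in>I. \<Sum>j\<in>J. f i j x)"
proof -
  have "integrable M (\<lambda>x. \<Sum>j\<in>J. f i j x)" if "i \<in> I" for i
    using assms that by (intro Bochner_Integration.integrable_sum) auto
  then show "integrable M (\<lambda>x. \<Sum>i\<in>I. \<Sum>j\<in>J. f i j x)"
    and "(\<integral>x. (\<Sum>i\<in>I. \<Sum>j\<in>J. f i j x) \<partial>M) = (\<Sum>i\<in>I. \<Sum>j\<in>J. \<integral>x. f i j x \<partial>M)"
    using assms by (simp_all add: Bochner_Integration.integral_sum)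
qed

lemma mult_in_unit: "0 \<le> a \<Longrightarrow> a \<le> 1 \<Longrightarrow> 0 \<le> b \<Longrightarrow> b \<le> 1 \<Longrightarrow> a * b \<le> (1 :: real)"
  by (simp add: mult_le_one)

lemma prod_diff_unit:
  fixes a b c d :: real
  assumes "0 \<le> b" "b \<le> 1" "0 \<le> c" "c \<le> 1"
  shows "\<bar>a * b - c * d\<bar> \<le> \<bar>a - c\<bar> + \<bar>b - d\<bar>"
proof -
  have "a * b - c * d = (a - c) * b + c * (b - d)" by algebra
  then have "\<bar>a * b - c * d\<bar> \<le> \<bar>(a - c) * b\<bar> + \<bar>c * (b - d)\<bar>"
    using abs_triangle_ineq[of "(a - c) * b" "c * (b - d)"] by (simp only:)
  also have "\<dots> = \<bar>a - c\<bar> * b + c * \<bar>b - d\<bar>"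
    using assms by (simp add: abs_mult)
  also have "\<dots> \<le> \<bar>a - c\<bar> * 1 + 1 * \<bar>b - d\<bar>"
    using assms by (intro add_mono mult_mono) auto
  finally show ?thesis by simp
qed

text \<open>Exchanging one factor at a time costs its L1 error, as the other factor lies in the unit
  interval. The weight \<open>w\<close> lets one estimate serve matrix entries and overlaps
  (\<open>w = 1\<close>) as well as integrals of test functions.\<close>

lemma integral_prod_diff:
  fixes a b c d w :: "'a \<Rightarrow> real"
  assumes M: "finite_measure M"
    and meas [measurable]: "a \<in> borel_measurable M" "b \<in> borel_measurable M" "c \<in> borel_measurable M"
      "d \<in> borel_measurable M" "w \<in> borel_measurable M"
    and unit: "\<And>x. x \<in> space M \<Longrightarrow> a x \<in> {0..1}" "\<And>x. x \<in> space M \<Longrightarrow> b x \<in> {0..1}"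
      "\<And>x. x \<in> space M \<Longrightarrow> c x \<in> {0..1}" "\<And>x. x \<in> space M \<Longrightarrow> d x \<in> {0..1}"
    and w: "\<And>x. x \<in> space M \<Longrightarrow> \<bar>w x\<bar> \<le> W"
  shows "\<bar>(\<integral>x. a x * b x * w x \<partial>M) - (\<integral>x. c x * d x * w x \<partial>M)\<bar> \<le>
    ((\<integral>x. \<bar>a x - c x\<bar> \<partial>M) + (\<integral>x. \<bar>b x - d x\<bar> \<partial>M)) * W"
    "integrable M (\<lambda>x. a x * b x * w x)"
proof -
  interpret finite_measure M by (rule M)
  have int: "integrable M (\<lambda>x. p x * q x * w x)"
    if [measurable]: "p \<in> borel_measurable M" "q \<in> borel_measurable M"
      and "\<And>x. x \<in> space M \<Longrightarrow> p x \<in> {0..1}" "\<And>x. x \<in> space M \<Longrightarrow> q x \<in> {0..1}" for p q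
  proof (rule integrable_const_bound[where B = "1 * W"])
    show "AE x in M. norm (p x * q x * w x) \<le> 1 * W"
    proof (rule AE_I2)
      fix x assume x: "x \<in> space M"
      show "norm (p x * q x * w x) \<le> 1 * W"
        unfolding real_norm_def abs_mult[of _ "w x"] using that(3,4)[OF x] w[OF x]
        by (intro mult_mono) (auto simp: abs_mult mult_in_unit)
    qed
  qed measurable
  show i1: "integrable M (\<lambda>x. a x * b x * w x)" by (intro int meas unit)
  have i2: "integrable M (\<lambda>x. c x * d x * w x)" by (intro int meas unit)
  have di: "integrable M (\<lambda>x. \<bar>p x - q x\<bar>)"
    if [measurable]: "p \<in> borel_measurable M" "q \<in> borel_measurable M"
      and "\<And>x. x \<in> space M \<Longrightarrow> p x \<in> {0..1}" "\<And>x. x \<in> space M \<Longrightarrow> q x \<in> {0..1}" for p q :: "'a \<Rightarrow> real"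
  proof (rule integrable_const_bound[where B = 1])
    show "AE x in M. norm \<bar>p x - q x\<bar> \<le> 1"
    proof (rule AE_I2)
      fix x assume "x \<in> space M"
      with that(3,4)[of x] show "norm \<bar>p x - q x\<bar> \<le> 1" by auto
    qed
  qed measurable
  note ac = di[OF meas(1,3) unit(1,3)] and bd = di[OF meas(2,4) unit(2,4)]
  have "\<bar>(\<integral>x. a x * b x * w x \<partial>M) - (\<integral>x. c x * d x * w x \<partial>M)\<bar> \<le> (\<integral>x. \<bar>a x * b x * w x - c x * d x * w x\<bar> \<partial>M)"
    unfolding Bochner_Integration.integral_diff[OF i1 i2, symmetric] by (rule integral_abs_bound)
  also have "\<dots> \<le> (\<integral>x. (\<bar>a x - c x\<bar> + \<bar>b x - d x\<bar>) * W \<partial>M)"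
  proof (rule integral_mono)
    fix x assume x: "x \<in> space M"
    have "\<bar>a x * b x * w x - c x * d x * w x\<bar> = \<bar>a x * b x - c x * d x\<bar> * \<bar>w x\<bar>"
      by (simp flip: abs_mult add: left_diff_distrib)
    also have "\<dots> \<le> (\<bar>a x - c x\<bar> + \<bar>b x - d x\<bar>) * W"
      using unit(2,3)[OF x] w[OF x] by (intro mult_mono prod_diff_unit) auto
    finally show "\<bar>a x * b x * w x - c x * d x * w x\<bar> \<le> (\<bar>a x - c x\<bar> + \<bar>b x - d x\<bar>) * W" .
  qed (use i1 i2 ac bd in auto)
  also have "\<dots> = ((\<integral>x. \<bar>a x - c x\<bar> \<partial>M) + (\<integral>x. \<bar>b x - d x\<bar> \<partial>M)) * W"
    using ac bd by simp
  finally show "\<bar>(\<integral>x. a x * b x * w x \<partial>M) - (\<integral>x. c x * d x * w x \<partial>M)\<bar> \<le>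
    ((\<integral>x. \<bar>a x - c x\<bar> \<partial>M) + (\<integral>x. \<bar>b x - d x\<bar> \<partial>M)) * W" .
qed

text \<open>The action of the kernel on functions, adjoint to its action \<open>Phi\<close> on
  measures: a product \<open>a u * b v\<close> integrated against \<open>Phi f \<mu>\<close> becomes
  the product of the transfers integrated against \<mu>.\<close>

definition transfer :: "(real \<times> real \<Rightarrow> real) \<Rightarrow> (real \<Rightarrow> real) \<Rightarrow> real \<Rightarrow> real" where
  "transfer f a x = (\<integral>u. a u * f (x, u) \<partial>lambda1)"

lemma continuous_imp_measurable_lambda2:
  "continuous_on unit_square f \<Longrightarrow> f \<in> borel_measurable lambda2"
  using borel_measurable_continuous_on_restrict measurable_cong_sets[OF sets_lambda2 refl] by blast

lemma FDC_measurable: "f \<in> FDC \<Longrightarrow> f \<in> borel_measurable lambda2"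
  by (auto simp: FDC_def intro: continuous_imp_measurable_lambda2)

lemma continuous_bounded_unit_square:
  fixes f :: "real \<times> real \<Rightarrow> real"
  assumes "continuous_on unit_square f"
  obtains B where "\<And>z. z \<in> unit_square \<Longrightarrow> \<bar>f z\<bar> \<le> B"
proof -
  have "compact (f ` unit_square)"
    by (intro compact_continuous_image[OF assms] compact_Times) auto
  then obtain B where "\<forall>y\<in>f ` unit_square. norm y \<le> B"
    using compact_imp_bounded bounded_iff by blast
  then show thesis using that[of B] by auto
qed

lemma FDC_nonneg: "f \<in> FDC \<Longrightarrow> x \<in> {0..1} \<Longrightarrow> y \<in> {0..1} \<Longrightarrow> 0 \<le> f (x, y)"
  by (auto simp: FDC_def)

lemma FDC_bounded:
  assumes "f \<in> FDC"
  obtains B where "B \<ge> 0" "\<And>x y. x \<in> {0..1} \<Longrightarrow> y \<in> {0..1} \<Longrightarrow> \<bar>f (x, y)\<bar> \<le> B"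
proof -
  have "continuous_on unit_square f" using assms by (auto simp: FDC_def)
  then obtain B where "\<And>z. z \<in> unit_square \<Longrightarrow> \<bar>f z\<bar> \<le> B" by (rule continuous_bounded_unit_square) blast
  then show thesis by (intro that[of "\<bar>B\<bar>"]) force+
qed

lemma integrable_lambda1:
  fixes a :: "real \<Rightarrow> real"
  assumes "a \<in> borel_measurable lambda1" "\<And>x. x \<in> {0..1} \<Longrightarrow> \<bar>a x\<bar> \<le> B"
  shows "integrable lambda1 a"
  using assms by (intro lambda1.integrable_const_bound[where B=B]) auto

lemma integrable_lambda2:
  fixes a :: "real \<times> real \<Rightarrow> real"
  assumes "a \<in> borel_measurable lambda2" "\<And>z. z \<in> unit_square \<Longrightarrow> \<bar>a z\<bar> \<le> B"
  shows "integrable lambda2 a"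
  using assms by (intro lambda2.integrable_const_bound[where B=B]) auto

lemma integrable_sgraphon:
  fixes a :: "real \<times> real \<Rightarrow> real"
  assumes "\<mu> \<in> sgraphons" "a \<in> borel_measurable lambda2" "\<And>z. z \<in> unit_square \<Longrightarrow> \<bar>a z\<bar> \<le> B"
  shows "integrable \<mu> a"
proof -
  interpret prob_space \<mu> using sgraphonsD[OF assms(1)] by simp
  show ?thesis using assms(2,3) measurable_sgraphonI[OF assms(1)]
    by (intro integrable_const_bound[where B=B]) (auto simp: sgraphonsD[OF assms(1)])
qed

lemma measurable_fst_lambda2: "a \<in> borel_measurable lambda1 \<Longrightarrow> (\<lambda>z. a (fst z)) \<in> borel_measurable lambda2"
  unfolding lambda2_eq by (rule measurable_compose[OF measurable_fst])

lemma measurable_snd_lambda2: "a \<in> borel_measurable lambda1 \<Longrightarrow> (\<lambda>z. a (snd z)) \<in> borel_measurable lambda2"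
  unfolding lambda2_eq by (rule measurable_compose[OF measurable_snd])

lemma integral_lambda2_prod:
  fixes a b :: "real \<Rightarrow> real"
  assumes a: "a \<in> borel_measurable lambda1" "\<And>x. x \<in> {0..1} \<Longrightarrow> \<bar>a x\<bar> \<le> A"
    and b: "b \<in> borel_measurable lambda1" "\<And>x. x \<in> {0..1} \<Longrightarrow> \<bar>b x\<bar> \<le> B"
  shows "(\<integral>z. a (fst z) * b (snd z) \<partial>lambda2) = (\<integral>x. a x \<partial>lambda1) * (\<integral>x. b x \<partial>lambda1)"
    "integrable lambda2 (\<lambda>z. a (fst z) * b (snd z))"
proof -
  have "\<bar>a x * b y\<bar> \<le> A * B" if "x \<in> {0..1}" "y \<in> {0..1}" for x y
    using a(2)[OF that(1)] b(2)[OF that(2)] by (simp add: abs_mult mult_mono')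
  then show int: "integrable lambda2 (\<lambda>z. a (fst z) * b (snd z))"
    using a b by (intro integrable_lambda2[of _ "A * B"] borel_measurable_times measurable_fst_lambda2 measurable_snd_lambda2) auto
  have "(\<integral>z. a (fst z) * b (snd z) \<partial>lambda2) = (\<integral>x. \<integral>y. a x * b y \<partial>lambda1 \<partial>lambda1)"
    using lambda1_pair.integral_fst'[OF int[unfolded lambda2_eq]] by (simp add: lambda2_eq)
  also have "\<dots> = (\<integral>x. a x \<partial>lambda1) * (\<integral>x. b x \<partial>lambda1)"
    using integrable_lambda1[OF a] by simp
  finally show "(\<integral>z. a (fst z) * b (snd z) \<partial>lambda2) = (\<integral>x. a x \<partial>lambda1) * (\<integral>x. b x \<partial>lambda1)" .
qed

lemma FDC_section:
  assumes "f \<in> FDC" "x \<in> {0..1}"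
  shows "(\<lambda>u. f (x, u)) \<in> borel_measurable lambda1" "(\<lambda>u. f (u, x)) \<in> borel_measurable lambda1"
    "(\<integral>u. f (x, u) \<partial>lambda1) = 1" "(\<integral>u. f (u, x) \<partial>lambda1) = 1"
proof -
  have "f \<in> borel_measurable (lambda1 \<Otimes>\<^sub>M lambda1)"
    using FDC_measurable[OF assms(1)] by (simp add: lambda2_eq)
  then show "(\<lambda>u. f (x, u)) \<in> borel_measurable lambda1" "(\<lambda>u. f (u, x)) \<in> borel_measurable lambda1"
    using assms(2) by (simp_all add: measurable_Pair1 measurable_Pair2)
  show "(\<integral>u. f (x, u) \<partial>lambda1) = 1" "(\<integral>u. f (u, x) \<partial>lambda1) = 1"
    using assms by (auto simp: FDC_def)
qed

lemma phi_measurable: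
  assumes f: "f \<in> FDC" and \<mu>: "\<mu> \<in> sgraphons"
  shows "(\<lambda>(w, z). f (fst z, fst w) * f (snd z, snd w)) \<in> borel_measurable (lambda2 \<Otimes>\<^sub>M \<mu>)"
    "phi f \<mu> \<in> borel_measurable lambda2"
proof -
  interpret \<mu>: prob_space \<mu> using sgraphonsD[OF \<mu>] by simp
  have [measurable]: "f \<in> borel_measurable (lambda1 \<Otimes>\<^sub>M lambda1)"
    using FDC_measurable[OF f] by (simp add: lambda2_eq)
  have "(\<lambda>(w, z). f (fst z, fst w) * f (snd z, snd w)) \<in> borel_measurable (lambda2 \<Otimes>\<^sub>M lambda2)"
    unfolding lambda2_eq by measurable
  moreover have "sets (lambda2 \<Otimes>\<^sub>M \<mu>) = sets (lambda2 \<Otimes>\<^sub>M lambda2)"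
    using sgraphonsD(2)[OF \<mu>] by (intro sets_pair_measure_cong) auto
  ultimately show m: "(\<lambda>(w, z). f (fst z, fst w) * f (snd z, snd w)) \<in> borel_measurable (lambda2 \<Otimes>\<^sub>M \<mu>)"
    using measurable_cong_sets by blast
  have "phi f \<mu> = (\<lambda>w. \<integral>z. f (fst z, fst w) * f (snd z, snd w) \<partial>\<mu>)"
    by (auto simp: phi_def case_prod_beta')
  then show "phi f \<mu> \<in> borel_measurable lambda2"
    using \<mu>.borel_measurable_lebesgue_integral[OF m] by simp
qed

lemma phi_bounds:
  assumes f: "f \<in> FDC" and \<mu>: "\<mu> \<in> sgraphons"
  shows "w \<in> unit_square \<Longrightarrow> 0 \<le> phi f \<mu> w" "integrable lambda2 (phi f \<mu>)"
proof -
  interpret \<mu>: prob_space \<mu> using sgraphonsD[OF \<mu>] by simp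
  note sp = sgraphonsD(3)[OF \<mu>]
  show "w \<in> unit_square \<Longrightarrow> 0 \<le> phi f \<mu> w" for w
    unfolding phi_def using FDC_nonneg[OF f]
    by (auto simp: sp case_prod_beta' intro!: Bochner_Integration.integral_nonneg mult_nonneg_nonneg)
  obtain B where B: "B \<ge> 0" "\<And>x y. x \<in> {0..1} \<Longrightarrow> y \<in> {0..1} \<Longrightarrow> \<bar>f (x, y)\<bar> \<le> B"
    using FDC_bounded[OF f] by metis
  have "\<bar>phi f \<mu> w\<bar> \<le> B * B" if "w \<in> unit_square" for w
  proof -
    have "\<bar>phi f \<mu> w\<bar> \<le> (\<integral>z. \<bar>f (fst z, fst w) * f (snd z, snd w)\<bar> \<partial>\<mu>)"
      unfolding phi_def case_prod_beta' by (rule integral_abs_bound)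
    also have "\<dots> \<le> (\<integral>z. B * B \<partial>\<mu>)"
      using that B by (intro integral_mono') (auto simp: sp abs_mult intro!: mult_mono)
    finally show ?thesis using \<mu>.prob_space by simp
  qed
  then show "integrable lambda2 (phi f \<mu>)"
    by (rule integrable_lambda2[OF phi_measurable(2)[OF f \<mu>]])
qed

lemma integral_Phi:
  assumes f: "f \<in> FDC" and \<mu>: "\<mu> \<in> sgraphons" and \<psi>: "\<psi> \<in> borel_measurable lambda2"
  shows "(\<integral>w. \<psi> w \<partial>Phi f \<mu>) = (\<integral>w. phi f \<mu> w * \<psi> w \<partial>lambda2)"
  unfolding Phi_def using phi_bounds[OF f \<mu>] phi_measurable[OF f \<mu>] \<psi>
  by (subst integral_density) auto

text \<open>Fubini moves the integral over \<mu> outside; for a fixed point of the square the inner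
  integral factors into two transfers.\<close>

lemma integral_phi_prod:
  assumes f: "f \<in> FDC" and \<mu>: "\<mu> \<in> sgraphons"
    and a: "a \<in> borel_measurable lambda1" "\<And>x. x \<in> {0..1} \<Longrightarrow> \<bar>a x\<bar> \<le> A"
    and b: "b \<in> borel_measurable lambda1" "\<And>x. x \<in> {0..1} \<Longrightarrow> \<bar>b x\<bar> \<le> B"
  shows "(\<integral>w. phi f \<mu> w * (a (fst w) * b (snd w)) \<partial>lambda2) =
    (\<integral>z. transfer f a (fst z) * transfer f b (snd z) \<partial>\<mu>)"
proof -
  interpret \<mu>: prob_space \<mu> using sgraphonsD[OF \<mu>] by simp
  interpret P: pair_prob_space lambda2 \<mu> ..
  note sp = sgraphonsD(3)[OF \<mu>]
  obtain C where C: "C \<ge> 0" "\<And>x y. x \<in> {0..1} \<Longrightarrow> y \<in> {0..1} \<Longrightarrow> \<bar>f (x, y)\<bar> \<le> C"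
    using FDC_bounded[OF f] by metis
  let ?H = "\<lambda>w z. (f (fst z, fst w) * f (snd z, snd w)) * (a (fst w) * b (snd w))"
  have "(\<lambda>w. a (fst w) * b (snd w)) \<in> borel_measurable lambda2"
    using a b by (intro borel_measurable_times measurable_fst_lambda2 measurable_snd_lambda2)
  from measurable_compose[OF measurable_fst this, of \<mu>]
  have H: "(\<lambda>(w, z). ?H w z) \<in> borel_measurable (lambda2 \<Otimes>\<^sub>M \<mu>)"
    using phi_measurable(1)[OF f \<mu>] by (simp add: case_prod_beta')
  have "\<bar>?H w z\<bar> \<le> (C * C) * (A * B)" if "w \<in> unit_square" "z \<in> unit_square" for w z
    unfolding abs_mult using that C a(2)[of "fst w"] b(2)[of "snd w"]
    by (intro mult_mono mult_nonneg_nonneg) auto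
  then have int: "integrable (lambda2 \<Otimes>\<^sub>M \<mu>) (\<lambda>(w, z). ?H w z)"
    using H by (intro P.integrable_const_bound[where B="(C * C) * (A * B)"])
      (auto simp: space_pair_measure sp)
  have "(\<integral>w. phi f \<mu> w * (a (fst w) * b (snd w)) \<partial>lambda2) = (\<integral>w. \<integral>z. ?H w z \<partial>\<mu> \<partial>lambda2)"
    unfolding phi_def case_prod_beta' by simp
  also have "\<dots> = (\<integral>z. \<integral>w. ?H w z \<partial>lambda2 \<partial>\<mu>)"
    by (rule P.Fubini_integral[OF int, symmetric])
  also have "\<dots> = (\<integral>z. transfer f a (fst z) * transfer f b (snd z) \<partial>\<mu>)"
  proof (intro Bochner_Integration.integral_cong refl)
    fix z assume "z \<in> space \<mu>"
    then have z: "fst z \<in> {0..1}" "snd z \<in> {0..1}" by (auto simp: sp)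
    have "(\<integral>w. ?H w z \<partial>lambda2) = (\<integral>w. (a (fst w) * f (fst z, fst w)) * (b (snd w) * f (snd z, snd w)) \<partial>lambda2)"
      by (simp add: mult_ac)
    also have "\<dots> = transfer f a (fst z) * transfer f b (snd z)"
      unfolding transfer_def
    proof (rule integral_lambda2_prod)
      show "(\<lambda>u. a u * f (fst z, u)) \<in> borel_measurable lambda1" "(\<lambda>u. b u * f (snd z, u)) \<in> borel_measurable lambda1"
        using a b FDC_section[OF f] z by auto
      show "\<bar>a u * f (fst z, u)\<bar> \<le> A * C" if "u \<in> {0..1}" for u
        unfolding abs_mult using a(2)[OF that] C z that by (intro mult_mono) auto
      show "\<bar>b u * f (snd z, u)\<bar> \<le> B * C" if "u \<in> {0..1}" for u
        unfolding abs_mult using b(2)[OF that] C z that by (intro mult_mono) auto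
    qed
    finally show "(\<integral>w. ?H w z \<partial>lambda2) = transfer f a (fst z) * transfer f b (snd z)" .
  qed
  finally show ?thesis .
qed

text \<open>The total mass comes from testing with the constant 1, whose transfer is 1 because
  \<open>f (x, u)\<close> integrates to 1 in \<open>u\<close>; symmetry of the density is inherited
  from \<mu>.\<close>

lemma Phi_in_sgraphons:
  assumes f: "f \<in> FDC" and \<mu>: "\<mu> \<in> sgraphons"
  shows "Phi f \<mu> \<in> sgraphons"
  unfolding Phi_def
proof (rule density_in_sgraphons)
  interpret \<mu>: prob_space \<mu> using sgraphonsD[OF \<mu>] by simp
  show "phi f \<mu> \<in> borel_measurable lambda2" "integrable lambda2 (phi f \<mu>)"
    and "w \<in> unit_square \<Longrightarrow> 0 \<le> phi f \<mu> w" for w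
    using phi_measurable[OF f \<mu>] phi_bounds[OF f \<mu>] by auto
  have "(\<integral>z. phi f \<mu> z \<partial>lambda2) = (\<integral>z. transfer f (\<lambda>_. 1) (fst z) * transfer f (\<lambda>_. 1) (snd z) \<partial>\<mu>)"
    using integral_phi_prod[OF f \<mu>, of "\<lambda>_. 1" 1 "\<lambda>_. 1" 1] by simp
  also have "\<dots> = (\<integral>z. 1 \<partial>\<mu>)"
    using FDC_section(3)[OF f]
    by (intro Bochner_Integration.integral_cong) (auto simp: transfer_def sgraphonsD(3)[OF \<mu>])
  finally show "(\<integral>z. phi f \<mu> z \<partial>lambda2) = 1" using \<mu>.prob_space by simp
  fix u v :: real assume uv: "u \<in> {0..1}" "v \<in> {0..1}"
  have "(\<lambda>z. f (fst z, u) * f (snd z, v)) \<in> borel_measurable lambda2"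
    using measurable_fst_lambda2[OF FDC_section(2)[OF f uv(1)]] measurable_snd_lambda2[OF FDC_section(2)[OF f uv(2)]]
    by (rule borel_measurable_times)
  from integral_sgraphon_swap[OF \<mu> this] show "phi f \<mu> (v, u) = phi f \<mu> (u, v)"
    by (simp add: phi_def case_prod_beta' mult.commute)
qed

section \<open>Matrices of partitions under the action of kernels\<close>

definition partition_matrix :: "nat \<Rightarrow> (nat \<Rightarrow> real \<Rightarrow> real) \<Rightarrow> (real \<times> real) measure \<Rightarrow> nat \<times> nat \<Rightarrow> real" where
  "partition_matrix k f \<mu> = (\<lambda>(i, j)\<in>{1..k} \<times> {1..k}. \<integral>(x, y). f i x * f j y \<partial>\<mu>)"

lemma partition_matrix_apply:
  "i \<in> {1..k} \<Longrightarrow> j \<in> {1..k} \<Longrightarrow> partition_matrix k f \<mu> (i, j) = (\<integral>z. f i (fst z) * f j (snd z) \<partial>\<mu>)"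
  by (simp add: partition_matrix_def case_prod_beta')

lemma topspace_matrix_topology: "topspace (matrix_topology k) = PiE ({1..k} \<times> {1..k}) (\<lambda>_. UNIV)"
  by (simp add: matrix_topology_def)

lemma partition_matrix_in_topspace: "partition_matrix k f \<mu> \<in> topspace (matrix_topology k)"
  by (auto simp: topspace_matrix_topology partition_matrix_def)

lemma k_shape_eq:
  "k_shape k \<mu> = matrix_topology k closure_of ((\<lambda>f. partition_matrix k f \<mu>) ` fractional_partitions k)"
  unfolding k_shape_def partition_matrix_def by (intro arg_cong2[where f = "(closure_of)"]) auto

lemma partition_matrix_in_k_shape:
  assumes "f \<in> fractional_partitions k"
  shows "partition_matrix k f \<mu> \<in> k_shape k \<mu>"
proof -
  have "(\<lambda>f. partition_matrix k f \<mu>) ` fractional_partitions k \<subseteq> k_shape k \<mu>"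
    unfolding k_shape_eq using partition_matrix_in_topspace by (intro closure_of_subset) auto
  then show ?thesis using assms by blast
qed

text \<open>Both marginal conditions of \<open>FDC\<close> enter: integration in the second variable
  keeps the sum equal to 1, and, after Fubini, integration in the first keeps the integrals equal to
  \<open>1 / k\<close>.\<close>

lemma transfer_in_fractional_partitions:
  assumes f: "f \<in> FDC" and a: "a \<in> fractional_partitions k"
  shows "(\<lambda>i. transfer f (a i)) \<in> fractional_partitions k"
proof -
  note D = fractional_partitionsD[OF a]
  obtain B where B: "B \<ge> 0" "\<And>x y. x \<in> {0..1} \<Longrightarrow> y \<in> {0..1} \<Longrightarrow> \<bar>f (x, y)\<bar> \<le> B"
    using FDC_bounded[OF f] by metis
  have [measurable]: "f \<in> borel_measurable (lambda1 \<Otimes>\<^sub>M lambda1)"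
    using FDC_measurable[OF f] by (simp add: lambda2_eq)
  have m: "(\<lambda>(x, u). a i u * f (x, u)) \<in> borel_measurable (lambda1 \<Otimes>\<^sub>M lambda1)" if "i \<in> {1..k}" for i
    using D(1)[OF that] by measurable
  have ab: "\<bar>a i u * f (x, u)\<bar> \<le> 1 * B" if "i \<in> {1..k}" "x \<in> {0..1}" "u \<in> {0..1}" for i x u
    unfolding abs_mult using B D(2,3)[OF that(1,3)] that by (intro mult_mono) auto
  have tm: "transfer f (a i) \<in> borel_measurable lambda1" if "i \<in> {1..k}" for i
    unfolding transfer_def by (rule lambda1.borel_measurable_lebesgue_integral[OF m[OF that]])
  have int: "integrable lambda1 (\<lambda>u. a i u * f (x, u))" if "i \<in> {1..k}" "x \<in> {0..1}" for i x
    using ab that FDC_section(1)[OF f] D(1)[OF that(1)] by (intro integrable_lambda1[of _ "1 * B"]) auto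
  show ?thesis
    unfolding fractional_partitions_def
  proof (intro CollectI conjI ballI)
    fix i assume i: "i \<in> {1..k}"
    show "transfer f (a i) \<in> borel_measurable (restrict_space borel {0..1})"
      using tm[OF i] measurable_cong_sets[OF sets_lambda1 refl] by blast
    show "0 \<le> transfer f (a i) x" if "x \<in> {0..1}" for x
      unfolding transfer_def using D(2)[OF i] FDC_nonneg[OF f] that
      by (intro Bochner_Integration.integral_nonneg mult_nonneg_nonneg) auto
    have "integrable (lambda1 \<Otimes>\<^sub>M lambda1) (\<lambda>(x, u). a i u * f (x, u))"
      using m[OF i] ab[OF i]
      by (intro lambda1_pair.integrable_const_bound[where B = "1 * B"]) (auto simp: space_pair_measure)
    from lambda1_pair.Fubini_integral[OF this]
    have "(\<integral>x. transfer f (a i) x \<partial>lambda1) = (\<integral>u. \<integral>x. a i u * f (x, u) \<partial>lambda1 \<partial>lambda1)"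
      by (simp add: transfer_def)
    also have "\<dots> = (\<integral>u. a i u \<partial>lambda1)"
      using FDC_section(4)[OF f] by (intro Bochner_Integration.integral_cong) auto
    finally show "(\<integral>x. transfer f (a i) x \<partial>lambda1) = 1 / real k" using D(4)[OF i] by simp
  next
    fix x :: real assume x: "x \<in> {0..1}"
    have "(\<Sum>i=1..k. transfer f (a i) x) = (\<integral>u. (\<Sum>i=1..k. a i u * f (x, u)) \<partial>lambda1)"
      unfolding transfer_def using int x by (subst Bochner_Integration.integral_sum) auto
    also have "\<dots> = (\<integral>u. f (x, u) \<partial>lambda1)"
    proof (intro Bochner_Integration.integral_cong refl)
      fix u assume "u \<in> space lambda1"
      then have "(\<Sum>i=1..k. a i u) = 1" using fractional_partitions_sum[OF a] by simp
      then show "(\<Sum>i=1..k. a i u * f (x, u)) = f (x, u)" by (simp flip: sum_distrib_right)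
    qed
    finally show "(\<Sum>i=1..k. transfer f (a i) x) = 1" using FDC_section(3)[OF f x] by simp
  qed
qed

text \<open>Adjointness of \<open>transfer\<close> and \<open>Phi\<close>. Hence every partition
  matrix of \<open>Phi f \<mu>\<close> is already one of \<mu>, for the transferred
  partition.\<close>

lemma partition_matrix_Phi:
  assumes f: "f \<in> FDC" and \<mu>: "\<mu> \<in> sgraphons" and a: "a \<in> fractional_partitions k"
  shows "partition_matrix k a (Phi f \<mu>) = partition_matrix k (\<lambda>i. transfer f (a i)) \<mu>"
proof (rule PiE_ext)
  show "partition_matrix k a (Phi f \<mu>) \<in> PiE ({1..k} \<times> {1..k}) (\<lambda>_. UNIV)"
    "partition_matrix k (\<lambda>i. transfer f (a i)) \<mu> \<in> PiE ({1..k} \<times> {1..k}) (\<lambda>_. UNIV)"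
    unfolding topspace_matrix_topology[symmetric] by (rule partition_matrix_in_topspace)+
  fix p assume "p \<in> {1..k} \<times> {1..k}"
  then obtain i j where p: "p = (i, j)" and i: "i \<in> {1..k}" and j: "j \<in> {1..k}" by blast
  note D = fractional_partitionsD[OF a]
  have b: "\<bar>a l x\<bar> \<le> 1" if "l \<in> {1..k}" "x \<in> {0..1}" for l x using D(2,3)[OF that] by auto
  have "(\<lambda>z. a i (fst z) * a j (snd z)) \<in> borel_measurable lambda2"
    using D(1) i j by (intro borel_measurable_times measurable_fst_lambda2 measurable_snd_lambda2) auto
  then have "(\<integral>z. a i (fst z) * a j (snd z) \<partial>Phi f \<mu>) = (\<integral>z. phi f \<mu> z * (a i (fst z) * a j (snd z)) \<partial>lambda2)"
    by (rule integral_Phi[OF f \<mu>])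
  also have "\<dots> = (\<integral>z. transfer f (a i) (fst z) * transfer f (a j) (snd z) \<partial>\<mu>)"
    by (rule integral_phi_prod[OF f \<mu> D(1)[OF i] b[OF i] D(1)[OF j] b[OF j]])
  finally show "partition_matrix k a (Phi f \<mu>) p = partition_matrix k (\<lambda>i. transfer f (a i)) \<mu> p"
    by (simp only: p partition_matrix_apply[OF i j])
qed

section \<open>Partition kernels and cells\<close>

text \<open>The factor \<open>k\<close> cancels the integrals \<open>1 / k\<close>, so that
  integrating out one variable leaves the sum of the partition in the other, which is 1.\<close>

definition partition_kernel :: "nat \<Rightarrow> (nat \<Rightarrow> real \<Rightarrow> real) \<Rightarrow> (nat \<Rightarrow> real \<Rightarrow> real) \<Rightarrow> real \<times> real \<Rightarrow> real" where
  "partition_kernel k g h = (\<lambda>(x, u). \<Sum>i=1..k. real k * g i x * h i u)"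

lemma partition_integrable:
  assumes "f \<in> fractional_partitions k" "i \<in> {1..k}"
  shows "integrable lambda1 (f i)"
  using fractional_partitionsD[OF assms] by (intro integrable_lambda1[of _ 1]) auto

lemma partition_integrable_prod:
  assumes "\<mu> \<in> sgraphons" "f \<in> fractional_partitions k" "i \<in> {1..k}" "j \<in> {1..k}"
  shows "integrable \<mu> (\<lambda>z. f i (fst z) * f j (snd z))"
proof (rule integrable_sgraphon[OF assms(1), of _ 1])
  note D = fractional_partitionsD[OF assms(2)]
  show "(\<lambda>z. f i (fst z) * f j (snd z)) \<in> borel_measurable lambda2"
    using D(1) assms by (intro borel_measurable_times measurable_fst_lambda2 measurable_snd_lambda2) auto
  show "\<bar>f i (fst z) * f j (snd z)\<bar> \<le> 1" if "z \<in> unit_square" for z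
    using D(2,3)[OF assms(3), of "fst z"] D(2,3)[OF assms(4), of "snd z"] that
    by (auto simp: abs_mult mult_in_unit)
qed

lemma partition_kernel_FDC:
  assumes g: "g \<in> continuous_partitions k" and h: "h \<in> continuous_partitions k" and k: "k \<ge> 1"
  shows "partition_kernel k g h \<in> FDC"
  unfolding FDC_def
proof (intro CollectI conjI ballI)
  note Dg = continuous_partitionsD[OF g] and Dh = continuous_partitionsD[OF h]
  have int: "integrable lambda1 (g i)" "integrable lambda1 (h i)" if "i \<in> {1..k}" for i
    using partition_integrable continuous_partitions_subset g h that by blast+
  have "continuous_on unit_square (\<lambda>z. g i (fst z))" "continuous_on unit_square (\<lambda>z. h i (snd z))"
    if "i \<in> {1..k}" for i
    using continuous_on_compose2[OF Dg(1)[OF that] continuous_on_fst[OF continuous_on_id]]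
      continuous_on_compose2[OF Dh(1)[OF that] continuous_on_snd[OF continuous_on_id]] by auto
  then have "continuous_on unit_square (\<lambda>z. \<Sum>i=1..k. real k * g i (fst z) * h i (snd z))"
    by (intro continuous_on_sum continuous_on_mult continuous_on_const)
  then show "continuous_on unit_square (partition_kernel k g h)"
    by (simp add: partition_kernel_def case_prod_beta')
  show "0 \<le> partition_kernel k g h z" for z
    using Dg(2) Dh(2) by (auto simp: partition_kernel_def case_prod_beta' intro!: sum_nonneg)
  fix x :: real
  have "(\<integral>v. partition_kernel k g h (x, v) \<partial>lambda1) = (\<Sum>i=1..k. k * g i x * (\<integral>v. h i v \<partial>lambda1))"
    unfolding partition_kernel_def using int by (simp add: Bochner_Integration.integral_sum)
  also have "\<dots> = (\<Sum>i=1..k. g i x)" using Dh(4) k by (intro sum.cong) auto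
  finally show "(\<integral>v. partition_kernel k g h (x, v) \<partial>lambda1) = 1" using continuous_partitions_sum[OF g] by simp
  have "(\<integral>v. partition_kernel k g h (v, x) \<partial>lambda1) = (\<Sum>i=1..k. k * (\<integral>v. g i v \<partial>lambda1) * h i x)"
    unfolding partition_kernel_def using int by (simp add: Bochner_Integration.integral_sum)
  also have "\<dots> = (\<Sum>i=1..k. h i x)" using Dg(4) k by (intro sum.cong) auto
  finally show "(\<integral>v. partition_kernel k g h (v, x) \<partial>lambda1) = 1" using continuous_partitions_sum[OF h] by simp
qed

lemma phi_partition_kernel:
  assumes g: "g \<in> continuous_partitions k" and \<mu>: "\<mu> \<in> sgraphons"
  shows "phi (partition_kernel k g h) \<mu> w =
    (\<Sum>i=1..k. \<Sum>j=1..k. (real k)\<^sup>2 * partition_matrix k g \<mu> (i, j) * (h i (fst w) * h j (snd w)))"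
proof -
  have int: "integrable \<mu> (\<lambda>z. g i (fst z) * g j (snd z))" if "i \<in> {1..k}" "j \<in> {1..k}" for i j
    using partition_integrable_prod[OF \<mu> _ that] continuous_partitions_subset g by blast
  have "phi (partition_kernel k g h) \<mu> w = (\<integral>z. (\<Sum>i=1..k. \<Sum>j=1..k.
      (real k)\<^sup>2 * (h i (fst w) * h j (snd w)) * (g i (fst z) * g j (snd z))) \<partial>\<mu>)"
    unfolding phi_def partition_kernel_def case_prod_beta' fst_conv snd_conv sum_product
    by (simp add: power2_eq_square mult_ac)
  also have "\<dots> = (\<Sum>i=1..k. \<Sum>j=1..k.
      (real k)\<^sup>2 * (h i (fst w) * h j (snd w)) * (\<integral>z. g i (fst z) * g j (snd z) \<partial>\<mu>))"
    using int by (subst integral_double_sum(1)) auto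
  also have "\<dots> = (\<Sum>i=1..k. \<Sum>j=1..k. (real k)\<^sup>2 * partition_matrix k g \<mu> (i, j) * (h i (fst w) * h j (snd w)))"
    by (intro sum.cong refl) (simp add: partition_matrix_apply)
  finally show ?thesis .
qed

text \<open>The coefficients are \<open>k\<close> times the Gram matrix of \<open>h\<close>, which
  would be the identity for sharp cells. So the kernel nearly carries \<open>h i\<close> to
  \<open>g i\<close>.\<close>

lemma transfer_partition_kernel:
  assumes h: "h \<in> continuous_partitions k" and i: "i \<in> {1..k}"
  shows "transfer (partition_kernel k g h) (h i) x = (\<Sum>j=1..k. g j x * (k * (\<integral>u. h i u * h j u \<partial>lambda1)))"
proof -
  note Dh = continuous_partitionsD[OF h]
  have int: "integrable lambda1 (\<lambda>u. h i u * h j u)" if j: "j \<in> {1..k}" for j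
    using Dh[OF i] Dh[OF j]
    by (intro integrable_lambda1[of _ 1] borel_measurable_times measurable_lambda1I) (auto simp: abs_mult mult_in_unit)
  have "transfer (partition_kernel k g h) (h i) x = (\<integral>u. (\<Sum>j=1..k. g j x * k * (h i u * h j u)) \<partial>lambda1)"
    unfolding transfer_def partition_kernel_def by (simp add: sum_distrib_left mult_ac)
  also have "\<dots> = (\<Sum>j=1..k. g j x * k * (\<integral>u. h i u * h j u \<partial>lambda1))"
    using int by (subst Bochner_Integration.integral_sum; simp)
  finally show ?thesis by (simp add: mult_ac)
qed

section \<open>The partition of the unit interval into \<open>k\<close> cells\<close>

definition cell_index :: "nat \<Rightarrow> real \<Rightarrow> nat" where
  "cell_index k u = max 1 (nat \<lceil>real k * u\<rceil>)"

text \<open>The cell of index \<open>i\<close> is \<open>((i - 1) / k, i / k]\<close>, with \<open>0\<close> added to the first one.\<close>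

definition cell_partition :: "nat \<Rightarrow> nat \<Rightarrow> real \<Rightarrow> real" where
  "cell_partition k i u = of_bool (cell_index k u = i)"

lemma cell_index_range: "k \<ge> 1 \<Longrightarrow> u \<in> {0..1} \<Longrightarrow> cell_index k u \<in> {1..k}"
proof -
  assume "k \<ge> 1" and u: "u \<in> {0..1}"
  have "real k * u \<le> real k * 1" using u by (intro mult_left_mono) auto
  then have "\<lceil>real k * u\<rceil> \<le> int k" by (simp add: ceiling_le_iff)
  then show ?thesis using \<open>k \<ge> 1\<close> by (simp add: cell_index_def nat_le_iff)
qed

lemma cell_index_eq_iff:
  assumes k: "k \<ge> 1" and u: "u \<in> {0..1}" and i: "i \<in> {1..k}"
  shows "cell_index k u = i \<longleftrightarrow> u \<in> (if i = 1 then {0..1 / k} else {(real i - 1) / k<..real i / k})"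
proof (cases "i = 1")
  case True
  have "max 1 n = 1 \<longleftrightarrow> n \<le> 1" for n :: nat by (simp add: max_def)
  then have "cell_index k u = 1 \<longleftrightarrow> nat \<lceil>real k * u\<rceil> \<le> 1"
    unfolding cell_index_def .
  also have "\<dots> \<longleftrightarrow> \<lceil>real k * u\<rceil> \<le> 1" by linarith
  also have "\<dots> \<longleftrightarrow> u \<le> 1 / k" using k by (simp add: ceiling_le_iff field_simps)
  finally show ?thesis using True u by simp
next
  case False
  then have i: "i \<ge> 2" using i by auto
  then have "cell_index k u = i \<longleftrightarrow> \<lceil>real k * u\<rceil> = int i"
    by (auto simp: cell_index_def max_def)
  also have "\<dots> \<longleftrightarrow> real i - 1 < real k * u \<and> real k * u \<le> real i"
    by (simp add: ceiling_eq_iff)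
  also have "\<dots> \<longleftrightarrow> (real i - 1) / k < u \<and> u \<le> real i / k"
    using k by (simp add: field_simps)
  finally show ?thesis using False by simp
qed

text \<open>The right end point \<open>i / k\<close> is the sample point of cell \<open>i\<close>;
  it stands for the whole cell when test functions are discretised.\<close>

lemma cell_index_dist:
  assumes "k \<ge> 1" "u \<in> {0..1}" "i \<in> {1..k}" "cell_index k u = i"
  shows "\<bar>u - real i / k\<bar> \<le> 1 / k"
  using cell_index_eq_iff[OF assms(1-3)] assms(2,4) by (auto simp: diff_divide_distrib split: if_splits)

lemma cell_partition_01: "0 \<le> cell_partition k i u" "cell_partition k i u \<le> 1"
  by (auto simp: cell_partition_def)

lemma cell_partition_measurable: "cell_partition k i \<in> borel_measurable borel"
  unfolding cell_partition_def cell_index_def by measurable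

lemma cell_partition_in_fractional_partitions:
  assumes k: "k \<ge> 1"
  shows "cell_partition k \<in> fractional_partitions k"
  unfolding fractional_partitions_def
proof (intro CollectI conjI ballI)
  fix i assume i: "i \<in> {1..k}"
  show "cell_partition k i \<in> borel_measurable (restrict_space borel {0..1})"
    by (intro measurable_restrict_space1 cell_partition_measurable)
  let ?A = "if i = 1 then {0..1 / k} else {(real i - 1) / k<..real i / k}"
  have "real i / k \<le> 1" using i k by (simp add: field_simps)
  moreover have "0 \<le> (real i - 1) / k" using i by simp
  ultimately have A: "?A \<subseteq> {0..1}" "?A \<in> sets borel"
    by auto
  have "(\<integral>u. cell_partition k i u \<partial>lambda1) = (\<integral>u. indicator ?A u \<partial>lambda1)"
    using cell_index_eq_iff[OF k _ i] by (intro Bochner_Integration.integral_cong) (auto simp: cell_partition_def)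
  also have "\<dots> = measure lborel ?A"
    using A by (simp add: measure_def emeasure_lambda1 Int_absorb2)
  also have "\<dots> = 1 / k"
    using i k by (auto simp: diff_divide_distrib)
  finally show "(\<integral>u. cell_partition k i u \<partial>lambda1) = 1 / k" .
next
  fix x :: real assume "x \<in> {0..1}"
  with cell_index_range[OF k this] show "(\<Sum>i=1..k. cell_partition k i x) = 1"
    by (simp add: cell_partition_def of_bool_def)
qed (simp add: cell_partition_01)

section \<open>Error estimates for matrices and for integrals of test functions\<close>

lemma matrix_dist_le:
  assumes "\<And>i j. i \<in> {1..k} \<Longrightarrow> j \<in> {1..k} \<Longrightarrow> \<bar>A (i, j) - B (i, j)\<bar> \<le> c"
  shows "matrix_dist k A B \<le> (real k)\<^sup>2 * c"
proof -
  have "matrix_dist k A B \<le> (\<Sum>p\<in>{1..k} \<times> {1..k}. \<bar>A p - B p\<bar>)"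
    using L2_set_le_sum_abs[of "\<lambda>p. A p - B p" "{1..k} \<times> {1..k}"] by (simp add: matrix_dist_def L2_set_def)
  also have "\<dots> \<le> real (card ({1..k} \<times> {1..k})) * c"
    using assms by (intro sum_bounded_above) auto
  finally show ?thesis by (simp add: power2_eq_square)
qed

lemma abs_entry_le_matrix_dist:
  assumes "i \<in> {1..k}" "j \<in> {1..k}"
  shows "\<bar>A (i, j) - B (i, j)\<bar> \<le> matrix_dist k A B"
proof -
  have "sqrt ((A (i, j) - B (i, j))\<^sup>2) \<le> matrix_dist k A B"
    unfolding matrix_dist_def using assms
    by (intro real_sqrt_le_mono member_le_sum[where f = "\<lambda>p. (A p - B p)\<^sup>2"]) auto
  then show ?thesis by simp
qed

text \<open>The two marginals of a symmetric measure coincide, which is why approximations of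
  partitions control the first coordinate only.\<close>

lemma partition_diff_integrable:
  assumes "\<mu> \<in> sgraphons" "f \<in> fractional_partitions k" "g \<in> fractional_partitions k" "i \<in> {1..k}"
  shows "integrable \<mu> (\<lambda>z. \<bar>f i (fst z) - g i (fst z)\<bar>)"
    "(\<integral>z. \<bar>f i (snd z) - g i (snd z)\<bar> \<partial>\<mu>) = (\<integral>z. \<bar>f i (fst z) - g i (fst z)\<bar> \<partial>\<mu>)"
proof -
  note Df = fractional_partitionsD[OF assms(2,4)] and Dg = fractional_partitionsD[OF assms(3,4)]
  have m: "(\<lambda>x. \<bar>f i x - g i x\<bar>) \<in> borel_measurable lambda1" using Df(1) Dg(1) by measurable
  have b: "\<bar>\<bar>f i x - g i x\<bar>\<bar> \<le> 1" if "x \<in> {0..1}" for x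
    using Df(2,3)[OF that] Dg(2,3)[OF that] by linarith
  show "integrable \<mu> (\<lambda>z. \<bar>f i (fst z) - g i (fst z)\<bar>)"
    by (rule integrable_sgraphon[OF assms(1) measurable_fst_lambda2[OF m], of 1]) (use b in force)
  show "(\<integral>z. \<bar>f i (snd z) - g i (snd z)\<bar> \<partial>\<mu>) = (\<integral>z. \<bar>f i (fst z) - g i (fst z)\<bar> \<partial>\<mu>)"
    using integral_sgraphon_swap[OF assms(1) measurable_fst_lambda2[OF m]] by simp
qed

lemma partition_matrix_diff:
  assumes \<mu>: "\<mu> \<in> sgraphons" and f: "f \<in> fractional_partitions k" and g: "g \<in> fractional_partitions k"
    and i: "i \<in> {1..k}" and j: "j \<in> {1..k}"
  shows "\<bar>partition_matrix k f \<mu> (i, j) - partition_matrix k g \<mu> (i, j)\<bar> \<le>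
    (\<integral>z. \<bar>f i (fst z) - g i (fst z)\<bar> \<partial>\<mu>) + (\<integral>z. \<bar>f j (fst z) - g j (fst z)\<bar> \<partial>\<mu>)"
proof -
  interpret \<mu>: prob_space \<mu> using sgraphonsD[OF \<mu>] by simp
  have m: "(\<lambda>z. q l (fst z)) \<in> borel_measurable \<mu>" "(\<lambda>z. q l (snd z)) \<in> borel_measurable \<mu>"
    and u: "z \<in> space \<mu> \<Longrightarrow> q l (fst z) \<in> {0..1}" "z \<in> space \<mu> \<Longrightarrow> q l (snd z) \<in> {0..1}"
    if "q \<in> fractional_partitions k" "l \<in> {1..k}" for q l z
  proof -
    note D = fractional_partitionsD[OF that]
    show "(\<lambda>z. q l (fst z)) \<in> borel_measurable \<mu>" "(\<lambda>z. q l (snd z)) \<in> borel_measurable \<mu>"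
      by (intro measurable_sgraphonI[OF \<mu>] measurable_fst_lambda2 measurable_snd_lambda2 D(1))+
    show "z \<in> space \<mu> \<Longrightarrow> q l (fst z) \<in> {0..1}" "z \<in> space \<mu> \<Longrightarrow> q l (snd z) \<in> {0..1}"
      using D(2,3)[of "fst z"] D(2,3)[of "snd z"] by (auto simp: sgraphonsD(3)[OF \<mu>])
  qed
  have "\<bar>(\<integral>z. f i (fst z) * f j (snd z) * 1 \<partial>\<mu>) - (\<integral>z. g i (fst z) * g j (snd z) * 1 \<partial>\<mu>)\<bar> \<le>
      ((\<integral>z. \<bar>f i (fst z) - g i (fst z)\<bar> \<partial>\<mu>) + (\<integral>z. \<bar>f j (snd z) - g j (snd z)\<bar> \<partial>\<mu>)) * 1"
    by (rule integral_prod_diff(1)) (use m u f g i j \<mu>.finite_measure_axioms in auto)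
  then show ?thesis
    by (simp add: partition_matrix_apply[OF i j] partition_diff_integrable(2)[OF \<mu> f g j])
qed

lemma lambda2_in_sgraphons: "density lambda2 (\<lambda>_. ennreal 1) \<in> sgraphons"
proof (rule density_in_sgraphons)
  show "(\<integral>z. 1 \<partial>lambda2) = (1 :: real)" using lambda2.prob_space by simp
qed simp_all

text \<open>Only the Lebesgue half of the approximation lemma is kept, so any s-graphon may be fed
  into it; the uniform one is at hand.\<close>

lemma continuous_cells:
  assumes k: "k \<ge> 1" and \<epsilon>: "\<epsilon> > 0"
  shows "\<exists>h\<in>continuous_partitions k. \<forall>i\<in>{1..k}. (\<integral>u. \<bar>cell_partition k i u - h i u\<bar> \<partial>lambda1) \<le> \<epsilon>"
proof (rule fractional_partition_approx[OF lambda2_in_sgraphons cell_partition_in_fractional_partitions[OF k] k \<epsilon>])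
  fix h assume "h \<in> continuous_partitions k"
    and "\<And>i. i \<in> {1..k} \<Longrightarrow> (\<integral>u. \<bar>cell_partition k i u - h i u\<bar> \<partial>lambda1) \<le> \<epsilon>"
  then show ?thesis by (intro bexI[of _ h] ballI)
qed

lemma integral_lambda2_prod_diff:
  fixes \<psi> :: "real \<times> real \<Rightarrow> real"
  assumes f: "f \<in> fractional_partitions k" and g: "g \<in> fractional_partitions k"
    and i: "i \<in> {1..k}" and j: "j \<in> {1..k}"
    and \<epsilon>: "\<And>i. i \<in> {1..k} \<Longrightarrow> (\<integral>u. \<bar>f i u - g i u\<bar> \<partial>lambda1) \<le> \<epsilon>"
    and \<psi>: "\<psi> \<in> borel_measurable lambda2" "\<And>z. z \<in> unit_square \<Longrightarrow> \<bar>\<psi> z\<bar> \<le> B"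
  shows "\<bar>(\<integral>z. f i (fst z) * f j (snd z) * \<psi> z \<partial>lambda2) - (\<integral>z. g i (fst z) * g j (snd z) * \<psi> z \<partial>lambda2)\<bar> \<le> 2 * \<epsilon> * B"
    "integrable lambda2 (\<lambda>z. f i (fst z) * f j (snd z) * \<psi> z)"
proof -
  have m: "(\<lambda>z. q l (fst z)) \<in> borel_measurable lambda2" "(\<lambda>z. q l (snd z)) \<in> borel_measurable lambda2"
    and u: "z \<in> space lambda2 \<Longrightarrow> q l (fst z) \<in> {0..1}" "z \<in> space lambda2 \<Longrightarrow> q l (snd z) \<in> {0..1}"
    if "q \<in> fractional_partitions k" "l \<in> {1..k}" for q l z
  proof -
    note D = fractional_partitionsD[OF that]
    show "(\<lambda>z. q l (fst z)) \<in> borel_measurable lambda2" "(\<lambda>z. q l (snd z)) \<in> borel_measurable lambda2"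
      by (intro measurable_fst_lambda2 measurable_snd_lambda2 D(1))+
    show "z \<in> space lambda2 \<Longrightarrow> q l (fst z) \<in> {0..1}" "z \<in> space lambda2 \<Longrightarrow> q l (snd z) \<in> {0..1}"
      using D(2,3)[of "fst z"] D(2,3)[of "snd z"] by auto
  qed
  note * = integral_prod_diff[OF lambda2.finite_measure_axioms m(1)[OF f i] m(2)[OF f j] m(1)[OF g i] m(2)[OF g j]
      \<psi>(1) u(1)[OF f i] u(2)[OF f j] u(1)[OF g i] u(2)[OF g j], of B]
  show "integrable lambda2 (\<lambda>z. f i (fst z) * f j (snd z) * \<psi> z)" using \<psi>(2) by (intro *(2)) auto
  have B: "0 \<le> B" using \<psi>(2)[of "(0, 0)"] by auto
  have dm: "(\<lambda>x. \<bar>f l x - g l x\<bar>) \<in> borel_measurable lambda1" and d1: "x \<in> {0..1} \<Longrightarrow> \<bar>\<bar>f l x - g l x\<bar>\<bar> \<le> 1"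
    if "l \<in> {1..k}" for l x
    using fractional_partitionsD[OF f that] fractional_partitionsD[OF g that] by (measurable, fastforce)
  have "\<bar>(\<integral>z. f i (fst z) * f j (snd z) * \<psi> z \<partial>lambda2) - (\<integral>z. g i (fst z) * g j (snd z) * \<psi> z \<partial>lambda2)\<bar> \<le>
      ((\<integral>z. \<bar>f i (fst z) - g i (fst z)\<bar> \<partial>lambda2) + (\<integral>z. \<bar>f j (snd z) - g j (snd z)\<bar> \<partial>lambda2)) * B"
    using \<psi>(2) by (intro *(1)) auto
  also have "\<dots> = ((\<integral>x. \<bar>f i x - g i x\<bar> \<partial>lambda1) + (\<integral>x. \<bar>f j x - g j x\<bar> \<partial>lambda1)) * B"
    using integral_lambda2_prod(1)[OF dm[OF i] d1[OF i], of "\<lambda>_. 1" 1]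
      integral_lambda2_prod(1)[OF _ _ dm[OF j] d1[OF j], of "\<lambda>_. 1" 1] lambda1.prob_space by simp
  also have "\<dots> \<le> (\<epsilon> + \<epsilon>) * B"
    using \<epsilon>[OF i] \<epsilon>[OF j] B by (intro mult_right_mono add_mono) auto
  finally show "\<bar>(\<integral>z. f i (fst z) * f j (snd z) * \<psi> z \<partial>lambda2) - (\<integral>z. g i (fst z) * g j (snd z) * \<psi> z \<partial>lambda2)\<bar> \<le> 2 * \<epsilon> * B"
    by simp
qed

text \<open>For sharp cells the scaled overlaps are exactly the Kronecker delta; smoothing the two
  factors costs \<epsilon> each before scaling by \<open>k\<close>.\<close>

lemma smoothed_cell_overlap:
  assumes k: "k \<ge> 1" and h: "h \<in> continuous_partitions k"
    and \<epsilon>: "\<And>i. i \<in> {1..k} \<Longrightarrow> (\<integral>u. \<bar>cell_partition k i u - h i u\<bar> \<partial>lambda1) \<le> \<epsilon>"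
    and i: "i \<in> {1..k}" and j: "j \<in> {1..k}"
  shows "\<bar>k * (\<integral>u. h i u * h j u \<partial>lambda1) - of_bool (i = j)\<bar> \<le> 2 * real k * \<epsilon>"
proof -
  let ?c = "cell_partition k"
  have c: "?c \<in> fractional_partitions k" by (rule cell_partition_in_fractional_partitions[OF k])
  have h': "h \<in> fractional_partitions k" using h continuous_partitions_subset by blast
  have m: "q l \<in> borel_measurable lambda1" and u: "x \<in> space lambda1 \<Longrightarrow> q l x \<in> {0..1}"
    if "q \<in> fractional_partitions k" "l \<in> {1..k}" for q l x
    using fractional_partitionsD[OF that] by auto
  have "(\<integral>u. ?c i u * ?c j u \<partial>lambda1) = (\<integral>u. of_bool (i = j) * ?c i u \<partial>lambda1)"
    by (intro Bochner_Integration.integral_cong) (auto simp: cell_partition_def)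
  then have cc: "(\<integral>u. ?c i u * ?c j u \<partial>lambda1) = of_bool (i = j) / k"
    using fractional_partitionsD(4)[OF c i] by simp
  have "\<bar>(\<integral>u. ?c i u * ?c j u * 1 \<partial>lambda1) - (\<integral>u. h i u * h j u * 1 \<partial>lambda1)\<bar> \<le>
      ((\<integral>u. \<bar>?c i u - h i u\<bar> \<partial>lambda1) + (\<integral>u. \<bar>?c j u - h j u\<bar> \<partial>lambda1)) * 1"
    by (rule integral_prod_diff(1)[OF lambda1.finite_measure_axioms]) (use m u c h' i j in auto)
  then have "\<bar>(\<integral>u. ?c i u * ?c j u \<partial>lambda1) - (\<integral>u. h i u * h j u \<partial>lambda1)\<bar> \<le>
      (\<integral>u. \<bar>?c i u - h i u\<bar> \<partial>lambda1) + (\<integral>u. \<bar>?c j u - h j u\<bar> \<partial>lambda1)"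
    by simp
  also have "\<dots> \<le> 2 * \<epsilon>" using \<epsilon>[OF i] \<epsilon>[OF j] by simp
  finally have le: "\<bar>of_bool (i = j) / k - (\<integral>u. h i u * h j u \<partial>lambda1)\<bar> \<le> 2 * \<epsilon>" unfolding cc .
  have "\<bar>k * (\<integral>u. h i u * h j u \<partial>lambda1) - of_bool (i = j)\<bar> = k * \<bar>of_bool (i = j) / k - (\<integral>u. h i u * h j u \<partial>lambda1)\<bar>"
    using k by (subst abs_minus_commute, subst abs_of_nat[symmetric], subst abs_mult[symmetric])
      (simp add: right_diff_distrib)
  also have "\<dots> \<le> k * (2 * \<epsilon>)" using le by (rule mult_left_mono) simp
  finally show ?thesis by simp
qed

text \<open>The transferred \<open>h\<close> differs from \<open>g\<close> uniformly by at most
  \<open>2 * real k * \<epsilon>\<close>, because at every point the values of \<open>g\<close> are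
  convex weights; an entry has two factors. Neither \<mu> nor \<open>g\<close> enters the bound, so
  one \<open>h\<close> recovers the matrices of all continuous partitions for all s-graphons up to
  this error.\<close>

lemma partition_matrix_kernel_dist:
  assumes k: "k \<ge> 1" and h: "h \<in> continuous_partitions k"
    and \<epsilon>: "\<And>i. i \<in> {1..k} \<Longrightarrow> (\<integral>u. \<bar>cell_partition k i u - h i u\<bar> \<partial>lambda1) \<le> \<epsilon>"
    and g: "g \<in> continuous_partitions k" and \<mu>: "\<mu> \<in> sgraphons"
  shows "matrix_dist k (partition_matrix k h (Phi (partition_kernel k g h) \<mu>)) (partition_matrix k g \<mu>)
    \<le> (real k)\<^sup>2 * (4 * real k * \<epsilon>)"
proof (rule matrix_dist_le)
  fix i j assume i: "i \<in> {1..k}" and j: "j \<in> {1..k}"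
  interpret \<mu>: prob_space \<mu> using sgraphonsD[OF \<mu>] by simp
  let ?K = "partition_kernel k g h"
  let ?F = "\<lambda>i. transfer ?K (h i)"
  have h': "h \<in> fractional_partitions k" and g': "g \<in> fractional_partitions k"
    using h g continuous_partitions_subset by blast+
  have K: "?K \<in> FDC" by (rule partition_kernel_FDC[OF g h k])
  have F: "?F \<in> fractional_partitions k" by (rule transfer_in_fractional_partitions[OF K h'])
  have close: "\<bar>?F l x - g l x\<bar> \<le> 2 * real k * \<epsilon>" if l: "l \<in> {1..k}" for l x
  proof -
    \<comment> \<open>Written with the identity matrix, to be subtracted term by term from the
      overlap coefficients.\<close>
    have "g l x = (\<Sum>m=1..k. g m x * of_bool (l = m))" using l by (simp add: of_bool_def if_distrib[of "(*) _"] cong: if_cong)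
    then have "?F l x - g l x = (\<Sum>m=1..k. g m x * (k * (\<integral>u. h l u * h m u \<partial>lambda1) - of_bool (l = m)))"
      by (simp only: transfer_partition_kernel[OF h l] right_diff_distrib sum_subtractf)
    also have "\<bar>\<dots>\<bar> \<le> (\<Sum>m=1..k. g m x * (2 * real k * \<epsilon>))"
    proof (rule order_trans[OF sum_abs sum_mono])
      fix m assume m: "m \<in> {1..k}"
      show "\<bar>g m x * (k * (\<integral>u. h l u * h m u \<partial>lambda1) - of_bool (l = m))\<bar> \<le> g m x * (2 * real k * \<epsilon>)"
        unfolding abs_mult abs_of_nonneg[OF continuous_partitionsD(2)[OF g m]]
        by (intro mult_left_mono smoothed_cell_overlap[OF k h \<epsilon> l m] continuous_partitionsD(2)[OF g m])
    qed
    also have "\<dots> = 2 * real k * \<epsilon>" using continuous_partitions_sum[OF g] by (simp flip: sum_distrib_right)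
    finally show ?thesis .
  qed
  have "(\<integral>z. \<bar>?F l (fst z) - g l (fst z)\<bar> \<partial>\<mu>) \<le> 2 * real k * \<epsilon>" if l: "l \<in> {1..k}" for l
  proof -
    have "(\<integral>z. \<bar>?F l (fst z) - g l (fst z)\<bar> \<partial>\<mu>) \<le> (\<integral>z. 2 * real k * \<epsilon> \<partial>\<mu>)"
      using close[OF l] partition_diff_integrable(1)[OF \<mu> F g' l] by (intro integral_mono) auto
    then show ?thesis using \<mu>.prob_space by simp
  qed
  from this[OF i] this[OF j] partition_matrix_diff[OF \<mu> F g' i j]
  show "\<bar>partition_matrix k h (Phi ?K \<mu>) (i, j) - partition_matrix k g \<mu> (i, j)\<bar> \<le> 4 * real k * \<epsilon>"
    unfolding partition_matrix_Phi[OF K \<mu> h'] by linarith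
qed

text \<open>Makes the entries convex weights: an error that is uniform over the cells does not grow
  when averaged with them.\<close>

lemma sum_partition_matrix:
  assumes f: "f \<in> fractional_partitions k" and \<mu>: "\<mu> \<in> sgraphons"
  shows "(\<Sum>i=1..k. \<Sum>j=1..k. partition_matrix k f \<mu> (i, j)) = 1"
    "i \<in> {1..k} \<Longrightarrow> j \<in> {1..k} \<Longrightarrow> 0 \<le> partition_matrix k f \<mu> (i, j)"
proof -
  interpret \<mu>: prob_space \<mu> using sgraphonsD[OF \<mu>] by simp
  note sp = sgraphonsD(3)[OF \<mu>]
  have "(\<Sum>i=1..k. \<Sum>j=1..k. partition_matrix k f \<mu> (i, j)) =
      (\<integral>z. (\<Sum>i=1..k. \<Sum>j=1..k. f i (fst z) * f j (snd z)) \<partial>\<mu>)"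
    using partition_integrable_prod[OF \<mu> f]
    by (subst integral_double_sum(1)) (auto simp: partition_matrix_apply)
  also have "\<dots> = (\<integral>z. 1 \<partial>\<mu>)"
  proof (intro Bochner_Integration.integral_cong refl)
    fix z assume "z \<in> space \<mu>"
    then have "fst z \<in> {0..1}" "snd z \<in> {0..1}" by (auto simp: sp)
    then show "(\<Sum>i=1..k. \<Sum>j=1..k. f i (fst z) * f j (snd z)) = 1"
      using fractional_partitions_sum[OF f] by (simp flip: sum_product)
  qed
  finally show "(\<Sum>i=1..k. \<Sum>j=1..k. partition_matrix k f \<mu> (i, j)) = 1" using \<mu>.prob_space by simp
  show "0 \<le> partition_matrix k f \<mu> (i, j)" if i: "i \<in> {1..k}" and j: "j \<in> {1..k}"
    using fractional_partitionsD(2)[OF f] i j unfolding partition_matrix_apply[OF i j]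
    by (intro Bochner_Integration.integral_nonneg mult_nonneg_nonneg) (auto simp: sp)
qed

lemma integral_phi_kernel:
  fixes \<psi> :: "real \<times> real \<Rightarrow> real"
  assumes k: "k \<ge> 1" and g: "g \<in> continuous_partitions k" and h: "h \<in> continuous_partitions k"
    and \<mu>: "\<mu> \<in> sgraphons"
    and \<psi>: "\<psi> \<in> borel_measurable lambda2" "\<And>z. z \<in> unit_square \<Longrightarrow> \<bar>\<psi> z\<bar> \<le> B"
  shows "(\<integral>z. \<psi> z \<partial>Phi (partition_kernel k g h) \<mu>) =
    (\<Sum>i=1..k. \<Sum>j=1..k. partition_matrix k g \<mu> (i, j) *
      ((real k)\<^sup>2 * (\<integral>z. h i (fst z) * h j (snd z) * \<psi> z \<partial>lambda2)))"
proof -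
  have h': "h \<in> fractional_partitions k" using h continuous_partitions_subset by blast
  \<comment> \<open>\<open>h\<close> is compared with itself in order to use the integrability part
    of the estimate.\<close>
  have "(\<integral>u. \<bar>h i u - h i u\<bar> \<partial>lambda1) \<le> 0" for i by simp
  then have int: "integrable lambda2 (\<lambda>z. h i (fst z) * h j (snd z) * \<psi> z)" if "i \<in> {1..k}" "j \<in> {1..k}" for i j
    using \<psi> by (intro integral_lambda2_prod_diff(2)[OF h' h' that])
  let ?c = "\<lambda>i j. (real k)\<^sup>2 * partition_matrix k g \<mu> (i, j)"
  have "(\<integral>z. \<psi> z \<partial>Phi (partition_kernel k g h) \<mu>) =
    (\<integral>z. (\<Sum>i=1..k. \<Sum>j=1..k. ?c i j * (h i (fst z) * h j (snd z) * \<psi> z)) \<partial>lambda2)"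
    unfolding integral_Phi[OF partition_kernel_FDC[OF g h k] \<mu> \<psi>(1)] phi_partition_kernel[OF g \<mu>] sum_distrib_right
    by (simp only: mult_ac)
  also have "\<dots> = (\<Sum>i=1..k. \<Sum>j=1..k. ?c i j * (\<integral>z. h i (fst z) * h j (snd z) * \<psi> z \<partial>lambda2))"
    using int by (subst integral_double_sum(1)) auto
  finally show ?thesis by (simp add: mult_ac)
qed

lemma integral_prod_partition:
  assumes "f \<in> fractional_partitions k" "i \<in> {1..k}" "j \<in> {1..k}"
  shows "(\<integral>z. f i (fst z) * f j (snd z) \<partial>lambda2) = 1 / (real k)\<^sup>2"
    "integrable lambda2 (\<lambda>z. f i (fst z) * f j (snd z))"
proof -
  have b: "\<bar>f l x\<bar> \<le> 1" if "l \<in> {1..k}" "x \<in> {0..1}" for l x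
    using fractional_partitionsD(2,3)[OF assms(1) that] by simp
  note * = integral_lambda2_prod[OF fractional_partitionsD(1)[OF assms(1,2)] b[OF assms(2)]
      fractional_partitionsD(1)[OF assms(1,3)] b[OF assms(3)]]
  show "(\<integral>z. f i (fst z) * f j (snd z) \<partial>lambda2) = 1 / (real k)\<^sup>2"
    using fractional_partitionsD(4)[OF assms(1,2)] fractional_partitionsD(4)[OF assms(1,3)] *(1)
    by (simp add: power2_eq_square)
  show "integrable lambda2 (\<lambda>z. f i (fst z) * f j (snd z))" by (rule *(2))
qed

text \<open>The bound on \<open>q\<close> is asked for only after multiplication with the weight:
  for sharp cells it then has to hold on the cell alone.\<close>

lemma integral_weighted_le:
  assumes f: "f \<in> fractional_partitions k" and i: "i \<in> {1..k}" and j: "j \<in> {1..k}"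
    and q: "q \<in> borel_measurable lambda2"
      "\<And>z. z \<in> unit_square \<Longrightarrow> f i (fst z) * f j (snd z) * \<bar>q z\<bar> \<le> f i (fst z) * f j (snd z) * C"
  shows "\<bar>\<integral>z. f i (fst z) * f j (snd z) * q z \<partial>lambda2\<bar> \<le> C / (real k)\<^sup>2"
proof -
  note D = fractional_partitionsD[OF f]
  have le: "\<bar>f i (fst z) * f j (snd z) * q z\<bar> \<le> f i (fst z) * f j (snd z) * C" if z: "z \<in> unit_square" for z
  proof -
    have "0 \<le> f i (fst z) * f j (snd z)" using D(2)[OF i] D(2)[OF j] z by (intro mult_nonneg_nonneg) auto
    then show ?thesis using q(2)[OF z] by (simp only: abs_mult[of _ "q z"] abs_of_nonneg)
  qed
  have "\<bar>\<integral>z. f i (fst z) * f j (snd z) * q z \<partial>lambda2\<bar> \<le> (\<integral>z. \<bar>f i (fst z) * f j (snd z) * q z\<bar> \<partial>lambda2)"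
    by (rule integral_abs_bound)
  also have "\<dots> \<le> (\<integral>z. f i (fst z) * f j (snd z) * C \<partial>lambda2)"
  proof (rule integral_mono')
    show "integrable lambda2 (\<lambda>z. f i (fst z) * f j (snd z) * C)"
      using integral_prod_partition(2)[OF f i j] by simp
    show "\<bar>f i (fst z) * f j (snd z) * q z\<bar> \<le> f i (fst z) * f j (snd z) * C" if "z \<in> space lambda2" for z
      using le that by simp
    then show "0 \<le> f i (fst z) * f j (snd z) * C" if "z \<in> space lambda2" for z
      using that order_trans[OF abs_ge_zero] by blast
  qed
  also have "\<dots> = C / (real k)\<^sup>2" using integral_prod_partition(1)[OF f i j] by simp
  finally show ?thesis .
qed

lemma sum_cells:
  assumes "k \<ge> 1" "x \<in> {0..1}" "y \<in> {0..1}"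
  shows "(\<Sum>i=1..k. \<Sum>j=1..k. cell_partition k i x * cell_partition k j y * w i j) = w (cell_index k x) (cell_index k y)"
proof -
  have "(\<Sum>i=1..k. \<Sum>j=1..k. cell_partition k i x * cell_partition k j y * w i j) =
      (\<Sum>i=1..k. if i = cell_index k x then (\<Sum>j=1..k. if j = cell_index k y then w i j else 0) else 0)"
    by (intro sum.cong refl) (auto simp: cell_partition_def intro!: sum.cong)
  then show ?thesis
    using cell_index_range[OF assms(1,2)] cell_index_range[OF assms(1,3)] by (simp add: sum.delta)
qed

text \<open>Both integrals are compared with the sum of \<open>M i j\<close> times the value of
  \<psi> at the upper right corner of cell \<open>(i, j)\<close>. The oscillation \<omega> is paid
  twice, once under \<rho> and once under Lebesgue measure; \<epsilon> pays for smoothing the cells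
  and \<eta> for the difference of the matrices.\<close>

lemma kernel_integral_close:
  fixes \<psi> :: "real \<times> real \<Rightarrow> real"
  assumes k: "k \<ge> 1" and g: "g \<in> continuous_partitions k" and h: "h \<in> continuous_partitions k"
    and \<epsilon>: "\<And>i. i \<in> {1..k} \<Longrightarrow> (\<integral>u. \<bar>cell_partition k i u - h i u\<bar> \<partial>lambda1) \<le> \<epsilon>"
    and \<rho>: "\<rho> \<in> sgraphons" and \<mu>: "\<mu> \<in> sgraphons"
    and \<eta>: "\<And>i j. i \<in> {1..k} \<Longrightarrow> j \<in> {1..k} \<Longrightarrow>
      \<bar>partition_matrix k (cell_partition k) \<rho> (i, j) - partition_matrix k g \<mu> (i, j)\<bar> \<le> \<eta>"
    and \<psi>: "\<psi> \<in> borel_measurable lambda2" "\<And>z. z \<in> unit_square \<Longrightarrow> \<bar>\<psi> z\<bar> \<le> B"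
    and \<omega>: "\<And>x y. x \<in> {0..1} \<Longrightarrow> y \<in> {0..1} \<Longrightarrow>
      \<bar>\<psi> (x, y) - \<psi> (real (cell_index k x) / k, real (cell_index k y) / k)\<bar> \<le> \<omega>"
  shows "\<bar>(\<integral>z. \<psi> z \<partial>\<rho>) - (\<integral>z. \<psi> z \<partial>Phi (partition_kernel k g h) \<mu>)\<bar> \<le>
    2 * \<omega> + (real k)\<^sup>2 * (2 * \<epsilon> * B) + (real k)\<^sup>2 * (\<eta> * B)"
proof -
  interpret \<rho>: prob_space \<rho> using sgraphonsD[OF \<rho>] by simp
  note sp = sgraphonsD(3)[OF \<rho>]
  let ?c = "cell_partition k" and ?p = "\<lambda>i j. \<psi> (real i / k, real j / k)"
  have c: "?c \<in> fractional_partitions k" by (rule cell_partition_in_fractional_partitions[OF k])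
  have h': "h \<in> fractional_partitions k" using h continuous_partitions_subset by blast
  define M where "M i j = partition_matrix k ?c \<rho> (i, j)" for i j
  define M' where "M' i j = partition_matrix k g \<mu> (i, j)" for i j
  \<comment> \<open>The average of \<psi> over the smoothed cell \<open>(i, j)\<close>:
    \<open>(real k)\<^sup>2\<close> is the reciprocal of the mass of the weight.\<close>
  define b where "b i j = (real k)\<^sup>2 * (\<integral>z. h i (fst z) * h j (snd z) * \<psi> z \<partial>lambda2)" for i j
  have k2: "(real k)\<^sup>2 > 0" using k by simp
  have B: "0 \<le> B" using \<psi>(2)[of "(0, 0)"] by auto
  have \<omega>0: "0 \<le> \<omega>" using \<omega>[of 0 0] by simp
  have M: "0 \<le> M i j" if "i \<in> {1..k}" "j \<in> {1..k}" for i j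
    using sum_partition_matrix(2)[OF c \<rho> that] by (simp add: M_def)
  have M_sum: "(\<Sum>i=1..k. \<Sum>j=1..k. M i j) = 1"
    using sum_partition_matrix(1)[OF c \<rho>] by (simp add: M_def)

  have int: "integrable \<rho> (\<lambda>z. ?c i (fst z) * ?c j (snd z) * ?p i j)" if "i \<in> {1..k}" "j \<in> {1..k}" for i j
    using partition_integrable_prod[OF \<rho> c that] by (rule integrable_mult_left)
  have "(\<Sum>i=1..k. \<Sum>j=1..k. M i j * ?p i j) = (\<Sum>i=1..k. \<Sum>j=1..k. \<integral>z. ?c i (fst z) * ?c j (snd z) * ?p i j \<partial>\<rho>)"
    by (intro sum.cong refl) (simp add: M_def partition_matrix_apply)
  also have "\<dots> = (\<integral>z. (\<Sum>i=1..k. \<Sum>j=1..k. ?c i (fst z) * ?c j (snd z) * ?p i j) \<partial>\<rho>)"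
    by (rule integral_double_sum(1)[symmetric]) (rule int)
  finally have Mp: "(\<Sum>i=1..k. \<Sum>j=1..k. M i j * ?p i j) = (\<integral>z. (\<Sum>i=1..k. \<Sum>j=1..k. ?c i (fst z) * ?c j (snd z) * ?p i j) \<partial>\<rho>)" .
  have i1: "integrable \<rho> (\<lambda>z. \<Sum>i=1..k. \<Sum>j=1..k. ?c i (fst z) * ?c j (snd z) * ?p i j)"
    by (rule integral_double_sum(2)) (rule int)
  have i2: "integrable \<rho> \<psi>" using \<psi> by (rule integrable_sgraphon[OF \<rho>])
  have "\<bar>(\<integral>z. \<psi> z \<partial>\<rho>) - (\<Sum>i=1..k. \<Sum>j=1..k. M i j * ?p i j)\<bar> =
      \<bar>\<integral>z. \<psi> z - (\<Sum>i=1..k. \<Sum>j=1..k. ?c i (fst z) * ?c j (snd z) * ?p i j) \<partial>\<rho>\<bar>"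
    unfolding Mp Bochner_Integration.integral_diff[OF i2 i1] ..
  also have "\<dots> \<le> (\<integral>z. \<bar>\<psi> z - (\<Sum>i=1..k. \<Sum>j=1..k. ?c i (fst z) * ?c j (snd z) * ?p i j)\<bar> \<partial>\<rho>)"
    by (rule integral_abs_bound)
  also have "\<dots> \<le> (\<integral>z. \<omega> \<partial>\<rho>)"
  proof (rule integral_mono')
    fix z assume "z \<in> space \<rho>"
    then have "fst z \<in> {0..1}" "snd z \<in> {0..1}" by (auto simp: sp)
    then show "\<bar>\<psi> z - (\<Sum>i=1..k. \<Sum>j=1..k. ?c i (fst z) * ?c j (snd z) * ?p i j)\<bar> \<le> \<omega>"
      using \<omega>[of "fst z" "snd z"] by (simp only: sum_cells[OF k] prod.collapse)
  qed (use \<omega>0 in auto)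
  finally have step1: "\<bar>(\<integral>z. \<psi> z \<partial>\<rho>) - (\<Sum>i=1..k. \<Sum>j=1..k. M i j * ?p i j)\<bar> \<le> \<omega>"
    using \<rho>.prob_space by simp

  have b_le: "\<bar>b i j\<bar> \<le> B" if ij: "i \<in> {1..k}" "j \<in> {1..k}" for i j
  proof -
    have "\<bar>\<integral>z. h i (fst z) * h j (snd z) * \<psi> z \<partial>lambda2\<bar> \<le> B / (real k)\<^sup>2"
    proof (rule integral_weighted_le[OF h' ij \<psi>(1)])
      show "h i (fst z) * h j (snd z) * \<bar>\<psi> z\<bar> \<le> h i (fst z) * h j (snd z) * B" if "z \<in> unit_square" for z
        using continuous_partitionsD(2)[OF h] ij \<psi>(2)[OF that] by (intro mult_left_mono mult_nonneg_nonneg) auto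
    qed
    then show ?thesis using k2 by (simp add: b_def abs_mult field_simps)
  qed
  have b_close: "\<bar>?p i j - b i j\<bar> \<le> \<omega> + (real k)\<^sup>2 * (2 * \<epsilon> * B)" if ij: "i \<in> {1..k}" "j \<in> {1..k}" for i j
  proof -
    \<comment> \<open>The integral over the sharp cell mediates between the corner value and the
      smoothed average.\<close>
    let ?I = "\<integral>z. ?c i (fst z) * ?c j (snd z) * \<psi> z \<partial>lambda2"
    have intc: "integrable lambda2 (\<lambda>z. ?c i (fst z) * ?c j (snd z) * \<psi> z)"
      by (rule integral_lambda2_prod_diff(2)[OF c h' ij \<epsilon> \<psi>])
    have "\<bar>\<integral>z. ?c i (fst z) * ?c j (snd z) * (\<psi> z - ?p i j) \<partial>lambda2\<bar> \<le> \<omega> / (real k)\<^sup>2"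
    proof (rule integral_weighted_le[OF c ij])
      show "(\<lambda>z. \<psi> z - ?p i j) \<in> borel_measurable lambda2" using \<psi>(1) by measurable
      show "?c i (fst z) * ?c j (snd z) * \<bar>\<psi> z - ?p i j\<bar> \<le> ?c i (fst z) * ?c j (snd z) * \<omega>"
        if "z \<in> unit_square" for z
        using \<omega>[of "fst z" "snd z"] that by (auto simp: cell_partition_def)
    qed
    also have "(\<integral>z. ?c i (fst z) * ?c j (snd z) * (\<psi> z - ?p i j) \<partial>lambda2) = ?I - ?p i j / (real k)\<^sup>2"
      using intc integral_prod_partition[OF c ij] by (simp add: right_diff_distrib)
    finally have "(real k)\<^sup>2 * \<bar>?I - ?p i j / (real k)\<^sup>2\<bar> \<le> \<omega>" using k2 by (simp add: field_simps)
    then have 1: "\<bar>(real k)\<^sup>2 * ?I - ?p i j\<bar> \<le> \<omega>"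
      using k by (simp add: abs_mult_pos' right_diff_distrib)
    have "(real k)\<^sup>2 * \<bar>?I - (\<integral>z. h i (fst z) * h j (snd z) * \<psi> z \<partial>lambda2)\<bar> \<le> (real k)\<^sup>2 * (2 * \<epsilon> * B)"
      by (intro mult_left_mono integral_lambda2_prod_diff(1)[OF c h' ij \<epsilon> \<psi>]) auto
    then have "\<bar>(real k)\<^sup>2 * ?I - b i j\<bar> \<le> (real k)\<^sup>2 * (2 * \<epsilon> * B)"
      unfolding b_def by (simp add: abs_mult_pos' right_diff_distrib)
    with 1 show ?thesis by linarith
  qed
  have "(\<integral>z. \<psi> z \<partial>Phi (partition_kernel k g h) \<mu>) = (\<Sum>i=1..k. \<Sum>j=1..k. M' i j * b i j)"
    unfolding M'_def b_def by (rule integral_phi_kernel[OF k g h \<mu> \<psi>])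
  \<comment> \<open>The difference is split so that the first error is weighted by \<open>M\<close>,
    whose sum is 1; only the second is counted \<open>k * k\<close> times.\<close>
  then have "\<bar>(\<Sum>i=1..k. \<Sum>j=1..k. M i j * ?p i j) - (\<integral>z. \<psi> z \<partial>Phi (partition_kernel k g h) \<mu>)\<bar> =
      \<bar>\<Sum>i=1..k. \<Sum>j=1..k. M i j * (?p i j - b i j) + (M i j - M' i j) * b i j\<bar>"
    by (simp add: sum_subtractf[symmetric] algebra_simps)
  also have "\<dots> \<le> (\<Sum>i=1..k. \<Sum>j=1..k. \<bar>M i j * (?p i j - b i j) + (M i j - M' i j) * b i j\<bar>)"
    by (intro order_trans[OF sum_abs] sum_mono sum_abs)
  also have "\<dots> \<le> (\<Sum>i=1..k. \<Sum>j=1..k. M i j * (\<omega> + (real k)\<^sup>2 * (2 * \<epsilon> * B)) + \<eta> * B)"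
  proof (intro sum_mono)
    fix i j assume ij: "i \<in> {1..k}" "j \<in> {1..k}"
    have "\<bar>M i j * (?p i j - b i j)\<bar> \<le> M i j * (\<omega> + (real k)\<^sup>2 * (2 * \<epsilon> * B))"
      unfolding abs_mult abs_of_nonneg[OF M[OF ij]] by (intro mult_left_mono b_close M ij)
    moreover have "\<bar>(M i j - M' i j) * b i j\<bar> \<le> \<eta> * B"
      unfolding abs_mult M_def M'_def using \<eta>[OF ij] by (intro mult_mono \<eta> b_le ij) auto
    ultimately show "\<bar>M i j * (?p i j - b i j) + (M i j - M' i j) * b i j\<bar> \<le> M i j * (\<omega> + (real k)\<^sup>2 * (2 * \<epsilon> * B)) + \<eta> * B"
      by linarith
  qed
  also have "\<dots> = (\<Sum>i=1..k. \<Sum>j=1..k. M i j) * (\<omega> + (real k)\<^sup>2 * (2 * \<epsilon> * B)) + (real k)\<^sup>2 * (\<eta> * B)"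
    by (simp add: sum.distrib sum_distrib_right power2_eq_square)
  finally have step2: "\<bar>(\<Sum>i=1..k. \<Sum>j=1..k. M i j * ?p i j) - (\<integral>z. \<psi> z \<partial>Phi (partition_kernel k g h) \<mu>)\<bar>
    \<le> \<omega> + (real k)\<^sup>2 * (2 * \<epsilon> * B) + (real k)\<^sup>2 * (\<eta> * B)"
    unfolding M_sum by simp
  have "\<bar>x - z\<bar> \<le> r + s" if "\<bar>x - y\<bar> \<le> r" "\<bar>y - z\<bar> \<le> s" for x y z r s :: real
    using that by linarith
  from this[OF step1 step2] show ?thesis by simp
qed

section \<open>Weak neighbourhoods and closures\<close>

lemma closure_of_meets_open:
  assumes "x \<in> X closure_of S" "openin X U" "x \<in> U"
  obtains y where "y \<in> S" "y \<in> U"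
  using assms unfolding in_closure_of by blast

lemma sgraphons_subset: "sgraphons \<subseteq> square_prob_measures"
  by (auto simp: sgraphons_def)

lemma openin_weak_topology:
  fixes \<psi> :: "real \<times> real \<Rightarrow> real"
  assumes "continuous_on unit_square \<psi>" "open V"
  shows "openin weak_topology {\<mu> \<in> square_prob_measures. (\<integral>z. \<psi> z \<partial>\<mu>) \<in> V}"
  unfolding weak_topology_def
  by (rule topology_generated_by_Basis, rule CollectI, rule exI[of _ \<psi>], rule exI[of _ V]) (simp add: assms)

lemma topspace_weak_topology: "topspace weak_topology = square_prob_measures"
proof
  have "openin weak_topology {\<mu> \<in> square_prob_measures. (\<integral>z. 0 \<partial>\<mu>) \<in> (UNIV :: real set)}"
    by (rule openin_weak_topology) simp_all
  from openin_subset[OF this] show "square_prob_measures \<subseteq> topspace weak_topology" by simp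
next
  show "topspace weak_topology \<subseteq> square_prob_measures"
    unfolding weak_topology_def topology_generated_by_topspace
  proof (rule Union_least)
    fix X assume "X \<in> {{\<mu> \<in> square_prob_measures. (\<integral>z. f z \<partial>\<mu>) \<in> U} | (f :: real \<times> real \<Rightarrow> real) U.
        continuous_on unit_square f \<and> open U}"
    then show "X \<subseteq> square_prob_measures" by (elim CollectE exE conjE) simp
  qed
qed

lemma topspace_sgraphon_topology: "topspace sgraphon_topology = sgraphons"
  unfolding sgraphon_topology_def topspace_subtopology topspace_weak_topology
  using sgraphons_subset by (rule Int_absorb1)

lemma openin_sgraphon_topology:
  fixes \<psi> :: "real \<times> real \<Rightarrow> real"
  assumes "continuous_on unit_square \<psi>" "open V"
  shows "openin sgraphon_topology {\<mu> \<in> sgraphons. (\<integral>z. \<psi> z \<partial>\<mu>) \<in> V}"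
  unfolding sgraphon_topology_def openin_subtopology using openin_weak_topology[OF assms] sgraphons_subset
  by (intro exI[of _ "{\<mu> \<in> square_prob_measures. (\<integral>z. \<psi> z \<partial>\<mu>) \<in> V}"]) auto

text \<open>Stands in for a metric: finite families of continuous functions together with a radius
  describe the neighbourhoods, with a triangle inequality for each family.\<close>

definition weakly_close :: "(real \<times> real \<Rightarrow> real) set \<Rightarrow> real \<Rightarrow> (real \<times> real) measure \<Rightarrow> (real \<times> real) measure \<Rightarrow> bool" where
  "weakly_close F \<delta> \<mu> \<nu> \<longleftrightarrow> (\<forall>\<psi>\<in>F. \<bar>(\<integral>z. \<psi> z \<partial>\<mu>) - (\<integral>z. \<psi> z \<partial>\<nu>)\<bar> < \<delta>)"

lemma weakly_close_trans:
  assumes "weakly_close F \<delta> \<mu> \<nu>" "weakly_close F \<delta>' \<nu> \<rho>"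
  shows "weakly_close F (\<delta> + \<delta>') \<mu> \<rho>"
  unfolding weakly_close_def
proof
  fix \<psi> assume "\<psi> \<in> F"
  with assms have "\<bar>(\<integral>z. \<psi> z \<partial>\<mu>) - (\<integral>z. \<psi> z \<partial>\<nu>)\<bar> < \<delta>" "\<bar>(\<integral>z. \<psi> z \<partial>\<nu>) - (\<integral>z. \<psi> z \<partial>\<rho>)\<bar> < \<delta>'"
    by (simp_all add: weakly_close_def)
  then show "\<bar>(\<integral>z. \<psi> z \<partial>\<mu>) - (\<integral>z. \<psi> z \<partial>\<rho>)\<bar> < \<delta> + \<delta>'" by linarith
qed

lemma weakly_close_mono: "weakly_close F \<delta> \<mu> \<nu> \<Longrightarrow> F' \<subseteq> F \<Longrightarrow> \<delta> \<le> \<delta>' \<Longrightarrow> weakly_close F' \<delta>' \<mu> \<nu>"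
  unfolding weakly_close_def by (meson less_le_trans subsetD)

lemma openin_weakly_close:
  assumes F: "finite F" "\<And>\<psi>. \<psi> \<in> F \<Longrightarrow> continuous_on unit_square \<psi>"
  shows "openin sgraphon_topology {\<nu> \<in> sgraphons. weakly_close F \<delta> \<mu> \<nu>}"
  using assms
proof (induction F)
  case empty
  show ?case using openin_topspace[of sgraphon_topology] by (simp add: topspace_sgraphon_topology weakly_close_def)
next
  case (insert \<psi> F)
  have "openin sgraphon_topology {\<nu> \<in> sgraphons. (\<integral>z. \<psi> z \<partial>\<nu>) \<in> ball (\<integral>z. \<psi> z \<partial>\<mu>) \<delta>}"
    using insert.prems by (intro openin_sgraphon_topology) auto
  moreover have "openin sgraphon_topology {\<nu> \<in> sgraphons. weakly_close F \<delta> \<mu> \<nu>}"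
    using insert by auto
  ultimately have "openin sgraphon_topology ({\<nu> \<in> sgraphons. (\<integral>z. \<psi> z \<partial>\<nu>) \<in> ball (\<integral>z. \<psi> z \<partial>\<mu>) \<delta>} \<inter>
      {\<nu> \<in> sgraphons. weakly_close F \<delta> \<mu> \<nu>})" by (rule openin_Int)
  also have "\<dots> = {\<nu> \<in> sgraphons. weakly_close (insert \<psi> F) \<delta> \<mu> \<nu>}"
    by (auto simp: weakly_close_def dist_real_def)
  finally show ?case .
qed

text \<open>Induction over the generated topology: an intersection unites the families and takes the
  smaller radius, and a subbasic set contributes one function with the radius of a ball inside the
  open set of values.\<close>

lemma weak_neighbourhood:
  assumes "openin sgraphon_topology U" "\<mu> \<in> U"
  shows "\<exists>F \<delta>. finite F \<and> (\<forall>\<psi>\<in>F. continuous_on unit_square \<psi>) \<and> \<delta> > 0 \<and>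
    {\<nu> \<in> sgraphons. weakly_close F \<delta> \<mu> \<nu>} \<subseteq> U"
proof -
  let ?S = "{{\<mu> \<in> square_prob_measures. (\<integral>z. \<psi> z \<partial>\<mu>) \<in> U} | (\<psi> :: real \<times> real \<Rightarrow> real) U.
        continuous_on unit_square \<psi> \<and> open U}"
  let ?P = "\<lambda>W \<mu>. \<exists>F \<delta>. finite F \<and> (\<forall>\<psi>\<in>F. continuous_on unit_square \<psi>) \<and> \<delta> > 0 \<and>
    {\<nu> \<in> sgraphons. weakly_close F \<delta> \<mu> \<nu>} \<subseteq> W"
  obtain W where W: "openin weak_topology W" "U = W \<inter> sgraphons"
    using assms(1) unfolding sgraphon_topology_def openin_subtopology by blast
  have "generate_topology_on ?S W"
    using W(1) unfolding weak_topology_def openin_topology_generated_by_iff .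
  then have "\<mu> \<in> W \<longrightarrow> ?P W \<mu>"
  proof (induction rule: generate_topology_on.induct)
    case (Int A B)
    show ?case
    proof
      assume "\<mu> \<in> A \<inter> B"
      then obtain F \<delta> F' \<delta>' where FF': "finite F" "\<forall>\<psi>\<in>F. continuous_on unit_square \<psi>" "\<delta> > 0"
          "{\<nu> \<in> sgraphons. weakly_close F \<delta> \<mu> \<nu>} \<subseteq> A"
          "finite F'" "\<forall>\<psi>\<in>F'. continuous_on unit_square \<psi>" "\<delta>' > 0"
          "{\<nu> \<in> sgraphons. weakly_close F' \<delta>' \<mu> \<nu>} \<subseteq> B"
        using Int.IH by blast
      have "weakly_close F \<delta> \<mu> \<nu> \<and> weakly_close F' \<delta>' \<mu> \<nu>" if "weakly_close (F \<union> F') (min \<delta> \<delta>') \<mu> \<nu>" for \<nu>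
        using weakly_close_mono[OF that, of F \<delta>] weakly_close_mono[OF that, of F' \<delta>'] by simp
      then have "{\<nu> \<in> sgraphons. weakly_close (F \<union> F') (min \<delta> \<delta>') \<mu> \<nu>} \<subseteq> A \<inter> B" using FF'(4,8) by blast
      then show "?P (A \<inter> B) \<mu>" using FF'
        by (intro exI[of _ "F \<union> F'"] exI[of _ "min \<delta> \<delta>'"] conjI) auto
    qed
  next
    case (UN K)
    show ?case
    proof
      assume "\<mu> \<in> \<Union>K"
      then obtain k where k: "k \<in> K" "\<mu> \<in> k" by blast
      with UN.IH have "?P k \<mu>" by blast
      then show "?P (\<Union>K) \<mu>" using k(1) by (meson Union_upper order_trans)
    qed
  next
    case (Basis s)
    then obtain \<psi> :: "real \<times> real \<Rightarrow> real" and V where s: "s = {\<mu> \<in> square_prob_measures. (\<integral>z. \<psi> z \<partial>\<mu>) \<in> V}"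
      and \<psi>: "continuous_on unit_square \<psi>" "open V" by (elim CollectE exE conjE)
    show ?case
    proof
      assume "\<mu> \<in> s"
      then have "(\<integral>z. \<psi> z \<partial>\<mu>) \<in> V" by (simp add: s)
      with \<psi>(2) obtain e where e: "e > 0" "ball (\<integral>z. \<psi> z \<partial>\<mu>) e \<subseteq> V" by (meson openE)
      have "{\<nu> \<in> sgraphons. weakly_close {\<psi>} e \<mu> \<nu>} \<subseteq> s"
        using e(2) sgraphons_subset by (auto simp: s weakly_close_def dist_real_def subset_iff)
      then show "?P s \<mu>" using \<psi> e(1) by (intro exI[of _ "{\<psi>}"] exI[of _ e]) simp
    qed
  qed simp
  with assms(2) W(2) obtain F \<delta> where "finite F" "\<forall>\<psi>\<in>F. continuous_on unit_square \<psi>" "\<delta> > 0"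
    "{\<nu> \<in> sgraphons. weakly_close F \<delta> \<mu> \<nu>} \<subseteq> W" by blast
  then show ?thesis unfolding W(2) by (intro exI[of _ F] exI[of _ \<delta>]) auto
qed

lemma shape_subset: "shape \<mu> \<subseteq> sgraphons"
  unfolding shape_def using closure_of_subset_topspace[of sgraphon_topology] by (simp add: topspace_sgraphon_topology)

lemma Phi_in_shape:
  assumes "\<mu> \<in> sgraphons" "f \<in> FDC"
  shows "Phi f \<mu> \<in> shape \<mu>"
proof -
  have "{Phi f \<mu> | f. f \<in> FDC} \<subseteq> topspace sgraphon_topology"
    using Phi_in_sgraphons assms(1) by (auto simp: topspace_sgraphon_topology)
  from closure_of_subset[OF this] show ?thesis using assms(2) unfolding shape_def by blast
qed

lemma shape_approx:
  assumes "\<rho> \<in> shape \<mu>" and F: "finite F" "\<And>\<psi>. \<psi> \<in> F \<Longrightarrow> continuous_on unit_square \<psi>" and "\<delta> > 0"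
  shows "\<exists>f\<in>FDC. weakly_close F \<delta> \<rho> (Phi f \<mu>)"
proof -
  have "\<rho> \<in> {\<nu> \<in> sgraphons. weakly_close F \<delta> \<rho> \<nu>}"
    using assms(1,4) shape_subset by (auto simp: weakly_close_def)
  with assms(1)[unfolded shape_def] openin_weakly_close[OF F, of \<delta> \<rho>]
  obtain y where "y \<in> {Phi f \<mu> | f. f \<in> FDC}" "y \<in> {\<nu> \<in> sgraphons. weakly_close F \<delta> \<rho> \<nu>}"
    by (rule closure_of_meets_open)
  then show ?thesis by (elim CollectE exE conjE) auto
qed

section \<open>Matrix distance and approximation within \<open>k\<close>-shapes\<close>

lemma openin_matrix_ball:
  assumes "A \<in> topspace (matrix_topology k)" "r > 0"
  shows "openin (matrix_topology k) {B \<in> topspace (matrix_topology k). matrix_dist k A B < r}"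
proof -
  interpret Metric_space "topspace (matrix_topology k)" "matrix_dist k" by (rule Metric_space_matrix_dist)
  have "{B \<in> topspace (matrix_topology k). matrix_dist k A B < r} = mball A r"
    using assms by auto
  then show ?thesis using openin_mball[of A r] by (simp only: mtopology_matrix_dist)
qed

lemma matrix_dist_triangle:
  "matrix_dist k A C \<le> matrix_dist k A B + matrix_dist k B C"
proof -
  have L2: "matrix_dist k A B = L2_set (\<lambda>p. A p - B p) ({1..k} \<times> {1..k})" for A B
    by (simp add: matrix_dist_def L2_set_def)
  show ?thesis
    using L2_set_triangle_ineq[of "\<lambda>p. A p - B p" "\<lambda>p. B p - C p" "{1..k} \<times> {1..k}"] by (simp add: L2)
qed

lemma matrix_dist_commute: "matrix_dist k A B = matrix_dist k B A"
  by (simp add: matrix_dist_def power2_commute)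

lemma matrix_dist_self: "matrix_dist k A A = 0"
  by (simp add: matrix_dist_def)

lemma k_shape_subset: "k_shape k \<mu> \<subseteq> topspace (matrix_topology k)"
  unfolding k_shape_eq by (rule closure_of_subset_topspace)

text \<open>Half of \<open>r\<close> is spent on the closure, half on replacing the Borel partition
  by a continuous one.\<close>

lemma k_shape_approx:
  assumes \<mu>: "\<mu> \<in> sgraphons" and k: "k \<ge> 1" and M: "M \<in> k_shape k \<mu>" and r: "r > 0"
  shows "\<exists>g\<in>continuous_partitions k. matrix_dist k M (partition_matrix k g \<mu>) < r"
proof -
  have "M \<in> topspace (matrix_topology k)" using M k_shape_subset by blast
  moreover from this have "openin (matrix_topology k) {B \<in> topspace (matrix_topology k). matrix_dist k M B < r / 2}"
    by (rule openin_matrix_ball) (use r in simp)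
  ultimately obtain N where "N \<in> (\<lambda>f. partition_matrix k f \<mu>) ` fractional_partitions k"
    "N \<in> {B \<in> topspace (matrix_topology k). matrix_dist k M B < r / 2}"
    using closure_of_meets_open[OF M[unfolded k_shape_eq]] r by (metis (no_types, lifting) half_gt_zero matrix_dist_self mem_Collect_eq)
  then obtain f where f: "f \<in> fractional_partitions k" "matrix_dist k M (partition_matrix k f \<mu>) < r / 2"
    by auto
  \<comment> \<open>Entries move by at most \<open>2 * \<epsilon>\<close>, and the distance by at
    most \<open>(real k)\<^sup>2\<close> times that, which is \<open>r / 4\<close>.\<close>
  define \<epsilon> where "\<epsilon> = r / (8 * (real k)\<^sup>2)"
  have \<epsilon>: "\<epsilon> > 0" using r k by (simp add: \<epsilon>_def)
  show ?thesis
  proof (rule fractional_partition_approx[OF \<mu> f(1) k \<epsilon>])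
    fix g assume g: "g \<in> continuous_partitions k"
      and err: "\<And>i. i \<in> {1..k} \<Longrightarrow> (\<integral>z. \<bar>f i (fst z) - g i (fst z)\<bar> \<partial>\<mu>) \<le> \<epsilon>"
    have g': "g \<in> fractional_partitions k" using g continuous_partitions_subset by blast
    have "matrix_dist k (partition_matrix k f \<mu>) (partition_matrix k g \<mu>) \<le> (real k)\<^sup>2 * (2 * \<epsilon>)"
    proof (rule matrix_dist_le)
      fix i j assume "i \<in> {1..k}" "j \<in> {1..k}"
      then show "\<bar>partition_matrix k f \<mu> (i, j) - partition_matrix k g \<mu> (i, j)\<bar> \<le> 2 * \<epsilon>"
        using partition_matrix_diff[OF \<mu> f(1) g', of i j] err[of i] err[of j] by simp
    qed
    also have "\<dots> < r / 2" using r k by (simp add: \<epsilon>_def field_simps)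
    finally show ?thesis
      using f(2) matrix_dist_triangle[of k M "partition_matrix k g \<mu>" "partition_matrix k f \<mu>"] g
      by (intro bexI[of _ g]) auto
  qed
qed

lemma continuous_map_integral:
  fixes \<psi> :: "real \<times> real \<Rightarrow> real"
  assumes "continuous_on unit_square \<psi>"
  shows "continuous_map sgraphon_topology euclideanreal (\<lambda>\<rho>. \<integral>z. \<psi> z \<partial>\<rho>)"
  unfolding continuous_map topspace_sgraphon_topology
  using openin_sgraphon_topology[OF assms] by simp

lemma continuous_partition_prod:
  assumes h: "h \<in> continuous_partitions k" and i: "i \<in> {1..k}" and j: "j \<in> {1..k}"
  shows "continuous_on S (\<lambda>z. h i (fst z) * h j (snd z))"
proof -
  have "continuous_on S (\<lambda>z. h i (fst z))"
    by (rule continuous_on_compose2[OF continuous_partitionsD(1)[OF h i]]) (simp_all add: continuous_on_fst)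
  moreover have "continuous_on S (\<lambda>z. h j (snd z))"
    by (rule continuous_on_compose2[OF continuous_partitionsD(1)[OF h j]]) (simp_all add: continuous_on_snd)
  ultimately show ?thesis by (rule continuous_on_mult)
qed

text \<open>The point of smoothing: the entries are integrals of continuous functions. With sharp
  cells the map could jump at measures that charge cell boundaries.\<close>

lemma continuous_map_partition_matrix:
  assumes h: "h \<in> continuous_partitions k"
  shows "continuous_map sgraphon_topology (matrix_topology k) (partition_matrix k h)"
  unfolding matrix_topology_def continuous_map_componentwise
proof (intro conjI ballI)
  show "partition_matrix k h ` topspace sgraphon_topology \<subseteq> extensional ({1..k} \<times> {1..k})"
    by (auto simp: partition_matrix_def)
  fix p assume "p \<in> {1..k} \<times> {1..k}"
  then obtain i j where p: "p = (i, j)" "i \<in> {1..k}" "j \<in> {1..k}" by blast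
  have "continuous_map sgraphon_topology euclideanreal (\<lambda>\<rho>. \<integral>z. h i (fst z) * h j (snd z) \<partial>\<rho>)"
    by (rule continuous_map_integral[OF continuous_partition_prod[OF h p(2,3)]])
  then show "continuous_map sgraphon_topology euclideanreal (\<lambda>\<rho>. partition_matrix k h \<rho> p)"
    by (simp only: p(1) partition_matrix_apply[OF p(2,3)])
qed

text \<open>A continuous map sends a closure into the closure of the image, and the matrices of the
  generators \<open>Phi f \<mu>\<close> are those of transferred partitions.\<close>

lemma partition_matrix_shape_subset:
  assumes h: "h \<in> continuous_partitions k" and \<mu>: "\<mu> \<in> sgraphons"
  shows "partition_matrix k h ` shape \<mu> \<subseteq> k_shape k \<mu>"
proof -
  have h': "h \<in> fractional_partitions k" using h continuous_partitions_subset by blast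
  have "partition_matrix k h ` shape \<mu> \<subseteq> matrix_topology k closure_of (partition_matrix k h ` {Phi f \<mu> | f. f \<in> FDC})"
    unfolding shape_def by (rule continuous_map_image_closure_subset[OF continuous_map_partition_matrix[OF h]])
  also have "\<dots> \<subseteq> k_shape k \<mu>"
    unfolding k_shape_eq
    using transfer_in_fractional_partitions[OF _ h'] partition_matrix_Phi[OF _ \<mu> h']
    by (intro closure_of_mono) auto
  finally show ?thesis .
qed

section \<open>Uniqueness of measures on the unit square\<close>

lemma measurable_square_prob:
  assumes "\<mu> \<in> square_prob_measures" "f \<in> borel_measurable (restrict_space borel unit_square)"
  shows "f \<in> borel_measurable \<mu>"
  using assms measurable_cong_sets[of \<mu> "restrict_space borel unit_square" borel borel]
  by (auto simp: square_prob_measures_def)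

text \<open>Closed sets form an intersection-stable generator, and their indicators are bounded
  limits of continuous functions. Needed for the symmetry of weak limits.\<close>

lemma square_prob_measure_eqI:
  assumes \<mu>: "\<mu> \<in> square_prob_measures" and \<nu>: "\<nu> \<in> square_prob_measures"
    and eq: "\<And>\<psi> :: real \<times> real \<Rightarrow> real. continuous_on unit_square \<psi> \<Longrightarrow> (\<integral>z. \<psi> z \<partial>\<mu>) = (\<integral>z. \<psi> z \<partial>\<nu>)"
  shows "\<mu> = \<nu>"
proof -
  \<comment> \<open>Pushed forward to the plane, the measures live on the full Borel sigma-algebra,
    which the closed sets generate.\<close>
  let ?D = "\<lambda>\<mu>. distr \<mu> borel (\<lambda>z :: real \<times> real. z)"
  have idm: "(\<lambda>z :: real \<times> real. z) \<in> borel_measurable \<mu>" if "\<mu> \<in> square_prob_measures" for \<mu>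
    by (rule measurable_square_prob[OF that]) (simp add: measurable_restrict_space1)
  have lim: "(\<lambda>n. \<integral>z. max 0 (1 - real n * infdist z A) \<partial>\<mu>) \<longlonglongrightarrow> (\<integral>z. indicator A z \<partial>\<mu>)"
    if A: "closed A" "A \<noteq> {}" and \<mu>: "\<mu> \<in> square_prob_measures" for A \<mu>
  proof -
    interpret prob_space \<mu> using \<mu> by (simp add: square_prob_measures_def)
    note [measurable] = idm[OF \<mu>]
    have [measurable]: "A \<in> sets borel" using A by simp
    show ?thesis
    proof (rule integral_dominated_convergence[where w = "\<lambda>_. 1"])
      have "(\<lambda>z. indicator A z :: real) \<in> borel_measurable borel" by measurable
      from measurable_compose[OF idm[OF \<mu>] this] show "(\<lambda>z. indicator A z :: real) \<in> borel_measurable \<mu>" .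
      show "(\<lambda>z. max 0 (1 - real n * infdist z A)) \<in> borel_measurable \<mu>" for n
      proof -
        have "(\<lambda>z. max 0 (1 - real n * infdist z A)) \<in> borel_measurable borel"
          by (intro borel_measurable_continuous_onI continuous_intros)
        from measurable_compose[OF idm[OF \<mu>] this] show ?thesis .
      qed
      show "AE z in \<mu>. (\<lambda>n. max 0 (1 - real n * infdist z A)) \<longlonglongrightarrow> indicator A z"
        by (rule AE_I2) (rule indicator_closed_limit[OF A])
    qed (auto simp: infdist_nonneg)
  qed
  have "?D \<mu> = ?D \<nu>"
  proof (rule measure_eqI_generator_eq[where E = "Collect closed" and \<Omega> = UNIV and A = "\<lambda>_. UNIV"])
    show "Int_stable (Collect closed)" by (auto simp: Int_stable_def)
    show "sets (?D \<mu>) = sigma_sets UNIV (Collect closed)" "sets (?D \<nu>) = sigma_sets UNIV (Collect closed)"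
      by (simp only: sets_distr, subst borel_eq_closed, simp add: sets_measure_of)+
    interpret \<mu>: prob_space \<mu> using \<mu> by (simp add: square_prob_measures_def)
    interpret \<nu>: prob_space \<nu> using \<nu> by (simp add: square_prob_measures_def)
    have "prob_space (?D \<mu>)" using idm[OF \<mu>] by (rule \<mu>.prob_space_distr)
    then interpret D: prob_space "?D \<mu>" .
    show "emeasure (?D \<mu>) UNIV \<noteq> \<infinity>" by (simp add: D.emeasure_finite)
    fix A :: "(real \<times> real) set" assume "A \<in> Collect closed"
    then have A: "closed A" and [measurable]: "A \<in> sets borel" by auto
    have "(\<integral>z. indicator A z \<partial>\<mu>) = (\<integral>z. indicator A z \<partial>\<nu> :: real)"
    proof (cases "A = {}")
      case False
      have "(\<integral>z. max 0 (1 - real n * infdist z A) \<partial>\<mu>) = (\<integral>z. max 0 (1 - real n * infdist z A) \<partial>\<nu>)" for n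
        by (intro eq continuous_intros)
      with lim[OF A False \<mu>] lim[OF A False \<nu>] show ?thesis
        by (simp add: LIMSEQ_unique)
    qed simp
    moreover have "(\<integral>z. indicator A z \<partial>\<mu>) = measure (?D \<mu>) A" "(\<integral>z. indicator A z \<partial>\<nu>) = measure (?D \<nu>) A"
      using idm[OF \<mu>] idm[OF \<nu>] by (simp_all add: measure_distr flip: vimage_def)
    ultimately show "emeasure (?D \<mu>) A = emeasure (?D \<nu>) A"
      using idm[OF \<mu>] idm[OF \<nu>]
      by (simp add: finite_measure.emeasure_eq_measure[OF prob_space.axioms(1)] \<mu>.prob_space_distr \<nu>.prob_space_distr)
  qed auto
  show ?thesis
  proof (rule measure_eqI)
    show s: "sets \<mu> = sets \<nu>" using \<mu> \<nu> by (simp add: square_prob_measures_def)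
    fix A assume A: "A \<in> sets \<mu>"
    have A': "A \<in> sets borel" using A \<mu> borel_unit_square
      by (auto simp: square_prob_measures_def sets_restrict_space_iff)
    have "emeasure \<mu> A = emeasure (?D \<mu>) A" "emeasure \<nu> A = emeasure (?D \<nu>) A"
      using A A' s sets.sets_into_space[of A \<mu>] sets.sets_into_space[of A \<nu>] idm[OF \<mu>] idm[OF \<nu>]
      by (simp_all add: emeasure_distr Int_absorb2)
    then show "emeasure \<mu> A = emeasure \<nu> A" using \<open>?D \<mu> = ?D \<nu>\<close> by simp
  qed
qed

section \<open>Schoenberg's space-filling curve\<close>

definition schoenberg_wave :: "real \<Rightarrow> real" where
  "schoenberg_wave t = max 0 (min 1 (1 / 2 - cos (pi * t)))"

text \<open>The wave is \<open>c\<close> on \<open>[2 * c / 3, (2 * c + 1) / 3]\<close> for \<open>c = 0, 1\<close> and has period 2, so at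
  \<open>3 ^ n * t\<close> it reads off the \<open>n\<close>-th digit of \<open>t = (\<Sum>n. 2 * c n / 3 ^ Suc n)\<close>. The two coordinates
  collect the digits of even and of odd index in base 2.\<close>

definition schoenberg_coordinate :: "nat \<Rightarrow> real \<Rightarrow> real" where
  "schoenberg_coordinate d t = (\<Sum>n. (1 / 2) ^ Suc n * schoenberg_wave (3 ^ (2 * n + d) * t))"

definition schoenberg_curve :: "real \<Rightarrow> real \<times> real" where
  "schoenberg_curve t = (schoenberg_coordinate 0 t, schoenberg_coordinate 1 t)"

lemma schoenberg_wave_bounds: "0 \<le> schoenberg_wave t" "schoenberg_wave t \<le> 1"
  by (auto simp: schoenberg_wave_def)

lemma schoenberg_wave_periodic: "schoenberg_wave (t + 2 * real_of_int m) = schoenberg_wave t"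
proof -
  have "cos (pi * (t + 2 * real_of_int m)) = cos (pi * t + 2 * pi * real_of_int m)"
    by (simp add: algebra_simps)
  also have "\<dots> = cos (pi * t)"
    using cos_int_2pin[of m] sin_int_2pin[of m] by (simp add: cos_add mult_ac)
  finally show ?thesis by (simp add: schoenberg_wave_def)
qed

lemma schoenberg_wave_digit:
  assumes "c \<in> {0, 1}" "0 \<le> t" "t \<le> 1"
  shows "schoenberg_wave ((2 * real c + t) / 3) = real c"
proof (cases "c = 0")
  case True
  have "cos (pi / 3) \<le> cos (pi * (t / 3))"
    using assms by (intro cos_monotone_0_pi_le) (auto simp: field_simps)
  then show ?thesis using True by (simp add: schoenberg_wave_def cos_60)
next
  case False
  then have c: "c = 1" using assms by simp
  have "cos (pi * ((2 + t) / 3)) \<le> cos (2 * pi / 3)"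
    using assms by (intro cos_monotone_0_pi_le) (auto simp: field_simps)
  then show ?thesis using c by (simp add: schoenberg_wave_def cos_120)
qed

lemma half_powers_sums: "(\<lambda>n. (1 / 2 :: real) ^ Suc n) sums 1"
  using power_half_series by simp

lemma summable_schoenberg:
  assumes "\<And>n. 0 \<le> f n \<and> f n \<le> 1"
  shows "summable (\<lambda>n. (1 / 2 :: real) ^ Suc n * f n)"
proof (rule summable_comparison_test'[of "\<lambda>n. (1 / 2 :: real) ^ Suc n" 0])
  show "summable (\<lambda>n. (1 / 2 :: real) ^ Suc n)" using half_powers_sums by (rule sums_summable)
  show "norm ((1 / 2 :: real) ^ Suc n * f n) \<le> (1 / 2) ^ Suc n" for n
    using assms[of n] by (simp add: abs_mult)
qed

lemma schoenberg_coordinate_bounds: "schoenberg_coordinate d t \<in> {0..1}"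
proof -
  have s: "summable (\<lambda>n. (1 / 2 :: real) ^ Suc n * schoenberg_wave (3 ^ (2 * n + d) * t))"
    using schoenberg_wave_bounds by (intro summable_schoenberg) blast
  have "0 \<le> schoenberg_coordinate d t"
    unfolding schoenberg_coordinate_def using schoenberg_wave_bounds by (intro suminf_nonneg s) simp
  moreover have "schoenberg_coordinate d t \<le> (\<Sum>n. (1 / 2) ^ Suc n)"
    unfolding schoenberg_coordinate_def using schoenberg_wave_bounds(2)
    by (intro suminf_le s sums_summable[OF half_powers_sums]) (simp add: mult_left_le)
  ultimately show ?thesis using sums_unique[OF half_powers_sums] by simp
qed

lemma schoenberg_curve_in_square: "schoenberg_curve t \<in> unit_square"
  using schoenberg_coordinate_bounds by (simp only: schoenberg_curve_def mem_Times_iff fst_conv snd_conv simp_thms)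

lemma continuous_schoenberg_coordinate: "continuous_on UNIV (schoenberg_coordinate d)"
proof -
  let ?f = "\<lambda>n t. (1 / 2) ^ Suc n * schoenberg_wave (3 ^ (2 * n + d) * t)"
  have "uniform_limit UNIV (\<lambda>n t. \<Sum>i<n. ?f i t) (\<lambda>t. \<Sum>i. ?f i t) sequentially"
  proof (rule Weierstrass_m_test[of _ _ "\<lambda>n. (1 / 2 :: real) ^ Suc n"])
    show "norm (?f n t) \<le> (1 / 2) ^ Suc n" for n t
      using schoenberg_wave_bounds by (simp add: abs_mult)
    show "summable (\<lambda>n. (1 / 2 :: real) ^ Suc n)" using half_powers_sums by (rule sums_summable)
  qed
  moreover have "continuous_on UNIV schoenberg_wave"
    unfolding schoenberg_wave_def by (intro continuous_intros)
  then have "continuous_on UNIV (\<lambda>t. schoenberg_wave (a * t))" for a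
    by (rule continuous_on_compose2) (auto intro: continuous_intros)
  then have "continuous_on UNIV (\<lambda>t. \<Sum>i<n. ?f i t)" for n
    by (intro continuous_on_sum continuous_on_mult continuous_on_const)
  ultimately have "continuous_on UNIV (\<lambda>t. \<Sum>i. ?f i t)"
    by (intro uniform_limit_theorem[OF always_eventually]) auto
  then show ?thesis by (simp add: schoenberg_coordinate_def[abs_def])
qed

lemma continuous_schoenberg_curve: "continuous_on S schoenberg_curve"
proof -
  have "continuous_on UNIV schoenberg_curve"
    unfolding schoenberg_curve_def[abs_def]
    using continuous_schoenberg_coordinate by (intro continuous_on_Pair)
  then show ?thesis using continuous_on_subset by blast
qed

text \<open>The digits are differences of floors, \<open>q (Suc n) - 2 * q n\<close>, whose weighted
  partial sums telescope to \<open>q n / 2 ^ n\<close>. For \<open>x = 1\<close> the integer part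
  \<open>q 0\<close> would be 1, so the expansion by ones is taken instead.\<close>

lemma binary_expansion:
  assumes "x \<in> {0..1}"
  shows "\<exists>c :: nat \<Rightarrow> nat. (\<forall>n. c n \<in> {0, 1}) \<and> (\<lambda>n. (1 / 2) ^ Suc n * real (c n)) sums x"
proof (cases "x = 1")
  case True
  then show ?thesis using half_powers_sums by (intro exI[of _ "\<lambda>_. 1"]) simp
next
  case False
  then have x: "0 \<le> x" "x < 1" using assms by auto
  define q where "q n = \<lfloor>2 ^ n * x\<rfloor>" for n :: nat
  define c where "c n = nat (q (Suc n) - 2 * q n)" for n
  have c: "q (Suc n) - 2 * q n \<in> {0, 1}" for n
  proof -
    have "of_int (q n) \<le> 2 ^ n * x" "2 ^ n * x < of_int (q n) + 1"
      and "of_int (q (Suc n)) \<le> 2 * (2 ^ n * x)" "2 * (2 ^ n * x) < of_int (q (Suc n)) + 1"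
      unfolding q_def by (simp_all add: mult.assoc)
    then have "of_int (q (Suc n)) < (of_int (2 * q n + 2) :: real)" "of_int (2 * q n) < (of_int (q (Suc n) + 1) :: real)"
      by simp_all
    then show ?thesis unfolding of_int_less_iff by auto
  qed
  have c01: "c n \<in> {0, 1}" and rc: "real (c n) = of_int (q (Suc n)) - 2 * of_int (q n)" for n
    using c[of n] by (auto simp: c_def)
  have partial: "(\<Sum>i<n. (1 / 2) ^ Suc i * real (c i)) = of_int (q n) / 2 ^ n" for n
  proof (induction n)
    case 0
    have "q 0 = 0" using x by (simp add: q_def floor_eq_iff)
    then show ?case by simp
  next
    case (Suc n)
    then show ?case by (simp add: rc field_simps)
  qed
  have "(\<lambda>n. of_int (q n) / 2 ^ n) \<longlonglongrightarrow> x"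
  proof (rule tendsto_sandwich[of "\<lambda>n. x - (1 / 2) ^ n" _ _ "\<lambda>_. x"])
    have "2 ^ n * x < of_int (q n) + 1" "of_int (q n) \<le> 2 ^ n * x" for n unfolding q_def by simp_all
    then have "(2 ^ n * x - 1) / 2 ^ n \<le> of_int (q n) / 2 ^ n" "of_int (q n) / 2 ^ n \<le> (2 ^ n * x) / 2 ^ n" for n
      by (intro divide_right_mono; simp add: less_imp_le diff_le_eq)+
    moreover have "(2 ^ n * x - 1) / 2 ^ n = x - (1 / 2) ^ n" "(2 ^ n * x) / 2 ^ n = x" for n
      by (simp_all add: diff_divide_distrib power_one_over)
    ultimately show "\<forall>\<^sub>F n in sequentially. x - (1 / 2) ^ n \<le> of_int (q n) / 2 ^ n"
      "\<forall>\<^sub>F n in sequentially. of_int (q n) / 2 ^ n \<le> x"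
      by (simp_all only: always_eventually simp_thms)
    have "(\<lambda>n. x - (1 / 2) ^ n) \<longlonglongrightarrow> x - 0"
      by (intro tendsto_diff tendsto_const LIMSEQ_power_zero) simp
    then show "(\<lambda>n. x - (1 / 2) ^ n) \<longlonglongrightarrow> x" by simp
  qed simp
  then show ?thesis using c01 unfolding sums_def by (intro exI[of _ c]) (simp only: partial, blast)
qed

text \<open>The binary digits of both coordinates are interleaved and doubled to the ternary digits
  of a point of the Cantor set, from which the wave recovers them.\<close>

lemma schoenberg_curve_surj:
  assumes z: "z \<in> unit_square"
  shows "\<exists>t\<in>{0..1}. schoenberg_curve t = z"
proof -
  from z obtain a b where a: "\<And>n. a n \<in> {0, 1 :: nat}" "(\<lambda>n. (1 / 2) ^ Suc n * real (a n)) sums fst z"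
    and b: "\<And>n. b n \<in> {0, 1 :: nat}" "(\<lambda>n. (1 / 2) ^ Suc n * real (b n)) sums snd z"
    using binary_expansion[of "fst z"] binary_expansion[of "snd z"] by (auto simp: mem_Times_iff)
  define c where "c n = (if even n then a (n div 2) else b (n div 2))" for n
  have c: "c n \<in> {0, 1}" for n using a(1) b(1) unfolding c_def by presburger
  \<comment> \<open>\<open>T m\<close> is what remains after deleting the first \<open>m\<close>
    ternary digits; \<open>T 0\<close> will be the preimage.\<close>
  define T where "T m = (\<Sum>n. 2 * real (c (n + m)) / 3 ^ Suc n)" for m
  have geo: "(\<lambda>n. 2 / 3 ^ Suc n) sums (1 :: real)"
  proof -
    have "(\<lambda>n. (2 / 3) * (1 / 3) ^ n) sums ((2 / 3) * (1 / (1 - 1 / 3)) :: real)"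
      by (intro sums_mult geometric_sums) simp
    then show ?thesis by (simp add: power_one_over field_simps)
  qed
  have s: "summable (\<lambda>n. 2 * real (c (n + m)) / 3 ^ Suc n)" for m
  proof (rule summable_comparison_test'[OF sums_summable[OF geo], of 0])
    show "norm (2 * real (c (n + m)) / 3 ^ Suc n) \<le> 2 / 3 ^ Suc n" for n
      using c[of "n + m"] by auto
  qed
  have T01: "0 \<le> T m" "T m \<le> 1" for m
  proof -
    show "0 \<le> T m" unfolding T_def by (intro suminf_nonneg s) simp
    have "T m \<le> (\<Sum>n. 2 / 3 ^ Suc n)" unfolding T_def
    proof (rule suminf_le[OF _ s sums_summable[OF geo]])
      show "2 * real (c (n + m)) / 3 ^ Suc n \<le> 2 / 3 ^ Suc n" for n
        using c[of "n + m"] by auto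
    qed
    then show "T m \<le> 1" using sums_unique[OF geo] by simp
  qed
  have T_rec: "3 * T m = 2 * real (c m) + T (Suc m)" for m
  proof -
    have "T m = 2 * real (c m) / 3 + (\<Sum>n. 2 * real (c (Suc n + m)) / 3 ^ Suc (Suc n))"
      unfolding T_def using suminf_split_head[OF s[of m]] by simp
    also have "(\<Sum>n. 2 * real (c (Suc n + m)) / 3 ^ Suc (Suc n)) = (\<Sum>n. 2 * real (c (n + Suc m)) / 3 ^ Suc n / 3)"
      by (intro suminf_cong) simp
    also have "\<dots> = T (Suc m) / 3" unfolding T_def by (rule suminf_divide[OF s])
    finally show ?thesis by simp
  qed
  \<comment> \<open>Multiplication by \<open>3 ^ m\<close> moves \<open>m\<close> digits in front of
    the point; all digits being even, they add up to a multiple of the period of the wave.\<close>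
  have "\<exists>N :: int. 3 ^ m * T 0 = T m + 2 * real_of_int N" for m
  proof (induction m)
    case (Suc m)
    then obtain N :: int where "3 ^ m * T 0 = T m + 2 * real_of_int N" by blast
    then have "3 ^ Suc m * T 0 = T (Suc m) + 2 * real_of_int (int (c m) + 3 * N)"
      using T_rec[of m] by simp
    then show ?case by blast
  qed (auto intro: exI[of _ 0])
  then have wave: "schoenberg_wave (3 ^ m * T 0) = real (c m)" for m
  proof -
    obtain N :: int where "3 ^ m * T 0 = T m + 2 * real_of_int N"
      using \<open>\<And>m. \<exists>N :: int. 3 ^ m * T 0 = T m + 2 * real_of_int N\<close> by blast
    then have "schoenberg_wave (3 ^ m * T 0) = schoenberg_wave (T m)" by (simp only: schoenberg_wave_periodic)
    also have "T m = (2 * real (c m) + T (Suc m)) / 3" using T_rec[of m] by simp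
    also have "schoenberg_wave \<dots> = real (c m)" by (rule schoenberg_wave_digit[OF c T01])
    finally show ?thesis .
  qed
  have "schoenberg_coordinate 0 (T 0) = fst z"
    using sums_unique[OF a(2)] unfolding schoenberg_coordinate_def wave by (simp add: c_def)
  moreover have "schoenberg_coordinate 1 (T 0) = snd z"
    using sums_unique[OF b(2)] unfolding schoenberg_coordinate_def wave by (simp add: c_def)
  ultimately show ?thesis
    using T01[of 0] by (intro bexI[of _ "T 0"]) (simp_all add: schoenberg_curve_def)
qed

text \<open>The least preimage is lower semicontinuous, hence a Borel section of the curve.\<close>

definition schoenberg_section :: "real \<times> real \<Rightarrow> real" where
  "schoenberg_section z = Inf {t \<in> {0..1}. schoenberg_curve t = z}"

lemma schoenberg_section:
  assumes "z \<in> unit_square"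
  shows "schoenberg_section z \<in> {0..1}" "schoenberg_curve (schoenberg_section z) = z"
    "t \<in> {0..1} \<Longrightarrow> schoenberg_curve t = z \<Longrightarrow> schoenberg_section z \<le> t"
proof -
  let ?T = "{t \<in> {0..1}. schoenberg_curve t = z}"
  have ne: "?T \<noteq> {}" using schoenberg_curve_surj[OF assms] by blast
  have "closed ({0..1} \<inter> schoenberg_curve -` {z})"
    using continuous_schoenberg_curve by (intro continuous_closed_preimage) auto
  moreover have "{0..1} \<inter> schoenberg_curve -` {z} = ?T" by auto
  ultimately have cl: "closed ?T" by simp
  have bdd: "bdd_below ?T" by (rule bdd_belowI[of _ 0]) simp
  have "schoenberg_section z \<in> ?T"
    unfolding schoenberg_section_def by (rule closed_contains_Inf[OF ne bdd cl])
  then show "schoenberg_section z \<in> {0..1}" "schoenberg_curve (schoenberg_section z) = z" by auto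
  show "t \<in> {0..1} \<Longrightarrow> schoenberg_curve t = z \<Longrightarrow> schoenberg_section z \<le> t"
    unfolding schoenberg_section_def using bdd by (intro cInf_lower) auto
qed

lemma sets_restrict_unit_square:
  "A \<in> sets borel \<Longrightarrow> A \<subseteq> unit_square \<Longrightarrow> A \<in> sets (restrict_space borel unit_square)"
  using borel_unit_square by (subst sets_restrict_space_iff) auto

lemma schoenberg_section_measurable:
  "schoenberg_section \<in> borel_measurable (restrict_space borel unit_square)"
  unfolding borel_measurable_iff_le
proof
  fix a :: real
  \<comment> \<open>The least parameter is at most \<open>a\<close> exactly when some parameter is,
    so sublevel sets are images of compact intervals; for negative \<open>a\<close> both sides are
    empty.\<close>
  have "{z \<in> unit_square. schoenberg_section z \<le> a} = schoenberg_curve ` {0..min a 1}"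
  proof (intro equalityI subsetI)
    fix z assume "z \<in> {z \<in> unit_square. schoenberg_section z \<le> a}"
    then show "z \<in> schoenberg_curve ` {0..min a 1}"
      using schoenberg_section(1,2)[of z] by (intro image_eqI[of _ _ "schoenberg_section z"]) auto
  next
    fix z assume "z \<in> schoenberg_curve ` {0..min a 1}"
    then obtain t where t: "0 \<le> t" "t \<le> a" "t \<le> 1" "z = schoenberg_curve t" by auto
    have z: "z \<in> unit_square" unfolding t(4) by (rule schoenberg_curve_in_square)
    have "schoenberg_section z \<le> t" by (rule schoenberg_section(3)[OF z _ t(4)[symmetric]]) (use t in simp)
    with t(2) z show "z \<in> {z \<in> unit_square. schoenberg_section z \<le> a}" by (intro CollectI conjI) linarith+
  qed
  moreover have "schoenberg_curve ` {0..min a 1} \<in> sets (restrict_space borel unit_square)"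
  proof (rule sets_restrict_unit_square)
    show "schoenberg_curve ` {0..min a 1} \<in> sets borel"
      by (intro borel_compact compact_continuous_image continuous_schoenberg_curve) simp
    show "schoenberg_curve ` {0..min a 1} \<subseteq> unit_square"
      by (rule image_subsetI) (rule schoenberg_curve_in_square)
  qed
  ultimately show "{z \<in> space (restrict_space borel unit_square). schoenberg_section z \<le> a}
      \<in> sets (restrict_space borel unit_square)"
    by (simp only: space_restrict_space space_borel Int_UNIV_right)
qed

text \<open>Tightness is free because the section takes values in \<open>{0..1}\<close>. The section
  may be discontinuous, but a test function \<psi> is read on the line as \<psi> after the curve,
  which is continuous, and the curve undoes the section, so its integral is unchanged.\<close>

lemma sgraphons_seq_compact:
  fixes \<nu> :: "nat \<Rightarrow> (real \<times> real) measure"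
  assumes \<nu>: "\<And>n. \<nu> n \<in> sgraphons"
  obtains r \<mu> where "strict_mono (r :: nat \<Rightarrow> nat)" "\<mu> \<in> sgraphons"
    "\<And>\<psi> :: real \<times> real \<Rightarrow> real. continuous_on unit_square \<psi> \<Longrightarrow> (\<lambda>n. \<integral>z. \<psi> z \<partial>\<nu> (r n)) \<longlonglongrightarrow> (\<integral>z. \<psi> z \<partial>\<mu>)"
proof -
  have \<nu>': "\<nu> n \<in> square_prob_measures" for n using \<nu> sgraphons_subset by blast
  have sm: "schoenberg_section \<in> borel_measurable (\<nu> n)" for n
    by (rule measurable_square_prob[OF \<nu>' schoenberg_section_measurable])
  define N where "N n = distr (\<nu> n) borel schoenberg_section" for n
  have N: "real_distribution (N n)" for n
    unfolding N_def using sgraphonsD(1)[OF \<nu>] sm by (intro prob_space.real_distribution_distr)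
  \<comment> \<open>Tightness is stated with intervals open on the left, so the left end lies below
    0 in order to include 0.\<close>
  have "measure (N n) {-1<..1} = 1" for n
  proof -
    have "schoenberg_section -` {-1<..1} \<inter> space (\<nu> n) = space (\<nu> n)"
      using schoenberg_section(1) sgraphonsD(3)[OF \<nu>, of n] by fastforce
    then show ?thesis
      unfolding N_def using sm prob_space.prob_space[OF sgraphonsD(1)[OF \<nu>]] by (simp add: measure_distr)
  qed
  then have "tight N"
    unfolding tight_def using N by (intro conjI allI impI exI[of _ "-1"] exI[of _ 1]) simp_all
  from tight_imp_convergent_subsubsequence[OF this strict_mono_id]
  obtain r M where r: "strict_mono (r :: nat \<Rightarrow> nat)" and M: "real_distribution M"
    and conv: "weak_conv_m (N \<circ> id \<circ> r) M" by blast
  interpret M: real_distribution M by (rule M)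
  let ?R = "restrict_space borel unit_square"
  have cm: "schoenberg_curve \<in> M \<rightarrow>\<^sub>M ?R"
    using schoenberg_curve_in_square continuous_schoenberg_curve
    by (intro measurable_restrict_space2)
      (auto simp: measurable_cong_sets[OF M.events_eq_borel refl] intro: borel_measurable_continuous_onI)
  define \<mu> where "\<mu> = distr M ?R schoenberg_curve"
  have \<mu>: "\<mu> \<in> square_prob_measures"
    unfolding \<mu>_def square_prob_measures_def using M.prob_space_distr[OF cm] by simp
  have lim: "(\<lambda>n. \<integral>z. \<psi> z \<partial>\<nu> (r n)) \<longlonglongrightarrow> (\<integral>z. \<psi> z \<partial>\<mu>)"
    if \<psi>: "continuous_on unit_square \<psi>" for \<psi> :: "real \<times> real \<Rightarrow> real"
  proof -
    have \<psi>m: "\<psi> \<in> borel_measurable ?R" using \<psi> by (rule borel_measurable_continuous_on_restrict)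
    let ?f = "\<lambda>t. \<psi> (schoenberg_curve t)"
    have f: "continuous_on UNIV ?f"
      using schoenberg_curve_in_square by (intro continuous_on_compose2[OF \<psi> continuous_schoenberg_curve]) blast
    obtain B where B: "\<And>z. z \<in> unit_square \<Longrightarrow> \<bar>\<psi> z\<bar> \<le> B" by (rule continuous_bounded_unit_square[OF \<psi>]) blast
    have "(\<lambda>n. \<integral>t. ?f t \<partial>(N \<circ> id \<circ> r) n) \<longlonglongrightarrow> (\<integral>t. ?f t \<partial>M)"
    proof (rule weak_conv_imp_integral_bdd_continuous_conv[OF _ M conv])
      show "real_distribution ((N \<circ> id \<circ> r) n)" for n using N by simp
      show "isCont ?f t" for t using f by (simp add: continuous_on_eq_continuous_at)
      show "norm (?f t) \<le> B" for t using B[OF schoenberg_curve_in_square] by simp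
    qed
    moreover have "(\<integral>t. ?f t \<partial>(N \<circ> id \<circ> r) n) = (\<integral>z. \<psi> z \<partial>\<nu> (r n))" for n
    proof -
      have "(\<integral>t. ?f t \<partial>N (r n)) = (\<integral>z. ?f (schoenberg_section z) \<partial>\<nu> (r n))"
        unfolding N_def using f by (intro integral_distr sm borel_measurable_continuous_onI)
      also have "\<dots> = (\<integral>z. \<psi> z \<partial>\<nu> (r n))"
        using schoenberg_section(2) sgraphonsD(3)[OF \<nu>, of "r n"]
        by (intro Bochner_Integration.integral_cong) auto
      finally show ?thesis by simp
    qed
    moreover have "(\<integral>z. \<psi> z \<partial>\<mu>) = (\<integral>t. ?f t \<partial>M)"
      unfolding \<mu>_def by (rule integral_distr[OF cm \<psi>m])
    ultimately show ?thesis by simp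
  qed
  have "sets \<mu> = sets lambda2" using \<mu> by (simp add: square_prob_measures_def sets_lambda2)
  have sw: "prod.swap \<in> \<mu> \<rightarrow>\<^sub>M \<mu>"
    using measurable_swap_lambda2 measurable_cong_sets[OF \<open>sets \<mu> = sets lambda2\<close> \<open>sets \<mu> = sets lambda2\<close>] by blast
  \<comment> \<open>The integrals of \<psi> and of \<psi> after the swap agree along the sequence,
    hence in the limit, and continuous functions determine the measure.\<close>
  have "distr \<mu> \<mu> prod.swap = \<mu>"
  proof (rule square_prob_measure_eqI[OF _ \<mu>])
    have "prob_space \<mu>" using \<mu> by (simp add: square_prob_measures_def)
    then show "distr \<mu> \<mu> prod.swap \<in> square_prob_measures"
      using \<mu> prob_space.prob_space_distr[OF _ sw] by (simp add: square_prob_measures_def)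
    fix \<psi> :: "real \<times> real \<Rightarrow> real" assume \<psi>: "continuous_on unit_square \<psi>"
    have \<psi>s: "continuous_on unit_square (\<lambda>z. \<psi> (prod.swap z))"
      by (rule continuous_on_compose2[OF \<psi>]) (auto intro: continuous_on_swap)
    have "\<psi> \<in> borel_measurable \<mu>"
      by (rule measurable_square_prob[OF \<mu> borel_measurable_continuous_on_restrict[OF \<psi>]])
    then have "(\<integral>z. \<psi> z \<partial>distr \<mu> \<mu> prod.swap) = (\<integral>z. \<psi> (prod.swap z) \<partial>\<mu>)"
      by (rule integral_distr[OF sw])
    also have "\<dots> = (\<integral>z. \<psi> z \<partial>\<mu>)"
    proof (rule LIMSEQ_unique[OF lim[OF \<psi>s]])
      have "(\<integral>z. \<psi> (prod.swap z) \<partial>\<nu> (r n)) = (\<integral>z. \<psi> z \<partial>\<nu> (r n))" for n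
        by (rule integral_sgraphon_swap[OF \<nu> continuous_imp_measurable_lambda2[OF \<psi>]])
      then show "(\<lambda>n. \<integral>z. \<psi> (prod.swap z) \<partial>\<nu> (r n)) \<longlonglongrightarrow> (\<integral>z. \<psi> z \<partial>\<mu>)" using lim[OF \<psi>] by simp
    qed
    finally show "(\<integral>z. \<psi> z \<partial>distr \<mu> \<mu> prod.swap) = (\<integral>z. \<psi> z \<partial>\<mu>)" .
  qed
  with \<mu> have "\<mu> \<in> sgraphons" by (simp add: sgraphons_def)
  with r lim show thesis by (intro that)
qed

text \<open>Uniform continuity on a compact set, phrased for all large \<open>k\<close> so that
  finitely many test functions can share one \<open>k\<close>.\<close>

lemma unit_square_oscillation:
  fixes \<psi> :: "real \<times> real \<Rightarrow> real"
  assumes \<psi>: "continuous_on unit_square \<psi>" and e: "e > 0"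
  shows "\<exists>K. \<forall>k\<ge>K. \<forall>z\<in>unit_square. \<forall>z'\<in>unit_square.
    \<bar>fst z - fst z'\<bar> \<le> 1 / real k \<and> \<bar>snd z - snd z'\<bar> \<le> 1 / real k \<longrightarrow> \<bar>\<psi> z - \<psi> z'\<bar> \<le> e"
proof -
  have "uniformly_continuous_on unit_square \<psi>"
    by (intro compact_uniformly_continuous \<psi> compact_Times) auto
  with e obtain d where d: "d > 0" and
    uc: "\<And>z z'. z \<in> unit_square \<Longrightarrow> z' \<in> unit_square \<Longrightarrow> dist z' z < d \<Longrightarrow> dist (\<psi> z') (\<psi> z) < e"
    unfolding uniformly_continuous_on_def by meson
  \<comment> \<open>The Euclidean distance is at most the sum of the two coordinate differences,
    hence at most \<open>2 / k\<close>.\<close>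
  obtain K :: nat where K: "2 / d < real K" using reals_Archimedean2 by blast
  show ?thesis
  proof (intro exI[of _ K] allI impI ballI, elim conjE)
    fix k z z' assume k: "K \<le> k" and z: "z \<in> unit_square" "z' \<in> unit_square"
      and "\<bar>fst z - fst z'\<bar> \<le> 1 / real k" "\<bar>snd z - snd z'\<bar> \<le> 1 / real k"
    have "2 / d < real k" using K k by simp
    moreover have "2 / d > 0" using d by simp
    ultimately have "real k > 0" by linarith
    then have "2 / real k < d" using \<open>2 / d < real k\<close> d by (simp add: divide_less_eq mult.commute)
    have "dist z z' \<le> dist (fst z) (fst z') + dist (snd z) (snd z')"
      unfolding dist_prod_def by (rule sqrt_sum_squares_le_sum) simp_all
    also have "\<dots> \<le> 1 / real k + 1 / real k"
      using \<open>\<bar>fst z - fst z'\<bar> \<le> 1 / real k\<close> \<open>\<bar>snd z - snd z'\<bar> \<le> 1 / real k\<close> by (intro add_mono) (simp_all add: dist_real_def)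
    also have "\<dots> < d" using \<open>2 / real k < d\<close> by simp
    finally show "\<bar>\<psi> z - \<psi> z'\<bar> \<le> e" using uc[OF z(2,1)] by (simp add: dist_real_def)
  qed
qed

section \<open>Compactness of the space of s-graphons\<close>

text \<open>For positive \<open>k\<close> the hat of height 1 over \<open>i / k\<close> that
  vanishes from distance \<open>1 / k\<close> on, written as a difference of consecutive clipped
  ramps so that the sum over \<open>i\<close> telescopes.\<close>

definition tent :: "nat \<Rightarrow> nat \<Rightarrow> real \<Rightarrow> real" where
  "tent k i x = max 0 (min 1 (real k * x - real i + 1)) - max 0 (min 1 (real k * x - real i))"

text \<open>The integrals of countably many products of hat functions determine the weak topology, so it
  is pulled back from a metrizable product space and sequential compactness suffices.\<close>

definition tent2 :: "nat \<times> nat \<times> nat \<Rightarrow> real \<times> real \<Rightarrow> real" where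
  "tent2 = (\<lambda>(k, i, j) z. tent k i (fst z) * tent k j (snd z))"

lemma tent_nonneg: "0 \<le> tent k i x"
  by (auto simp: tent_def)

lemma tent_eq_0: "1 \<le> \<bar>real k * x - real i\<bar> \<Longrightarrow> tent k i x = 0"
  by (auto simp: tent_def)

lemma sum_tent:
  assumes "x \<in> {0..1}"
  shows "(\<Sum>i\<le>k. tent k i x) = 1"
proof -
  have "(\<Sum>i\<le>n. tent k i x) = max 0 (min 1 (real k * x + 1)) - max 0 (min 1 (real k * x - real n))" for n
    by (induction n) (simp_all add: tent_def)
  moreover have "0 \<le> real k * x" "real k * x \<le> real k" using assms mult_left_mono[of x 1 "real k"] by auto
  ultimately show ?thesis by simp
qed

lemma continuous_tent2: "continuous_on S (tent2 p)"
  unfolding tent2_def tent_def case_prod_beta' by (intro continuous_intros)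

text \<open>The coefficients are the values of \<psi> at the grid points: the hats sum to 1, and a
  product of hats that is nonzero at \<open>z\<close> has its grid point within \<open>1 / k\<close>
  of \<open>z\<close> in each coordinate.\<close>

lemma tent2_approx:
  fixes \<psi> :: "real \<times> real \<Rightarrow> real"
  assumes \<psi>: "continuous_on unit_square \<psi>" and e: "e > 0"
  shows "\<exists>k c. \<forall>z\<in>unit_square. \<bar>\<psi> z - (\<Sum>i\<le>k. \<Sum>j\<le>k. c i j * tent2 (k, i, j) z)\<bar> \<le> e"
proof -
  obtain K where K: "\<And>k z z'. k \<ge> K \<Longrightarrow> z \<in> unit_square \<Longrightarrow> z' \<in> unit_square \<Longrightarrow>
    \<bar>fst z - fst z'\<bar> \<le> 1 / real k \<Longrightarrow> \<bar>snd z - snd z'\<bar> \<le> 1 / real k \<Longrightarrow> \<bar>\<psi> z - \<psi> z'\<bar> \<le> e"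
    using unit_square_oscillation[OF \<psi> e] by meson
  define k where "k = Suc K"
  have k: "k \<ge> K" "real k > 0" by (simp_all add: k_def)
  let ?p = "\<lambda>i j. (real i / k, real j / k)"
  show ?thesis
  proof (intro exI[of _ k] exI[of _ "\<lambda>i j. \<psi> (?p i j)"] ballI)
    fix z assume z: "z \<in> unit_square"
    then have z1: "fst z \<in> {0..1}" "snd z \<in> {0..1}" by auto
    have one: "(\<Sum>i\<le>k. \<Sum>j\<le>k. tent2 (k, i, j) z) = 1"
      using sum_tent[OF z1(1), of k] sum_tent[OF z1(2), of k] by (simp add: tent2_def flip: sum_product)
    have "\<psi> z - (\<Sum>i\<le>k. \<Sum>j\<le>k. \<psi> (?p i j) * tent2 (k, i, j) z) =
        \<psi> z * (\<Sum>i\<le>k. \<Sum>j\<le>k. tent2 (k, i, j) z) - (\<Sum>i\<le>k. \<Sum>j\<le>k. \<psi> (?p i j) * tent2 (k, i, j) z)"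
      by (simp only: one mult_1_right)
    also have "\<dots> = (\<Sum>i\<le>k. \<Sum>j\<le>k. (\<psi> z - \<psi> (?p i j)) * tent2 (k, i, j) z)"
      by (simp only: sum_distrib_left sum_subtractf left_diff_distrib)
    also have "\<bar>\<dots>\<bar> \<le> (\<Sum>i\<le>k. \<Sum>j\<le>k. \<bar>(\<psi> z - \<psi> (?p i j)) * tent2 (k, i, j) z\<bar>)"
      by (intro order_trans[OF sum_abs] sum_mono sum_abs)
    also have "\<dots> \<le> (\<Sum>i\<le>k. \<Sum>j\<le>k. e * tent2 (k, i, j) z)"
    proof (intro sum_mono)
      fix i j assume ij: "i \<in> {..k}" "j \<in> {..k}"
      have t0: "0 \<le> tent2 (k, i, j) z" by (simp add: tent2_def tent_nonneg)
      show "\<bar>(\<psi> z - \<psi> (?p i j)) * tent2 (k, i, j) z\<bar> \<le> e * tent2 (k, i, j) z"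
      proof (cases "\<bar>real k * fst z - real i\<bar> \<le> 1 \<and> \<bar>real k * snd z - real j\<bar> \<le> 1")
        case True
        have d: "\<bar>x - real m / k\<bar> = \<bar>real k * x - real m\<bar> / k" for x m
        proof -
          have "x - real m / k = (real k * x - real m) / k" using k(2) by (simp add: diff_divide_distrib)
          then show ?thesis by (simp add: abs_divide)
        qed
        have "?p i j \<in> unit_square" using ij k by simp
        moreover have "\<bar>fst z - real i / k\<bar> \<le> 1 / k" "\<bar>snd z - real j / k\<bar> \<le> 1 / k"
          unfolding d using True k(2) by (simp_all add: divide_right_mono)
        ultimately have "\<bar>\<psi> z - \<psi> (?p i j)\<bar> \<le> e" using K[OF k(1) z] by simp
        then show ?thesis unfolding abs_mult abs_of_nonneg[OF t0] by (rule mult_right_mono[OF _ t0])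
      next
        case False
        then have "1 \<le> \<bar>real k * fst z - real i\<bar> \<or> 1 \<le> \<bar>real k * snd z - real j\<bar>" by linarith
        then have "tent2 (k, i, j) z = 0" by (elim disjE) (simp_all add: tent2_def tent_eq_0)
        then show ?thesis by simp
      qed
    qed
    also have "\<dots> = e" using one by (simp only: sum_distrib_left[symmetric])
    finally show "\<bar>\<psi> z - (\<Sum>i\<le>k. \<Sum>j\<le>k. \<psi> (?p i j) * tent2 (k, i, j) z)\<bar> \<le> e" .
  qed
qed

lemma integrable_continuous_sgraphon:
  fixes \<psi> :: "real \<times> real \<Rightarrow> real"
  assumes \<psi>: "continuous_on unit_square \<psi>" and \<mu>: "\<mu> \<in> sgraphons"
  shows "integrable \<mu> \<psi>"
proof -
  obtain B where "\<And>z. z \<in> unit_square \<Longrightarrow> \<bar>\<psi> z\<bar> \<le> B" by (rule continuous_bounded_unit_square[OF \<psi>]) blast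
  then show ?thesis
    by (rule integrable_sgraphon[OF \<mu> continuous_imp_measurable_lambda2[OF \<psi>]])
qed

definition moments :: "(real \<times> real) measure \<Rightarrow> nat \<times> nat \<times> nat \<Rightarrow> real" where
  "moments \<mu> p = (\<integral>z. tent2 p z \<partial>\<mu>)"

text \<open>A test function is uniformly close to a finite combination of products of hats, so its
  integral is close to a linear function of the moments, with the same error for every
  s-graphon.\<close>

lemma openin_moments:
  assumes U: "openin sgraphon_topology U" and \<mu>: "\<mu> \<in> U"
  shows "\<exists>V. open V \<and> moments \<mu> \<in> V \<and> {\<nu> \<in> sgraphons. moments \<nu> \<in> V} \<subseteq> U"
proof -
  have \<mu>': "\<mu> \<in> sgraphons" using openin_subset[OF U] \<mu> by (auto simp: topspace_sgraphon_topology)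
  obtain F \<delta> where F: "finite F" "\<And>\<psi>. \<psi> \<in> F \<Longrightarrow> continuous_on unit_square \<psi>" and \<delta>: "\<delta> > 0"
    and sub: "{\<nu> \<in> sgraphons. weakly_close F \<delta> \<mu> \<nu>} \<subseteq> U"
    using weak_neighbourhood[OF U \<mu>] by meson
  have "\<exists>k c. \<forall>z\<in>unit_square. \<bar>\<psi> z - (\<Sum>i\<le>k. \<Sum>j\<le>k. c i j * tent2 (k, i, j) z)\<bar> \<le> \<delta> / 4" if "\<psi> \<in> F" for \<psi>
    by (rule tent2_approx[OF F(2)[OF that]]) (use \<delta> in simp)
  then have "\<forall>\<psi>\<in>F. \<exists>k c. \<forall>z\<in>unit_square. \<bar>\<psi> z - (\<Sum>i\<le>k. \<Sum>j\<le>k. c i j * tent2 (k, i, j) z)\<bar> \<le> \<delta> / 4" ..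
  from bchoice[OF this] obtain k where
    "\<forall>\<psi>\<in>F. \<exists>c. \<forall>z\<in>unit_square. \<bar>\<psi> z - (\<Sum>i\<le>k \<psi>. \<Sum>j\<le>k \<psi>. c i j * tent2 (k \<psi>, i, j) z)\<bar> \<le> \<delta> / 4" ..
  from bchoice[OF this] obtain c where
    *: "\<forall>\<psi>\<in>F. \<forall>z\<in>unit_square. \<bar>\<psi> z - (\<Sum>i\<le>k \<psi>. \<Sum>j\<le>k \<psi>. c \<psi> i j * tent2 (k \<psi>, i, j) z)\<bar> \<le> \<delta> / 4" ..
  have kc: "\<bar>\<psi> z - (\<Sum>i\<le>k \<psi>. \<Sum>j\<le>k \<psi>. c \<psi> i j * tent2 (k \<psi>, i, j) z)\<bar> \<le> \<delta> / 4"
    if "\<psi> \<in> F" "z \<in> unit_square" for \<psi> z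
    using bspec[OF bspec[OF * that(1)] that(2)] .
  define l where "l \<psi> x = (\<Sum>i\<le>k \<psi>. \<Sum>j\<le>k \<psi>. c \<psi> i j * x (k \<psi>, i, j))" for \<psi> and x :: "nat \<times> nat \<times> nat \<Rightarrow> real"
  have l: "\<bar>(\<integral>z. \<psi> z \<partial>\<nu>) - l \<psi> (moments \<nu>)\<bar> \<le> \<delta> / 4" if \<psi>: "\<psi> \<in> F" and \<nu>: "\<nu> \<in> sgraphons" for \<psi> \<nu>
  proof -
    interpret \<nu>: prob_space \<nu> using sgraphonsD[OF \<nu>] by simp
    have ti: "integrable \<nu> (tent2 p)" for p by (rule integrable_continuous_sgraphon[OF continuous_tent2 \<nu>])
    let ?S = "\<lambda>z. \<Sum>i\<le>k \<psi>. \<Sum>j\<le>k \<psi>. c \<psi> i j * tent2 (k \<psi>, i, j) z"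
    have Si: "integrable \<nu> ?S" using ti by (intro Bochner_Integration.integrable_sum integrable_mult_right)
    have \<psi>i: "integrable \<nu> \<psi>" by (rule integrable_continuous_sgraphon[OF F(2)[OF \<psi>] \<nu>])
    have "l \<psi> (moments \<nu>) = (\<integral>z. ?S z \<partial>\<nu>)"
      unfolding l_def moments_def using ti by (simp add: Bochner_Integration.integral_sum)
    then have "\<bar>(\<integral>z. \<psi> z \<partial>\<nu>) - l \<psi> (moments \<nu>)\<bar> = \<bar>\<integral>z. \<psi> z - ?S z \<partial>\<nu>\<bar>"
      by (simp only: Bochner_Integration.integral_diff[OF \<psi>i Si])
    also have "\<dots> \<le> (\<integral>z. \<bar>\<psi> z - ?S z\<bar> \<partial>\<nu>)" by (rule integral_abs_bound)
    also have "\<dots> \<le> (\<integral>z. \<delta> / 4 \<partial>\<nu>)"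
      using kc[OF \<psi>] \<delta> by (intro integral_mono') (auto simp: sgraphonsD(3)[OF \<nu>])
    finally show ?thesis using \<nu>.prob_space by simp
  qed
  \<comment> \<open>The tolerance \<open>\<delta> / 2\<close> and the approximation errors
    \<open>\<delta> / 4\<close> at \<mu> and at \<nu> add up to \<delta>. Each condition involves
    finitely many coordinates and is therefore open.\<close>
  define V where "V = (\<Inter>\<psi>\<in>F. {x. \<bar>l \<psi> x - l \<psi> (moments \<mu>)\<bar> < \<delta> / 2})"
  have "open {x. \<bar>l \<psi> x - l \<psi> (moments \<mu>)\<bar> < \<delta> / 2}" for \<psi>
  proof (rule open_Collect_less)
    have "continuous_on UNIV (\<lambda>x :: nat \<times> nat \<times> nat \<Rightarrow> real. x p)" for p
      by (rule continuous_on_product_then_coordinatewise) (rule continuous_on_id)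
    then show "continuous_on UNIV (\<lambda>x. \<bar>l \<psi> x - l \<psi> (moments \<mu>)\<bar>)"
      unfolding l_def by (intro continuous_intros)
  qed (rule continuous_on_const)
  then have "open V" unfolding V_def using F(1) by (intro open_INT) auto
  moreover have "moments \<mu> \<in> V" using \<delta> by (simp add: V_def)
  moreover have "{\<nu> \<in> sgraphons. moments \<nu> \<in> V} \<subseteq> U"
  proof (rule order_trans[OF _ sub], intro subsetI, elim CollectE conjE, intro CollectI conjI)
    fix \<nu> assume \<nu>: "\<nu> \<in> sgraphons" and V: "moments \<nu> \<in> V"
    show "weakly_close F \<delta> \<mu> \<nu>"
      unfolding weakly_close_def
    proof
      fix \<psi> assume \<psi>: "\<psi> \<in> F"
      have "\<bar>l \<psi> (moments \<nu>) - l \<psi> (moments \<mu>)\<bar> < \<delta> / 2" using V \<psi> by (simp add: V_def)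
      with l[OF \<psi> \<nu>] l[OF \<psi> \<mu>'] show "\<bar>(\<integral>z. \<psi> z \<partial>\<mu>) - (\<integral>z. \<psi> z \<partial>\<nu>)\<bar> < \<delta>" by linarith
    qed
  qed
  ultimately show ?thesis by blast
qed

text \<open>The moments live in a metrizable product, where sequential compactness is enough;
  convergence there is coordinatewise, and each coordinate is the integral of a continuous
  function.\<close>

lemma compact_moments: "compact (moments ` sgraphons)"
  unfolding compact_eq_seq_compact_metric seq_compact_def
proof (intro allI impI)
  fix f :: "nat \<Rightarrow> nat \<times> nat \<times> nat \<Rightarrow> real" assume "\<forall>n. f n \<in> moments ` sgraphons"
  then have "\<exists>\<nu>. \<forall>n. \<nu> n \<in> sgraphons \<and> f n = moments (\<nu> n)" by (intro choice) blast
  then obtain \<nu> where \<nu>: "\<And>n. \<nu> n \<in> sgraphons" "\<And>n. f n = moments (\<nu> n)" by blast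
  show "\<exists>l\<in>moments ` sgraphons. \<exists>r. strict_mono r \<and> (f \<circ> r) \<longlonglongrightarrow> l"
  proof (rule sgraphons_seq_compact[OF \<nu>(1)])
    fix r \<mu> assume r: "strict_mono (r :: nat \<Rightarrow> nat)" and \<mu>: "\<mu> \<in> sgraphons"
      and lim: "\<And>\<psi> :: real \<times> real \<Rightarrow> real. continuous_on unit_square \<psi> \<Longrightarrow> (\<lambda>n. \<integral>z. \<psi> z \<partial>\<nu> (r n)) \<longlonglongrightarrow> (\<integral>z. \<psi> z \<partial>\<mu>)"
    have "limitin (product_topology (\<lambda>_. euclideanreal) UNIV) (f \<circ> r) (moments \<mu>) sequentially"
      unfolding limitin_componentwise
      using lim[OF continuous_tent2] by (simp add: \<nu>(2) moments_def)
    then have "(f \<circ> r) \<longlonglongrightarrow> moments \<mu>" by (simp add: euclidean_product_topology)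
    then show ?thesis using r \<mu> by blast
  qed
qed

text \<open>A cover of \<open>sgraphons\<close> is exchanged for open sets of moments whose
  preimages lie inside single members of the cover; a finite subcover of the compact image then
  selects finitely many members.\<close>

lemma compactin_sgraphons: "compactin sgraphon_topology sgraphons"
  unfolding compactin_def
proof (intro conjI allI impI)
  show "sgraphons \<subseteq> topspace sgraphon_topology" by (simp add: topspace_sgraphon_topology)
  fix \<U> assume \<U>: "Ball \<U> (openin sgraphon_topology) \<and> sgraphons \<subseteq> \<Union> \<U>"
  define \<V> where "\<V> = {V. open V \<and> (\<exists>U\<in>\<U>. {\<nu> \<in> sgraphons. moments \<nu> \<in> V} \<subseteq> U)}"
  have "moments ` sgraphons \<subseteq> \<Union>\<V>"
  proof (rule image_subsetI)
    fix \<mu> assume "\<mu> \<in> sgraphons"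
    with \<U> have "\<mu> \<in> \<Union>\<U>" by blast
    then obtain U where U: "U \<in> \<U>" "\<mu> \<in> U" by (rule UnionE)
    with \<U> have "openin sgraphon_topology U" by blast
    from openin_moments[OF this U(2)] U(1) show "moments \<mu> \<in> \<Union>\<V>" unfolding \<V>_def by blast
  qed
  moreover have "open V" if "V \<in> \<V>" for V using that by (simp add: \<V>_def)
  ultimately obtain \<D> where D: "\<D> \<subseteq> \<V>" "finite \<D>" "moments ` sgraphons \<subseteq> \<Union>\<D>"
    using compactE[OF compact_moments] by metis
  have "\<forall>V\<in>\<V>. \<exists>U. U \<in> \<U> \<and> {\<nu> \<in> sgraphons. moments \<nu> \<in> V} \<subseteq> U" by (auto simp: \<V>_def)
  from bchoice[OF this] obtain u where
    u: "\<forall>V\<in>\<V>. u V \<in> \<U> \<and> {\<nu> \<in> sgraphons. moments \<nu> \<in> V} \<subseteq> u V" ..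
  have "sgraphons \<subseteq> \<Union>(u ` \<D>)"
  proof
    fix \<nu> assume \<nu>: "\<nu> \<in> sgraphons"
    with D(3) obtain V where "V \<in> \<D>" "moments \<nu> \<in> V" by blast
    with u D(1) \<nu> show "\<nu> \<in> \<Union>(u ` \<D>)" by blast
  qed
  then show "\<exists>\<F>. finite \<F> \<and> \<F> \<subseteq> \<U> \<and> sgraphons \<subseteq> \<Union> \<F>"
    using u D by (intro exI[of _ "u ` \<D>"]) auto
qed

section \<open>Shapes and \<open>k\<close>-shapes determine each other\<close>

lemma shape_nonempty:
  assumes "\<mu> \<in> sgraphons"
  shows "shape \<mu> \<noteq> {}"
proof -
  have "(\<lambda>_. 1) \<in> FDC" using lambda1.prob_space by (simp add: FDC_def)
  then show ?thesis using Phi_in_shape[OF assms] by blast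
qed

lemma compactin_shape: "compactin sgraphon_topology (shape \<mu>)"
  by (rule closed_compactin[OF compactin_sgraphons shape_subset]) (simp add: shape_def)

lemma k_shape_nonempty: "k \<ge> 1 \<Longrightarrow> k_shape k \<mu> \<noteq> {}"
  using partition_matrix_in_k_shape[OF cell_partition_in_fractional_partitions] by blast

lemma partition_matrix_le_1:
  assumes f: "f \<in> fractional_partitions k" and \<mu>: "\<mu> \<in> sgraphons" and ij: "i \<in> {1..k}" "j \<in> {1..k}"
  shows "partition_matrix k f \<mu> (i, j) \<le> 1"
proof -
  interpret \<mu>: prob_space \<mu> using sgraphonsD[OF \<mu>] by simp
  note D = fractional_partitionsD[OF f]
  have "(\<integral>z. f i (fst z) * f j (snd z) \<partial>\<mu>) \<le> (\<integral>z. 1 \<partial>\<mu>)"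
  proof (rule integral_mono')
    fix z assume "z \<in> space \<mu>"
    then have z: "fst z \<in> {0..1}" "snd z \<in> {0..1}" by (auto simp: sgraphonsD(3)[OF \<mu>])
    show "f i (fst z) * f j (snd z) \<le> 1"
      by (intro mult_in_unit D(2,3)[OF ij(1) z(1)] D(2,3)[OF ij(2) z(2)])
  qed auto
  then show ?thesis using \<mu>.prob_space by (simp add: partition_matrix_apply[OF ij])
qed

text \<open>Entries are integrals of functions with values in \<open>{0..1}\<close> against a
  probability measure, so the closure stays inside a compact cube.\<close>

lemma compactin_k_shape:
  assumes \<mu>: "\<mu> \<in> sgraphons"
  shows "compactin (matrix_topology k) (k_shape k \<mu>)"
proof (rule closed_compactin)
  let ?B = "PiE ({1..k} \<times> {1..k}) (\<lambda>_. {0..1 :: real})"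
  show "compactin (matrix_topology k) ?B"
    unfolding matrix_topology_def compactin_PiE by simp
  have "(\<lambda>f. partition_matrix k f \<mu>) ` fractional_partitions k \<subseteq> ?B"
  proof (rule image_subsetI, rule PiE_I)
    fix f p assume f: "f \<in> fractional_partitions k"
    { assume "p \<in> {1..k} \<times> {1..k}"
      then obtain i j where p: "p = (i, j)" and ij: "i \<in> {1..k}" "j \<in> {1..k}" by blast
      show "partition_matrix k f \<mu> p \<in> {0..1}"
        unfolding p using sum_partition_matrix(2)[OF f \<mu> ij] partition_matrix_le_1[OF f \<mu> ij] by simp }
    { assume "p \<notin> {1..k} \<times> {1..k}"
      then show "partition_matrix k f \<mu> p = undefined" by (simp add: partition_matrix_def) }
  qed
  moreover have "closedin (matrix_topology k) ?B"
    unfolding matrix_topology_def closedin_product_topology by simp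
  ultimately show "k_shape k \<mu> \<subseteq> ?B"
    unfolding k_shape_eq by (rule closure_of_minimal)
  show "closedin (matrix_topology k) (k_shape k \<mu>)" by (simp add: k_shape_eq)
qed

lemma hausdorff_matrix_less:
  assumes "\<mu> \<in> sgraphons" "\<nu> \<in> sgraphons" "k \<ge> 1"
    and "hausdorff_distance (matrix_dist k) (k_shape k \<mu>) (k_shape k \<nu>) < r"
  shows "M \<in> k_shape k \<mu> \<Longrightarrow> \<exists>N\<in>k_shape k \<nu>. matrix_dist k M N < r"
    "N \<in> k_shape k \<nu> \<Longrightarrow> \<exists>M\<in>k_shape k \<mu>. matrix_dist k N M < r"
proof -
  interpret Metric_space "topspace (matrix_topology k)" "matrix_dist k" by (rule Metric_space_matrix_dist)
  have c: "compactin mtopology (k_shape k \<mu>)" "compactin mtopology (k_shape k \<nu>)"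
    unfolding mtopology_matrix_dist by (rule compactin_k_shape[OF assms(1)] compactin_k_shape[OF assms(2)])+
  note ne = k_shape_nonempty[OF assms(3)]
  show "M \<in> k_shape k \<mu> \<Longrightarrow> \<exists>N\<in>k_shape k \<nu>. matrix_dist k M N < r"
    by (rule hausdorff_distance_less[OF c ne ne assms(4)])
  show "N \<in> k_shape k \<nu> \<Longrightarrow> \<exists>M\<in>k_shape k \<mu>. matrix_dist k N M < r"
    by (rule hausdorff_distance_less[OF c(2,1) ne ne]) (use assms(4) hausdorff_distance_commute in simp)
qed

lemma finite_family_bounded:
  fixes F :: "(real \<times> real \<Rightarrow> real) set"
  assumes "finite F" "\<And>\<psi>. \<psi> \<in> F \<Longrightarrow> continuous_on unit_square \<psi>"
  shows "\<exists>B\<ge>0. \<forall>\<psi>\<in>F. \<forall>z\<in>unit_square. \<bar>\<psi> z\<bar> \<le> B"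
  using assms
proof (induction F)
  case (insert \<psi> F)
  then obtain B where B: "B \<ge> 0" "\<forall>\<psi>\<in>F. \<forall>z\<in>unit_square. \<bar>\<psi> z\<bar> \<le> B" by auto
  obtain B' where B': "\<And>z. z \<in> unit_square \<Longrightarrow> \<bar>\<psi> z\<bar> \<le> B'"
    by (rule continuous_bounded_unit_square[of \<psi>]) (use insert.prems in auto)
  show ?case
  proof (intro exI[of _ "max B B'"] conjI ballI)
    fix \<phi> z assume "\<phi> \<in> insert \<psi> F" and z: "z \<in> unit_square"
    then have "\<bar>\<phi> z\<bar> \<le> B' \<or> \<bar>\<phi> z\<bar> \<le> B" using B(2) B'[OF z] by blast
    then show "\<bar>\<phi> z\<bar> \<le> max B B'" by linarith
  qed (use B in simp)
qed auto

text \<open>Given \<rho> near some \<open>Phi f \<mu>\<close>, the cell matrix of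
  \<open>Phi f \<mu>\<close> lies in \<open>k_shape k \<mu>\<close>. So the matrix of some
  continuous partition \<open>g\<close> under \<nu> is near it, and
  \<open>partition_kernel k g h\<close> realises that matrix within \<open>shape \<nu>\<close>. The
  quantifiers put \<open>k\<close> and \<eta> before the measures, as a sequence requires.\<close>

lemma shape_close_of_k_shape_close:
  assumes fin: "finite F" and cont: "\<forall>\<psi>\<in>F. continuous_on unit_square \<psi>" and \<delta>: "\<delta> > 0"
  shows "\<exists>k\<ge>1. \<exists>\<eta>>0. \<forall>\<mu>\<in>sgraphons. \<forall>\<nu>\<in>sgraphons.
    (\<forall>M\<in>k_shape k \<mu>. \<exists>N\<in>k_shape k \<nu>. matrix_dist k M N < \<eta>) \<longrightarrow>
    (\<forall>\<rho>\<in>shape \<mu>. \<exists>\<rho>'\<in>shape \<nu>. weakly_close F \<delta> \<rho> \<rho>')"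
proof -
  note F = fin bspec[OF cont]
  let ?osc = "\<lambda>\<psi> k. \<forall>z\<in>unit_square. \<forall>z'\<in>unit_square.
    \<bar>fst z - fst z'\<bar> \<le> 1 / real k \<and> \<bar>snd z - snd z'\<bar> \<le> 1 / real k \<longrightarrow> \<bar>\<psi> z - \<psi> z'\<bar> \<le> \<delta> / 8"
  have "\<forall>\<^sub>F k in sequentially. \<forall>\<psi>\<in>F. ?osc \<psi> k"
  proof (rule eventually_ball_finite[OF F(1)], rule ballI)
    fix \<psi> assume "\<psi> \<in> F"
    then show "\<forall>\<^sub>F k in sequentially. ?osc \<psi> k"
      unfolding eventually_sequentially using F(2) \<delta> by (intro unit_square_oscillation) auto
  qed
  then have "\<forall>\<^sub>F k in sequentially. k \<ge> 1 \<and> (\<forall>\<psi>\<in>F. ?osc \<psi> k)"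
    by (rule eventually_conj[OF eventually_ge_at_top])
  then obtain k where k: "k \<ge> 1" and osc: "\<And>\<psi>. \<psi> \<in> F \<Longrightarrow> ?osc \<psi> k"
    by (auto dest: eventually_happens)
  obtain B where B: "B \<ge> 0" "\<And>\<psi> z. \<psi> \<in> F \<Longrightarrow> z \<in> unit_square \<Longrightarrow> \<bar>\<psi> z\<bar> \<le> B"
    using finite_family_bounded[OF F] by blast
  \<comment> \<open>Makes \<open>(real k)\<^sup>2 * (2 * \<eta> * B)\<close> at most
    \<open>\<delta> / 8\<close>. This term occurs twice, for the smoothed cells and for matrices
    within \<open>2 * \<eta>\<close>; with the oscillation the sum is at most
    \<open>\<delta> / 2\<close>, below the \<open>\<delta> * 3 / 4\<close> left over by the closure.
    \<open>B + 1\<close> keeps the divisor positive.\<close>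
  define \<eta> where "\<eta> = \<delta> / (16 * (real k)\<^sup>2 * (B + 1))"
  have k2: "(real k)\<^sup>2 > 0" using k by simp
  have \<eta>: "\<eta> > 0" using \<delta> k2 B(1) by (simp add: \<eta>_def add_nonneg_pos)
  have "16 * (real k)\<^sup>2 * (B + 1) \<noteq> 0" using k2 B(1) by simp
  then have "16 * (real k)\<^sup>2 * (B + 1) * \<eta> = \<delta>"
    unfolding \<eta>_def times_divide_eq_right by (rule nonzero_mult_div_cancel_left)
  then have "(real k)\<^sup>2 * (2 * \<eta> * (B + 1)) = \<delta> / 8" by (simp add: algebra_simps)
  moreover have "(real k)\<^sup>2 * (2 * \<eta> * B) \<le> (real k)\<^sup>2 * (2 * \<eta> * (B + 1))"
    using k2 \<eta> by (intro mult_left_mono) auto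
  ultimately have small: "(real k)\<^sup>2 * (2 * \<eta> * B) \<le> \<delta> / 8" by linarith
  obtain h where h: "h \<in> continuous_partitions k"
    and h_err: "\<And>i. i \<in> {1..k} \<Longrightarrow> (\<integral>u. \<bar>cell_partition k i u - h i u\<bar> \<partial>lambda1) \<le> \<eta>"
    using continuous_cells[OF k \<eta>] by blast
  have cell: "cell_partition k \<in> fractional_partitions k" by (rule cell_partition_in_fractional_partitions[OF k])
  show ?thesis
  proof (intro exI[of _ k] exI[of _ \<eta>] conjI ballI impI k \<eta>)
    fix \<mu> \<nu> \<rho> assume \<mu>: "\<mu> \<in> sgraphons" and \<nu>: "\<nu> \<in> sgraphons" and \<rho>: "\<rho> \<in> shape \<mu>"
      and close: "\<forall>M\<in>k_shape k \<mu>. \<exists>N\<in>k_shape k \<nu>. matrix_dist k M N < \<eta>"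
    obtain f where f: "f \<in> FDC" and \<rho>f: "weakly_close F (\<delta> / 4) \<rho> (Phi f \<mu>)"
      using shape_approx[OF \<rho> F] \<delta> by (meson divide_pos_pos zero_less_numeral)
    let ?M = "partition_matrix k (cell_partition k) (Phi f \<mu>)"
    have "?M \<in> k_shape k \<mu>"
      unfolding partition_matrix_Phi[OF f \<mu> cell]
      by (intro partition_matrix_in_k_shape transfer_in_fractional_partitions f cell)
    then obtain N where N: "N \<in> k_shape k \<nu>" "matrix_dist k ?M N < \<eta>" using close by blast
    obtain g where g: "g \<in> continuous_partitions k" "matrix_dist k N (partition_matrix k g \<nu>) < \<eta>"
      using k_shape_approx[OF \<nu> k N(1) \<eta>] by blast
    let ?\<rho>' = "Phi (partition_kernel k g h) \<nu>"
    have "weakly_close F (\<delta> * 3 / 4) (Phi f \<mu>) ?\<rho>'"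
      unfolding weakly_close_def
    proof
      fix \<psi> assume \<psi>: "\<psi> \<in> F"
      have "\<bar>(\<integral>z. \<psi> z \<partial>Phi f \<mu>) - (\<integral>z. \<psi> z \<partial>?\<rho>')\<bar> \<le>
        2 * (\<delta> / 8) + (real k)\<^sup>2 * (2 * \<eta> * B) + (real k)\<^sup>2 * (2 * \<eta> * B)"
      proof (rule kernel_integral_close[OF k g(1) h h_err Phi_in_sgraphons[OF f \<mu>] \<nu>])
        fix i j assume "i \<in> {1..k}" "j \<in> {1..k}"
        then have "\<bar>?M (i, j) - partition_matrix k g \<nu> (i, j)\<bar> \<le> matrix_dist k ?M (partition_matrix k g \<nu>)"
          by (rule abs_entry_le_matrix_dist)
        also have "\<dots> \<le> 2 * \<eta>"
          using matrix_dist_triangle[of k ?M "partition_matrix k g \<nu>" N] N(2) g(2) by linarith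
        finally show "\<bar>?M (i, j) - partition_matrix k g \<nu> (i, j)\<bar> \<le> 2 * \<eta>" .
      next
        show "\<psi> \<in> borel_measurable lambda2" by (rule continuous_imp_measurable_lambda2[OF F(2)[OF \<psi>]])
        show "\<bar>\<psi> z\<bar> \<le> B" if "z \<in> unit_square" for z by (rule B(2)[OF \<psi> that])
        fix x y :: real assume x: "x \<in> {0..1}" and y: "y \<in> {0..1}"
        have r: "cell_index k x \<in> {1..k}" "cell_index k y \<in> {1..k}"
          using cell_index_range[OF k] x y by blast+
        then have "(real (cell_index k x) / k, real (cell_index k y) / k) \<in> unit_square" by auto
        moreover have "(x, y) \<in> unit_square" using x y by simp
        moreover have "\<bar>x - real (cell_index k x) / k\<bar> \<le> 1 / k" "\<bar>y - real (cell_index k y) / k\<bar> \<le> 1 / k"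
          using cell_index_dist[OF k x r(1)] cell_index_dist[OF k y r(2)] by simp_all
        ultimately show "\<bar>\<psi> (x, y) - \<psi> (real (cell_index k x) / k, real (cell_index k y) / k)\<bar> \<le> \<delta> / 8"
          using osc[OF \<psi>] by (metis fst_conv snd_conv)
      qed
      then show "\<bar>(\<integral>z. \<psi> z \<partial>Phi f \<mu>) - (\<integral>z. \<psi> z \<partial>?\<rho>')\<bar> < \<delta> * 3 / 4"
        using small \<delta> by linarith
    qed
    from weakly_close_trans[OF \<rho>f this] have "weakly_close F \<delta> \<rho> ?\<rho>'" by simp
    then show "\<exists>\<rho>'\<in>shape \<nu>. weakly_close F \<delta> \<rho> \<rho>'"
      using Phi_in_shape[OF \<nu> partition_kernel_FDC[OF g(1) h k]] by blast
  qed
qed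

text \<open>A Lebesgue number argument without a metric: finitely many neighbourhoods of half the
  radius cover \<open>L\<close>, and the other half absorbs the step from \<rho> to \<nu>.\<close>

lemma compact_weak_neighbourhood:
  assumes L: "compactin sgraphon_topology L" and U: "openin sgraphon_topology U" "L \<subseteq> U"
  shows "\<exists>F \<delta>. finite F \<and> (\<forall>\<psi>\<in>F. continuous_on unit_square \<psi>) \<and> \<delta> > 0 \<and>
    (\<forall>\<rho>\<in>L. \<forall>\<nu>\<in>sgraphons. weakly_close F \<delta> \<rho> \<nu> \<longrightarrow> \<nu> \<in> U)"
proof -
  have LS: "L \<subseteq> sgraphons" using compactin_subset_topspace[OF L] by (simp add: topspace_sgraphon_topology)
  let ?P = "\<lambda>\<rho> q. finite (fst q) \<and> (\<forall>\<psi>\<in>fst q. continuous_on unit_square \<psi>) \<and> snd q > 0 \<and>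
      {\<nu> \<in> sgraphons. weakly_close (fst q) (snd q) \<rho> \<nu>} \<subseteq> U"
  have "\<forall>\<rho>\<in>L. \<exists>q. ?P \<rho> q"
  proof
    fix \<rho> assume "\<rho> \<in> L"
    with U(2) have "\<rho> \<in> U" by blast
    from weak_neighbourhood[OF U(1) this] show "\<exists>q. ?P \<rho> q" by simp
  qed
  from bchoice[OF this] obtain q where q: "\<forall>\<rho>\<in>L. ?P \<rho> (q \<rho>)" ..
  define W where "W \<rho> = {\<nu> \<in> sgraphons. weakly_close (fst (q \<rho>)) (snd (q \<rho>) / 2) \<rho> \<nu>}" for \<rho>
  have "openin sgraphon_topology (W \<rho>)" if "\<rho> \<in> L" for \<rho>
    unfolding W_def using q that by (intro openin_weakly_close) auto
  moreover have "L \<subseteq> \<Union>(W ` L)"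
  proof
    fix \<rho> assume "\<rho> \<in> L"
    then have "\<rho> \<in> W \<rho>" using q LS by (auto simp: W_def weakly_close_def)
    with \<open>\<rho> \<in> L\<close> show "\<rho> \<in> \<Union>(W ` L)" by blast
  qed
  ultimately obtain \<D> where "finite \<D>" "\<D> \<subseteq> W ` L" "L \<subseteq> \<Union>\<D>"
    using compactinD[OF L, of "W ` L"] by blast
  then obtain C where C: "finite C" "C \<subseteq> L" "L \<subseteq> \<Union>(W ` C)"
    by (metis finite_subset_image)
  define F where "F = (\<Union>\<rho>\<in>C. fst (q \<rho>))"
  define \<delta> where "\<delta> = Min (insert 1 ((\<lambda>\<rho>. snd (q \<rho>) / 2) ` C))"
  have \<delta>: "\<delta> > 0" unfolding \<delta>_def using C q by (subst Min_gr_iff) auto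
  have \<delta>_le: "\<delta> \<le> snd (q \<rho>) / 2" if "\<rho> \<in> C" for \<rho>
    unfolding \<delta>_def using C(1) that by (intro Min_le) auto
  show ?thesis
  proof (intro exI[of _ F] exI[of _ \<delta>] conjI ballI impI \<delta>)
    show "finite F" unfolding F_def using C q by auto
    show "continuous_on unit_square \<psi>" if "\<psi> \<in> F" for \<psi> using that C(2) q unfolding F_def by blast
    fix \<rho> \<nu> assume "\<rho> \<in> L" and \<nu>: "\<nu> \<in> sgraphons" and close: "weakly_close F \<delta> \<rho> \<nu>"
    then obtain \<sigma> where \<sigma>: "\<sigma> \<in> C" "\<rho> \<in> W \<sigma>" using C(3) by blast
    have "weakly_close (fst (q \<sigma>)) (snd (q \<sigma>) / 2) \<rho> \<nu>"
      by (rule weakly_close_mono[OF close _ \<delta>_le[OF \<sigma>(1)]]) (use \<sigma>(1) in \<open>auto simp: F_def\<close>)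
    moreover have "weakly_close (fst (q \<sigma>)) (snd (q \<sigma>) / 2) \<sigma> \<rho>" using \<sigma>(2) by (simp add: W_def)
    ultimately have "weakly_close (fst (q \<sigma>)) (snd (q \<sigma>)) \<sigma> \<nu>"
      using weakly_close_trans[of "fst (q \<sigma>)" "snd (q \<sigma>) / 2" \<sigma> \<rho> "snd (q \<sigma>) / 2" \<nu>] by simp
    then show "\<nu> \<in> U" using q \<sigma>(1) C(2) \<nu> by blast
  qed
qed

section \<open>Limits in the Vietoris topology\<close>

lemma limitin_vietoris_topology:
  "limitin (vietoris_topology X) K L net \<longleftrightarrow> compactin X L \<and>
    (\<forall>U. openin X U \<longrightarrow> (L \<subseteq> U \<longrightarrow> (\<forall>\<^sub>F n in net. compactin X (K n) \<and> K n \<subseteq> U)) \<and>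
      (L \<inter> U \<noteq> {} \<longrightarrow> (\<forall>\<^sub>F n in net. compactin X (K n) \<and> K n \<inter> U \<noteq> {})))"
    (is "?lhs \<longleftrightarrow> ?L \<and> ?R")
proof -
  let ?S1 = "{{K. compactin X K \<and> K \<subseteq> U} | U. openin X U}"
    and ?S2 = "{{K. compactin X K \<and> K \<inter> U \<noteq> {}} | U. openin X U}"
  have "{K. compactin X K \<and> K \<subseteq> topspace X} \<in> ?S1 \<union> ?S2"
    by (rule UnI1, rule CollectI, rule exI[of _ "topspace X"]) simp
  moreover have "L \<in> {K. compactin X K \<and> K \<subseteq> topspace X}" if "compactin X L"
    using that compactin_subset_topspace[OF that] by simp
  moreover have "compactin X L" if "L \<in> V" "V \<in> ?S1 \<union> ?S2" for V
    using that(2,1) by (elim UnE CollectE exE conjE) simp_all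
  ultimately have mem: "L \<in> \<Union>(?S1 \<union> ?S2) \<longleftrightarrow> ?L" by (meson UnionE UnionI)
  have ball: "(\<forall>V\<in>?S1 \<union> ?S2. Q V) \<longleftrightarrow>
    (\<forall>U. openin X U \<longrightarrow> Q {K. compactin X K \<and> K \<subseteq> U} \<and> Q {K. compactin X K \<and> K \<inter> U \<noteq> {}})" for Q
    unfolding ball_Un setcompr_eq_image by auto
  show ?thesis
    unfolding vietoris_topology_def limitin_topology_generated_by mem ball by (auto simp: conj_commute)
qed

text \<open>The uniform comparison is applied to \<open>\<nu> n\<close> and \<mu> in both orders.
  Inclusion in an open set needs a test family valid on the whole compact
  \<open>shape \<mu>\<close>; meeting an open set needs one at a single point.\<close>

lemma k_shapes_imp_shapes:
  assumes \<nu>: "\<And>n. \<nu> n \<in> sgraphons" and \<mu>: "\<mu> \<in> sgraphons"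
    and conv: "\<And>k. k \<ge> 1 \<Longrightarrow> (\<lambda>n. hausdorff_distance (matrix_dist k) (k_shape k (\<nu> n)) (k_shape k \<mu>)) \<longlonglongrightarrow> 0"
  shows "limitin (vietoris_topology sgraphon_topology) (\<lambda>n. shape (\<nu> n)) (shape \<mu>) sequentially"
proof -
  let ?X = sgraphon_topology
  have ev: "\<forall>\<^sub>F n in sequentially. (\<forall>\<rho>\<in>shape (\<nu> n). \<exists>\<rho>'\<in>shape \<mu>. weakly_close F \<delta> \<rho> \<rho>') \<and>
      (\<forall>\<rho>\<in>shape \<mu>. \<exists>\<rho>'\<in>shape (\<nu> n). weakly_close F \<delta> \<rho> \<rho>')"
    if F: "finite F" "\<forall>\<psi>\<in>F. continuous_on unit_square \<psi>" and \<delta>: "\<delta> > 0" for F \<delta>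
  proof -
    from shape_close_of_k_shape_close[OF F \<delta>]
    obtain k \<eta> where k: "k \<ge> 1" and \<eta>: "\<eta> > 0" and
      *: "\<forall>\<mu>\<in>sgraphons. \<forall>\<nu>\<in>sgraphons.
        (\<forall>M\<in>k_shape k \<mu>. \<exists>N\<in>k_shape k \<nu>. matrix_dist k M N < \<eta>) \<longrightarrow>
        (\<forall>\<rho>\<in>shape \<mu>. \<exists>\<rho>'\<in>shape \<nu>. weakly_close F \<delta> \<rho> \<rho>')"
      by (elim exE conjE)
    note imp = mp[OF bspec[OF bspec[OF *]]]
    have "\<forall>\<^sub>F n in sequentially. hausdorff_distance (matrix_dist k) (k_shape k (\<nu> n)) (k_shape k \<mu>) < \<eta>"
      by (rule order_tendstoD(2)[OF conv[OF k] \<eta>])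
    then show ?thesis
    proof eventually_elim
      case (elim n)
      show ?case
        using hausdorff_matrix_less[OF \<nu> \<mu> k elim] by (intro conjI imp \<nu> \<mu>) blast+
    qed
  qed
  show ?thesis
    unfolding limitin_vietoris_topology
  proof (intro conjI allI impI compactin_shape)
    fix U assume U: "openin ?X U" and "shape \<mu> \<subseteq> U"
    from compact_weak_neighbourhood[OF compactin_shape this]
    obtain F \<delta> where F: "finite F" "\<forall>\<psi>\<in>F. continuous_on unit_square \<psi>" "\<delta> > 0"
      and sub: "\<forall>\<rho>\<in>shape \<mu>. \<forall>\<nu>\<in>sgraphons. weakly_close F \<delta> \<rho> \<nu> \<longrightarrow> \<nu> \<in> U" by (elim exE conjE)
    have "\<forall>\<^sub>F n in sequentially. shape (\<nu> n) \<subseteq> U"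
      using ev[OF F]
    proof eventually_elim
      case (elim n)
      show ?case
      proof
        fix \<rho> assume \<rho>: "\<rho> \<in> shape (\<nu> n)"
        with elim obtain \<rho>' where \<rho>': "\<rho>' \<in> shape \<mu>" "weakly_close F \<delta> \<rho> \<rho>'" by blast
        then have "weakly_close F \<delta> \<rho>' \<rho>" by (simp add: weakly_close_def abs_minus_commute)
        then show "\<rho> \<in> U" using sub \<rho>'(1) \<rho> shape_subset by blast
      qed
    qed
    then show "\<forall>\<^sub>F n in sequentially. compactin ?X (shape (\<nu> n)) \<and> shape (\<nu> n) \<subseteq> U"
      using compactin_shape by simp
  next
    fix U assume U: "openin ?X U" and "shape \<mu> \<inter> U \<noteq> {}"
    then obtain \<rho> where \<rho>: "\<rho> \<in> shape \<mu>" "\<rho> \<in> U" by blast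
    from weak_neighbourhood[OF U \<rho>(2)]
    obtain F \<delta> where F: "finite F" "\<forall>\<psi>\<in>F. continuous_on unit_square \<psi>" "\<delta> > 0"
      and sub: "{\<nu> \<in> sgraphons. weakly_close F \<delta> \<rho> \<nu>} \<subseteq> U" by (elim exE conjE)
    have "\<forall>\<^sub>F n in sequentially. shape (\<nu> n) \<inter> U \<noteq> {}"
      using ev[OF F]
    proof eventually_elim
      case (elim n)
      with \<rho>(1) obtain \<rho>' where "\<rho>' \<in> shape (\<nu> n)" "weakly_close F \<delta> \<rho> \<rho>'" by blast
      moreover from this sub have "\<rho>' \<in> U" using shape_subset by blast
      ultimately show ?case by blast
    qed
    then show "\<forall>\<^sub>F n in sequentially. compactin ?X (shape (\<nu> n)) \<and> shape (\<nu> n) \<inter> U \<noteq> {}"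
      using compactin_shape by simp
  qed
qed

text \<open>Both kinds of subbasic conditions on an image are conditions of the same kind with the
  open preimage, and images of compact sets are compact.\<close>

lemma limitin_vietoris_image:
  assumes f: "continuous_map X Y f" and lim: "limitin (vietoris_topology X) K L net"
  shows "limitin (vietoris_topology Y) (\<lambda>n. f ` K n) (f ` L) net"
proof -
  have L: "compactin X L" using lim unfolding limitin_vietoris_topology by blast
  show ?thesis
    unfolding limitin_vietoris_topology
  proof (intro conjI allI impI image_compactin[OF L f])
    fix U assume "openin Y U"
    with f have U: "openin X {x \<in> topspace X. f x \<in> U}" by (simp add: continuous_map)
    { assume "f ` L \<subseteq> U"
      then have "L \<subseteq> {x \<in> topspace X. f x \<in> U}" using compactin_subset_topspace[OF L] by blast
      then have "\<forall>\<^sub>F n in net. compactin X (K n) \<and> K n \<subseteq> {x \<in> topspace X. f x \<in> U}"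
        using lim U unfolding limitin_vietoris_topology by blast
      then show "\<forall>\<^sub>F n in net. compactin Y (f ` K n) \<and> f ` K n \<subseteq> U"
        by eventually_elim (use image_compactin[OF _ f] in blast) }
    { assume "f ` L \<inter> U \<noteq> {}"
      then have "L \<inter> {x \<in> topspace X. f x \<in> U} \<noteq> {}" using compactin_subset_topspace[OF L] by blast
      then have "\<forall>\<^sub>F n in net. compactin X (K n) \<and> K n \<inter> {x \<in> topspace X. f x \<in> U} \<noteq> {}"
        using lim U unfolding limitin_vietoris_topology by blast
      then show "\<forall>\<^sub>F n in net. compactin Y (f ` K n) \<and> f ` K n \<inter> U \<noteq> {}"
        by eventually_elim (use image_compactin[OF _ f] in blast) }
  qed
qed

text \<open>For fixed \<open>h\<close> the map \<open>partition_matrix k h\<close> is continuous, so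
  the images of the shapes converge. Each image lies in the corresponding \<open>k\<close>-shape and
  comes within \<open>r / 2\<close> of all its points, for the whole sequence at once.\<close>

lemma shapes_imp_k_shapes:
  assumes \<nu>: "\<And>n. \<nu> n \<in> sgraphons" and \<mu>: "\<mu> \<in> sgraphons"
    and lim: "limitin (vietoris_topology sgraphon_topology) (\<lambda>n. shape (\<nu> n)) (shape \<mu>) sequentially"
    and k: "k \<ge> 1"
  shows "(\<lambda>n. hausdorff_distance (matrix_dist k) (k_shape k (\<nu> n)) (k_shape k \<mu>)) \<longlonglongrightarrow> 0"
proof (rule tendstoI)
  interpret Metric_space "topspace (matrix_topology k)" "matrix_dist k" by (rule Metric_space_matrix_dist)
  note mt = mtopology_matrix_dist[of k]
  fix r :: real assume r: "r > 0"
  \<comment> \<open>Chosen so that the bound on the error of recovering a matrix through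
    \<open>h\<close> is \<open>r / 4\<close>.\<close>
  define \<epsilon> where "\<epsilon> = r / (16 * (real k)\<^sup>2 * real k)"
  have \<epsilon>: "\<epsilon> > 0" using r k by (simp add: \<epsilon>_def)
  have err: "(real k)\<^sup>2 * (4 * real k * \<epsilon>) = r / 4" using k by (simp add: \<epsilon>_def field_simps)
  obtain h where h: "h \<in> continuous_partitions k"
    and h_err: "\<And>i. i \<in> {1..k} \<Longrightarrow> (\<integral>u. \<bar>cell_partition k i u - h i u\<bar> \<partial>lambda1) \<le> \<epsilon>"
    using continuous_cells[OF k \<epsilon>] by blast
  let ?T = "\<lambda>\<mu>. partition_matrix k h ` shape \<mu>"
  have cT: "compactin mtopology (?T \<mu>)" for \<mu>
    unfolding mt by (rule image_compactin[OF compactin_shape continuous_map_partition_matrix[OF h]])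
  have neT: "?T \<mu> \<noteq> {}" if "\<mu> \<in> sgraphons" for \<mu> using shape_nonempty[OF that] by simp
  have near: "\<exists>A\<in>?T \<mu>. matrix_dist k M A < r / 2" if \<mu>: "\<mu> \<in> sgraphons" and M: "M \<in> k_shape k \<mu>" for \<mu> M
  proof -
    have "r / 4 > 0" using r by simp
    then obtain g where g: "g \<in> continuous_partitions k" "matrix_dist k M (partition_matrix k g \<mu>) < r / 4"
      using k_shape_approx[OF \<mu> k M] by blast
    let ?A = "partition_matrix k h (Phi (partition_kernel k g h) \<mu>)"
    have "matrix_dist k ?A (partition_matrix k g \<mu>) \<le> r / 4"
      using partition_matrix_kernel_dist[OF k h h_err g(1) \<mu>] unfolding err .
    with g(2) have "matrix_dist k M ?A < r / 2"
      using matrix_dist_triangle[of k M ?A "partition_matrix k g \<mu>"] matrix_dist_commute[of k ?A "partition_matrix k g \<mu>"] by linarith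
    then show ?thesis using Phi_in_shape[OF \<mu> partition_kernel_FDC[OF g(1) h k]] by blast
  qed
  have "limitin (vietoris_topology mtopology) (\<lambda>n. ?T (\<nu> n)) (?T \<mu>) sequentially"
    unfolding mt by (rule limitin_vietoris_image[OF continuous_map_partition_matrix[OF h] lim])
  then have "(\<lambda>n. hausdorff_distance (matrix_dist k) (?T (\<nu> n)) (?T \<mu>)) \<longlonglongrightarrow> 0"
    by (rule limitin_vietoris_iff_hausdorff[THEN iffD1, rotated -1]) (intro cT neT \<nu> \<mu>)+
  moreover have "r / 4 > 0" using r by simp
  ultimately have "\<forall>\<^sub>F n in sequentially. hausdorff_distance (matrix_dist k) (?T (\<nu> n)) (?T \<mu>) < r / 4"
    by (rule order_tendstoD(2))
  then show "\<forall>\<^sub>F n in sequentially. dist (hausdorff_distance (matrix_dist k) (k_shape k (\<nu> n)) (k_shape k \<mu>)) 0 < r"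
  proof eventually_elim
    case (elim n)
    have elim': "hausdorff_distance (matrix_dist k) (?T \<mu>) (?T (\<nu> n)) < r / 4"
      using elim by (simp only: hausdorff_distance_commute)
    \<comment> \<open>From \<open>M\<close> to the image for \<alpha> at cost \<open>r / 2\<close>,
      across to the image for \<beta> at cost \<open>r / 4\<close>; the latter image is contained in
      \<open>k_shape k \<beta>\<close>, so there is no third cost.\<close>
    have *: "\<exists>N\<in>k_shape k \<beta>. matrix_dist k M N \<le> r * 3 / 4"
      if \<alpha>: "\<alpha> \<in> sgraphons" and \<beta>: "\<beta> \<in> sgraphons" and M: "M \<in> k_shape k \<alpha>"
        and d: "hausdorff_distance (matrix_dist k) (?T \<alpha>) (?T \<beta>) < r / 4" for \<alpha> \<beta> M
    proof -
      obtain A where A: "A \<in> ?T \<alpha>" "matrix_dist k M A < r / 2" using near[OF \<alpha> M] by blast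
      obtain N where N: "N \<in> ?T \<beta>" "matrix_dist k A N < r / 4"
        using hausdorff_distance_less[OF cT cT neT[OF \<alpha>] neT[OF \<beta>] d A(1)] by blast
      have "N \<in> k_shape k \<beta>" using partition_matrix_shape_subset[OF h \<beta>] N(1) by blast
      moreover have "matrix_dist k M N \<le> r * 3 / 4"
        using matrix_dist_triangle[of k M N A] A(2) N(2) by linarith
      ultimately show ?thesis by blast
    qed
    have "hausdorff_distance (matrix_dist k) (k_shape k (\<nu> n)) (k_shape k \<mu>) \<le> r * 3 / 4"
    proof (rule hausdorff_distance_le)
      show "\<exists>N\<in>k_shape k \<mu>. matrix_dist k M N \<le> r * 3 / 4" if "M \<in> k_shape k (\<nu> n)" for M
        by (rule *[OF \<nu> \<mu> that elim])
      show "\<exists>M\<in>k_shape k (\<nu> n). matrix_dist k M N \<le> r * 3 / 4" if "N \<in> k_shape k \<mu>" for N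
        using *[OF \<mu> \<nu> that elim'] by (simp only: matrix_dist_commute)
    qed (use k_shape_nonempty[OF k] in blast)+
    moreover have "0 \<le> hausdorff_distance (matrix_dist k) (k_shape k (\<nu> n)) (k_shape k \<mu>)"
      by (rule hausdorff_distance_nonneg(2))
        (simp_all only: mt compactin_k_shape[OF \<nu>] compactin_k_shape[OF \<mu>] k_shape_nonempty[OF k] not_False_eq_True)
    ultimately show ?case using r by simp
  qed
qed

section \<open>Graphs\<close>

lemma adjacency_matrix_apply:
  "i \<in> {1..card (verts G)} \<Longrightarrow> j \<in> {1..card (verts G)} \<Longrightarrow> adjacency_matrix G e (i, j) = of_bool (e i \<rightarrow>\<^bsub>G\<^esub> e j)"
  by (simp add: adjacency_matrix_def)

text \<open>The enumeration reaches both ends of an arc, which gives an entry 1; so the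
  normalisation does not divide by zero.\<close>

lemma l1_norm_adjacency_pos:
  assumes "graph G" "arcs G \<noteq> {}" "bij_betw e {1..card (verts G)} (verts G)"
  shows "l1_norm (card (verts G)) (adjacency_matrix G e) > 0"
proof -
  interpret graph G by fact
  obtain a where a: "a \<in> arcs G" using assms(2) by blast
  then have "tail G a \<in> e ` {1..card (verts G)}" "head G a \<in> e ` {1..card (verts G)}"
    using assms(3) by (auto simp: bij_betw_def)
  then obtain i j where ij: "i \<in> {1..card (verts G)}" "j \<in> {1..card (verts G)}" "tail G a = e i" "head G a = e j"
    by (elim imageE)
  have "tail G a \<rightarrow>\<^bsub>G\<^esub> head G a" using a by (auto simp: arcs_ends_def arc_to_ends_def)
  then have "adjacency_matrix G e (i, j) = 1" using ij by (simp add: adjacency_matrix_def)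
  moreover have "\<bar>adjacency_matrix G e (i, j)\<bar> \<le> l1_norm (card (verts G)) (adjacency_matrix G e)"
    unfolding l1_norm_def using ij by (intro member_le_sum[where f = "\<lambda>p. \<bar>adjacency_matrix G e p\<bar>"]) auto
  ultimately show ?thesis by simp
qed

lemma indicator_cell_integral:
  assumes k: "k \<ge> 1" and i: "i \<in> {1..k}" and j: "j \<in> {1..k}"
  shows "(\<integral>z. indicator ({(real i - 1) / k <..< real i / k} \<times> {(real j - 1) / k <..< real j / k}) z \<partial>lambda2) = 1 / (real k)\<^sup>2"
proof -
  let ?I = "\<lambda>i. {(real i - 1) / k <..< real i / k}"
  have I: "(\<integral>x. indicator (?I i) x \<partial>lambda1) = 1 / k" if i: "i \<in> {1..k}" for i
  proof -
    have "real i / k \<le> 1" "0 \<le> (real i - 1) / k" using i k by (simp_all add: field_simps)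
    then have A: "?I i \<subseteq> {0..1}" by auto
    have "(\<integral>x. indicator (?I i) x \<partial>lambda1) = measure lborel (?I i)"
      using A by (simp add: measure_def emeasure_lambda1 Int_absorb2)
    then show ?thesis using k by (simp add: diff_divide_distrib)
  qed
  have m: "(indicator (?I i) :: real \<Rightarrow> real) \<in> borel_measurable lambda1" for i
    by (rule measurable_lambda1I) simp
  have "(\<integral>z. indicator (?I i \<times> ?I j) z \<partial>lambda2) = (\<integral>z. indicator (?I i) (fst z) * (indicator (?I j) (snd z) :: real) \<partial>lambda2)"
    by (intro Bochner_Integration.integral_cong) (simp_all add: indicator_times)
  also have "\<dots> = (\<integral>x. indicator (?I i) x \<partial>lambda1) * (\<integral>x. indicator (?I j) x \<partial>lambda1)"
    by (rule integral_lambda2_prod[OF m _ m, of _ 1 _ 1]) (auto simp: indicator_def)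
  finally show ?thesis by (simp only: I[OF i] I[OF j] power2_eq_square times_divide_times_eq mult_1)
qed

text \<open>Each cell has mass \<open>1 / (real k)\<^sup>2\<close>, which cancels the factor in the
  density, so the total mass is the sum of the entries; exchanging the order of summation turns
  symmetry of \<open>A\<close> into symmetry of the density.\<close>

lemma matrix_measure_in_sgraphons:
  assumes k: "k \<ge> 1"
    and A: "\<And>i j. i \<in> {1..k} \<Longrightarrow> j \<in> {1..k} \<Longrightarrow> 0 \<le> A (i, j)"
      "\<And>i j. i \<in> {1..k} \<Longrightarrow> j \<in> {1..k} \<Longrightarrow> A (j, i) = A (i, j)"
      "(\<Sum>i=1..k. \<Sum>j=1..k. A (i, j)) = 1"
  shows "matrix_measure k A \<in> sgraphons"
  unfolding matrix_measure_def
proof (rule density_in_sgraphons)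
  let ?Q = "\<lambda>i j. {(real i - 1) / k <..< real i / k} \<times> {(real j - 1) / k <..< real j / k}"
  let ?g = "\<lambda>z. \<Sum>i=1..k. \<Sum>j=1..k. (real k)\<^sup>2 * A (i, j) * indicator (?Q i j) z"
  have Qm: "(indicator (?Q i j) :: real \<times> real \<Rightarrow> real) \<in> borel_measurable lambda2" for i j
    by (intro measurable_lambda2I borel_measurable_indicator borel_open open_Times) simp_all
  then show "?g \<in> borel_measurable lambda2"
    by (intro borel_measurable_sum borel_measurable_times borel_measurable_const)
  show "0 \<le> ?g z" for z
    using A(1) by (intro sum_nonneg mult_nonneg_nonneg) auto
  show "?g (y, x) = ?g (x, y)" for x y
  proof -
    have "?g (y, x) = (\<Sum>i=1..k. \<Sum>j=1..k. (real k)\<^sup>2 * A (j, i) * indicator (?Q j i) (x, y))"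
      using A(2) by (intro sum.cong refl) (auto simp: indicator_def)
    also have "\<dots> = ?g (x, y)" by (rule sum.swap)
    finally show ?thesis .
  qed
  have Qi: "integrable lambda2 (indicator (?Q i j) :: real \<times> real \<Rightarrow> real)" for i j
    by (rule integrable_lambda2[OF Qm, of _ _ 1]) (auto simp: indicator_def)
  note ds = integral_double_sum[OF integrable_mult_right[OF Qi]]
  show "integrable lambda2 ?g" by (rule ds(2))
  have "(\<integral>z. ?g z \<partial>lambda2) = (\<Sum>i=1..k. \<Sum>j=1..k. \<integral>z. (real k)\<^sup>2 * A (i, j) * indicator (?Q i j) z \<partial>lambda2)"
    by (rule ds(1))
  also have "\<dots> = (\<Sum>i=1..k. \<Sum>j=1..k. A (i, j))"
  proof (intro sum.cong refl)
    fix i j assume ij: "i \<in> {1..k}" "j \<in> {1..k}"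
    have "(\<integral>z. (real k)\<^sup>2 * A (i, j) * indicator (?Q i j) z \<partial>lambda2) = (real k)\<^sup>2 * A (i, j) * (1 / (real k)\<^sup>2)"
      unfolding indicator_cell_integral[OF k ij, symmetric] by (rule integral_mult_right_zero)
    then show "(\<integral>z. (real k)\<^sup>2 * A (i, j) * indicator (?Q i j) z \<partial>lambda2) = A (i, j)" using k by simp
  qed
  finally show "(\<integral>z. ?g z \<partial>lambda2) = 1" using A(3) by simp
qed

lemma graph_sgraphon_in_sgraphons:
  assumes G: "graph G" "arcs G \<noteq> {}" "bij_betw e {1..card (verts G)} (verts G)"
  shows "graph_sgraphon G e \<in> sgraphons"
proof -
  interpret graph G by fact
  let ?k = "card (verts G)" and ?A = "adjacency_matrix G e"
  obtain a where "a \<in> arcs G" using G(2) by blast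
  then have "verts G \<noteq> {}" using tail_in_verts by blast
  then have k: "?k \<ge> 1" using finite_verts by (simp add: Suc_le_eq card_gt_0_iff)
  note pos = l1_norm_adjacency_pos[OF G]
  have na: "normalized_adjacency G e (i, j) = of_bool (e i \<rightarrow>\<^bsub>G\<^esub> e j) / l1_norm ?k ?A"
    if "i \<in> {1..?k}" "j \<in> {1..?k}" for i j
    using that by (simp add: normalized_adjacency_def adjacency_matrix_def)
  show ?thesis
    unfolding graph_sgraphon_def
  proof (rule matrix_measure_in_sgraphons[OF k])
    fix i j assume ij: "i \<in> {1..?k}" "j \<in> {1..?k}"
    show "0 \<le> normalized_adjacency G e (i, j)" using pos by (simp add: na[OF ij])
    have "e i \<rightarrow>\<^bsub>G\<^esub> e j \<longleftrightarrow> e j \<rightarrow>\<^bsub>G\<^esub> e i" using arcs_ends_symmetric[OF sym_arcs] by blast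
    then show "normalized_adjacency G e (j, i) = normalized_adjacency G e (i, j)"
      by (simp only: na[OF ij] na[OF ij(2,1)])
  next
    have "(\<Sum>i=1..?k. \<Sum>j=1..?k. normalized_adjacency G e (i, j)) =
        (\<Sum>i=1..?k. \<Sum>j=1..?k. \<bar>?A (i, j)\<bar>) / l1_norm ?k ?A"
      unfolding sum_divide_distrib by (intro sum.cong refl) (simp add: na adjacency_matrix_apply)
    also have "(\<Sum>i=1..?k. \<Sum>j=1..?k. \<bar>?A (i, j)\<bar>) = l1_norm ?k ?A"
      unfolding l1_norm_def by (simp add: sum.cartesian_product case_prod_beta')
    finally show "(\<Sum>i=1..?k. \<Sum>j=1..?k. normalized_adjacency G e (i, j)) = 1" using pos by simp
  qed
qed

text \<open>Graphs matter only as a source of s-graphons: once their measures lie in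
  \<open>sgraphons\<close>, both implications are instances of statements about arbitrary sequences
  of s-graphons, whatever the enumerations \<open>e n\<close>.\<close>

theorem corollary2:
  fixes G :: "nat \<Rightarrow> ('a, 'b) pre_digraph"
    and e :: "nat \<Rightarrow> nat \<Rightarrow> 'a"
    and \<mu> :: "(real \<times> real) measure"
  assumes "\<And>n. graph (G n)"
    and "\<And>n. arcs (G n) \<noteq> {}"
    and "\<And>n. bij_betw (e n) {1..card (verts (G n))} (verts (G n))"
    and "\<mu> \<in> sgraphons"
  shows "s_convergent G e \<mu> \<longleftrightarrow>
    limitin (vietoris_topology sgraphon_topology) (\<lambda>n. graph_shape (G n) (e n)) (shape \<mu>) sequentially"
proof -
  have G: "graph_sgraphon (G n) (e n) \<in> sgraphons" for n
    by (rule graph_sgraphon_in_sgraphons[OF assms(1-3)])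
  show ?thesis
    unfolding s_convergent_def graph_shape_def
  proof (intro iffI allI impI)
    assume "\<forall>k\<ge>1. (\<lambda>n. hausdorff_distance (matrix_dist k) (k_shape k (graph_sgraphon (G n) (e n))) (k_shape k \<mu>)) \<longlonglongrightarrow> 0"
    then show "limitin (vietoris_topology sgraphon_topology) (\<lambda>n. shape (graph_sgraphon (G n) (e n))) (shape \<mu>) sequentially"
      by (intro k_shapes_imp_shapes G assms(4)) blast
  next
    fix k :: nat
    assume "limitin (vietoris_topology sgraphon_topology) (\<lambda>n. shape (graph_sgraphon (G n) (e n))) (shape \<mu>) sequentially"
      and "k \<ge> 1"
    then show "(\<lambda>n. hausdorff_distance (matrix_dist k) (k_shape k (graph_sgraphon (G n) (e n))) (k_shape k \<mu>)) \<longlonglongrightarrow> 0"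
      by (rule shapes_imp_k_shapes[OF G assms(4)])
  qed
qed

end
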